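(* Let $M\subset\mathbb{C}^{n+1}$, $n\geq 2$, be a quadric given in coordinates $(z,w)\in\mathbb{C}^n\times\mathbb{C}$ by $$w = Q(z,\bar z) = z^*Az + \overline{z^tBz} + z^tCz,$$ where $A,B,C$ are complex $n\times n$ matrices with $B$ and $C$ symmetric. Assume that $\bar\partial Q\not\equiv 0$ (equivalently, $A$ and $B$ are not both zero). The following are equivalent. (a) $\operatorname{rank}\begin{bmatrix} A^*\\ B\end{bmatrix}\geq 2$. (b) Whenever $f(z,\bar z)$ is a polynomial that, when considered as a function on $M$ (parametrized by $z$), is a CR function on $M_{\mathit{CR}}$, there exists a unique holomorphic polynomial $F(z,w)$ such that $f$ and $F$ agree on $M$, that is, $f(z,\bar z)=F\bigl(z,Q(z,\bar z)\bigr)$. The weighted degree of $F$, where each $z_j$ has weight one and $w$ has weight two, equals the degree of $f$ (in $z,\bar z$), and if $f$ is homogeneous, then $F$ is weighted homogeneous of the same degree. (c) Whenever $h(z,\bar z)$ is a linear function (a complex linear combination of $z_1,\dots,z_n,\bar z_1,\dots,\bar z_n$) that, when considered as a function on $M$ (parametrized by $z$), is a CR function on $M_{\mathit{CR}}$, then $h$ is holomorphic, that is, it is independent of $\bar z_1,\ldots,\bar z_n$. (d) $M$ is not biholomorphically equivalent to one of the following exceptional cases: (1) $w=\bar z_1z_2+\bar z_1^2$, (2) $w=\bar z_1z_2$, (3) $w=|z_1|^2+a\bar z_1^2$, $a\geq 0$, (4) $w=\bar z_1^2$. Moreover, the exceptional cases (1)–(4) are mutually inequivalent (biholomorphically).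
   Context: Vectors $z\in\mathbb{C}^n$ are columns; $z^t$ is the transpose, $z^*$ the conjugate transpose, and $A^*$ the conjugate transpose of $A$. $\begin{bmatrix} A^* \\ B\end{bmatrix}$ is the $2n\times n$ matrix obtained by stacking $A^*$ on top of $B$. Functions are complex-valued; $Q$ is not assumed real-valued. For a real submanifold $M\subset\mathbb{C}^{n+1}$ and $p\in M$, put $$T^{0,1}_pM = (\mathbb{C}\otimes T_pM)\cap \operatorname{span}_{\mathbb{C}}\Bigl\{\tfrac{\partial}{\partial \bar z_1}\big|_p,\ldots,\tfrac{\partial}{\partial \bar z_n}\big|_p,\tfrac{\partial}{\partial \bar w}\big|_p\Bigr\}.$$ $M_{\mathit{CR}}\subset M$ is the set of CR points, i.e. points near which $\dim_{\mathbb{C}} T^{0,1}_pM$ is constant as $p\in M$ varies. A CR vector field is a vector field on $M$ with values in $T^{0,1}M$. A function is CR (on $M_{\mathit{CR}}$) if it is annihilated by every CR vector field (on $M_{\mathit{CR}}$). Since $M$ is a graph over $z$, a function $f(z,\bar z)$ is regarded as the function on $M$ whose value at $(z,Q(z,\bar z))$ is $f(z,\bar z)$. The exceptional quadrics in (d) are understood as submanifolds of $\mathbb{C}^{n+1}$ (with $z_3,\dots,z_n$ not appearing in the equation). Two submanifolds through the origin are biholomorphically equivalent if some biholomorphic map between neighborhoods of the origin, fixing the origin, takes one to the other near the origin. "Mutually inequivalent" means that no quadric from one of the items (1)–(4) is equivalent to a quadric from a different item. *)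

theory Defs
  imports "HOL-Analysis.Analysis" "HOL-Library.Poly_Mapping"
begin

section \<open>Points of complex (n+1)-space\<close>

text \<open>A point (z, w) has z indexed by the finite type 'n, with n = CARD('n).\<close>

type_synonym 'n pt = "(complex ^ 'n) \<times> complex"

definition pt_scale :: "complex \<Rightarrow> 'n::finite pt \<Rightarrow> 'n pt" where
  "pt_scale c p = (c *s fst p, c * snd p)"

definition fun_graph :: "(complex ^ 'n::finite \<Rightarrow> complex) \<Rightarrow> 'n pt set" where
  "fun_graph Q = {(z, w). w = Q z}"

definition adjoint_mat :: "complex ^ 'n ^ 'm \<Rightarrow> complex ^ 'm ^ 'n" where
  "adjoint_mat A = (\<chi> i j. cnj (A $ j $ i))"

definition stack :: "'a ^ 'n ^ 'm \<Rightarrow> 'a ^ 'n ^ 'k \<Rightarrow> 'a ^ 'n ^ ('m + 'k)" where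
  "stack X Y = (\<chi> i. case i of Inl k \<Rightarrow> X $ k | Inr k \<Rightarrow> Y $ k)"

definition quadric_fun ::
  "complex ^ 'n ^ 'n \<Rightarrow> complex ^ 'n ^ 'n \<Rightarrow> complex ^ 'n ^ 'n \<Rightarrow> complex ^ 'n::finite \<Rightarrow> complex" where
  "quadric_fun A B C z =
     (\<Sum>i\<in>UNIV. \<Sum>j\<in>UNIV. cnj (z $ i) * A $ i $ j * z $ j)
   + cnj (\<Sum>i\<in>UNIV. \<Sum>j\<in>UNIV. z $ i * B $ i $ j * z $ j)
   + (\<Sum>i\<in>UNIV. \<Sum>j\<in>UNIV. z $ i * C $ i $ j * z $ j)"

text \<open>The coefficient of d zbar_j in the (0,1)-form dbar Q at z, i.e. half of
  (d/dx_j + i d/dy_j) Q.\<close>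

definition dbar :: "(complex ^ 'n::finite \<Rightarrow> complex) \<Rightarrow> complex ^ 'n \<Rightarrow> 'n \<Rightarrow> complex" where
  "dbar Q z j = (frechet_derivative Q (at z) (axis j 1)
                 + \<i> * frechet_derivative Q (at z) (axis j \<i>)) / 2"


section \<open>Smoothness\<close>

text \<open>On an open set U of a finite-dimensional space this is membership in the class of
  k times continuously differentiable maps.\<close>

primrec Ck_on ::
  "nat \<Rightarrow> ('a::real_normed_vector \<Rightarrow> 'b::real_normed_vector) \<Rightarrow> 'a set \<Rightarrow> bool" where
  "Ck_on 0 f U \<longleftrightarrow> continuous_on U f"
| "Ck_on (Suc k) f U \<longleftrightarrow>
     (\<forall>x\<in>U. f differentiable (at x)) \<and> (\<forall>v. Ck_on k (\<lambda>x. frechet_derivative f (at x) v) U)"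

text \<open>Smoothness on an arbitrary subset S: locally the restriction of a smooth map on an open
  set.  For an embedded submanifold this is the intrinsic notion.\<close>

definition smooth_on :: "('a::real_normed_vector \<Rightarrow> 'b::real_normed_vector) \<Rightarrow> 'a set \<Rightarrow> bool" where
  "smooth_on f S \<longleftrightarrow>
     (\<forall>p\<in>S. \<exists>U g. open U \<and> p \<in> U \<and> (\<forall>k. Ck_on k g U) \<and> (\<forall>q\<in>S \<inter> U. g q = f q))"


section \<open>CR structure\<close>

text \<open>The complexification of a real vector space V is modelled on pairs: (u, v) stands for the
  formal combination u + i v, where i is the new imaginary unit of the complexification and not
  a complex structure that V may already carry.\<close>

definition cx_scale :: "complex \<Rightarrow> 'a::real_vector \<times> 'a \<Rightarrow> 'a \<times> 'a" where
  "cx_scale c X = (Re c *\<^sub>R fst X - Im c *\<^sub>R snd X, Re c *\<^sub>R snd X + Im c *\<^sub>R fst X)"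

global_interpretation cx: vector_space "cx_scale :: complex \<Rightarrow> 'a::real_vector \<times> 'a \<Rightarrow> 'a \<times> 'a"
  by unfold_locales (auto simp: cx_scale_def algebra_simps)

text \<open>The tangent space of a submanifold, as the set of velocities of curves in it.\<close>

definition tangent_space :: "'a::real_normed_vector set \<Rightarrow> 'a \<Rightarrow> 'a set" where
  "tangent_space M p =
     {v. \<exists>\<gamma>. \<gamma> 0 = p \<and> (\<forall>t::real. \<gamma> t \<in> M) \<and> (\<gamma> has_vector_derivative v) (at 0)}"

text \<open>The vector fields d/dzbar_j and d/dwbar, each being half of d/dx + i d/dy.\<close>

definition d_zbar :: "'n::finite \<Rightarrow> 'n pt \<times> 'n pt" where
  "d_zbar j = ((1/2) *\<^sub>R (axis j 1, 0), (1/2) *\<^sub>R (axis j \<i>, 0))"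

definition d_wbar :: "'n::finite pt \<times> 'n pt" where
  "d_wbar = ((1/2) *\<^sub>R (0, 1), (1/2) *\<^sub>R (0, \<i>))"

definition T01 :: "'n::finite pt set \<Rightarrow> 'n pt \<Rightarrow> ('n pt \<times> 'n pt) set" where
  "T01 M p = (tangent_space M p \<times> tangent_space M p) \<inter> cx.span (insert d_wbar (range d_zbar))"

definition CR_points :: "'n::finite pt set \<Rightarrow> 'n pt set" where
  "CR_points M =
     {p \<in> M. \<exists>U. open U \<and> p \<in> U \<and> (\<forall>q\<in>M \<inter> U. cx.dim (T01 M q) = cx.dim (T01 M p))}"

text \<open>CR vector fields on the submanifold of CR points.\<close>

definition CR_vector_field :: "'n::finite pt set \<Rightarrow> ('n pt \<Rightarrow> 'n pt \<times> 'n pt) \<Rightarrow> bool" where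
  "CR_vector_field M X \<longleftrightarrow>
     smooth_on X (CR_points M) \<and> (\<forall>p\<in>CR_points M. X p \<in> T01 M p)"

text \<open>Derivative at p of a function on M along a complexified tangent vector.  A derivative
  within M need not be unique as a linear map on the ambient space, but its values on vectors
  tangent to M are, and it depends on the values of g on M only.\<close>

definition apply_vector ::
  "'n::finite pt set \<Rightarrow> 'n pt \<times> 'n pt \<Rightarrow> ('n pt \<Rightarrow> complex) \<Rightarrow> 'n pt \<Rightarrow> complex" where
  "apply_vector M v g p =
     frechet_derivative g (at p within M) (fst v) + \<i> * frechet_derivative g (at p within M) (snd v)"

definition CR_function :: "'n::finite pt set \<Rightarrow> ('n pt \<Rightarrow> complex) \<Rightarrow> bool" where
  "CR_function M g \<longleftrightarrow>
     (\<forall>p\<in>CR_points M. g differentiable (at p within M)) \<and>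
     (\<forall>X. CR_vector_field M X \<longrightarrow> (\<forall>p\<in>CR_points M. apply_vector M (X p) g p = 0))"


section \<open>Polynomials\<close>

text \<open>Complex polynomials in variables indexed by 'v: finitely supported maps from exponent
  vectors to coefficients.\<close>

type_synonym 'v mpol = "('v \<Rightarrow>\<^sub>0 nat) \<Rightarrow>\<^sub>0 complex"

definition mpol_eval :: "'v::finite mpol \<Rightarrow> ('v \<Rightarrow> complex) \<Rightarrow> complex" where
  "mpol_eval P x =
     (\<Sum>m\<in>Poly_Mapping.keys P. Poly_Mapping.lookup P m * (\<Prod>v\<in>UNIV. x v ^ Poly_Mapping.lookup m v))"

definition exp_weight :: "('v::finite \<Rightarrow> nat) \<Rightarrow> ('v \<Rightarrow>\<^sub>0 nat) \<Rightarrow> nat" where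
  "exp_weight wt m = (\<Sum>v\<in>UNIV. wt v * Poly_Mapping.lookup m v)"

text \<open>The zero polynomial gets degree 0 and is homogeneous of every degree.\<close>

definition weighted_degree :: "('v::finite \<Rightarrow> nat) \<Rightarrow> 'v mpol \<Rightarrow> nat" where
  "weighted_degree wt P = (if P = 0 then 0 else Max (exp_weight wt ` Poly_Mapping.keys P))"

definition weighted_homogeneous :: "('v::finite \<Rightarrow> nat) \<Rightarrow> nat \<Rightarrow> 'v mpol \<Rightarrow> bool" where
  "weighted_homogeneous wt d P \<longleftrightarrow> (\<forall>m\<in>Poly_Mapping.keys P. exp_weight wt m = d)"

text \<open>A polynomial f(z, zbar) has variables Inl j for z_j and Inr j for zbar_j; a holomorphic
  polynomial F(z, w) has variables Some j for z_j and None for w.\<close>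

definition eval_zzbar :: "('n::finite + 'n) mpol \<Rightarrow> complex ^ 'n \<Rightarrow> complex" where
  "eval_zzbar f z = mpol_eval f (case_sum (\<lambda>j. z $ j) (\<lambda>j. cnj (z $ j)))"

definition eval_zw :: "('n::finite option) mpol \<Rightarrow> complex ^ 'n \<Rightarrow> complex \<Rightarrow> complex" where
  "eval_zw F z w = mpol_eval F (case_option w (\<lambda>j. z $ j))"

definition unit_weight :: "'v \<Rightarrow> nat" where
  "unit_weight v = 1"

definition zw_weight :: "'n option \<Rightarrow> nat" where
  "zw_weight v = (case v of None \<Rightarrow> 2 | Some j \<Rightarrow> 1)"

definition linear_zzbar :: "complex ^ 'n \<Rightarrow> complex ^ 'n \<Rightarrow> complex ^ 'n::finite \<Rightarrow> complex" where
  "linear_zzbar a b z = (\<Sum>j\<in>UNIV. a $ j * z $ j) + (\<Sum>j\<in>UNIV. b $ j * cnj (z $ j))"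


section \<open>Biholomorphic equivalence\<close>

definition holomorphic_map_on :: "('n::finite pt \<Rightarrow> 'n pt) \<Rightarrow> 'n pt set \<Rightarrow> bool" where
  "holomorphic_map_on \<Phi> U \<longleftrightarrow>
     (\<forall>p\<in>U. \<exists>L. (\<Phi> has_derivative L) (at p) \<and> (\<forall>c v. L (pt_scale c v) = pt_scale c (L v)))"

definition biholomorphically_equivalent :: "'n::finite pt set \<Rightarrow> 'n pt set \<Rightarrow> bool" where
  "biholomorphically_equivalent M N \<longleftrightarrow>
     (\<exists>U V \<Phi> \<Psi>. open U \<and> open V \<and> 0 \<in> U \<and> 0 \<in> V
        \<and> \<Phi> ` U = V \<and> \<Psi> ` V = U
        \<and> (\<forall>p\<in>U. \<Psi> (\<Phi> p) = p) \<and> (\<forall>q\<in>V. \<Phi> (\<Psi> q) = q)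
        \<and> holomorphic_map_on \<Phi> U \<and> holomorphic_map_on \<Psi> V
        \<and> \<Phi> 0 = 0 \<and> \<Phi> ` (M \<inter> U) = N \<inter> V)"

text \<open>The exceptional cases (1)-(4) are the list entries 0 to 3, each a set of submanifolds; the
  indices i and j play the roles of 1 and 2 and are meant to be distinct.\<close>

definition exceptional :: "'n \<Rightarrow> 'n::finite \<Rightarrow> 'n pt set set list" where
  "exceptional i j =
     [{fun_graph (\<lambda>z. cnj (z $ i) * z $ j + (cnj (z $ i))\<^sup>2)},
      {fun_graph (\<lambda>z. cnj (z $ i) * z $ j)},
      {fun_graph (\<lambda>z. complex_of_real ((cmod (z $ i))\<^sup>2) + complex_of_real a * (cnj (z $ i))\<^sup>2) | a. a \<ge> 0},
      {fun_graph (\<lambda>z. (cnj (z $ i))\<^sup>2)}]"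

end

theory Submission
  imports Defs "HOL-Complex_Analysis.Complex_Analysis"
begin

no_notation fps_nth (infixl \<open>$\<close> 75)

text \<open>Write q for the coefficient vector A z + 2 conj (B z) of dbar Q.  The CR points of M are those with
  q nonzero, and there a function f is CR iff dbar f is proportional to q.  If the entries of q span
  at least two dimensions of linear forms in (z, conj z), treated as independent variables, two of
  them are coprime, so dbar f = l q with a polynomial l, which is again CR and of lower degree; induction
  on the degree gives f = F(z, Q).  If the span is one-dimensional, q is a scalar function times a
  constant vector b, and b . conj z is a CR function that is not holomorphic; in suitable linear
  coordinates such a quadric is one of the four exceptional ones.

  Conversely, comparing second-order terms at the origin, a biholomorphic equivalence of quadrics
  yields an invertible linear L and a constant c with Q' (L z) = c Q z + (holomorphic quadratic form).
  Hence the pairing of q(z) with conj v is an invariant of the quadric up to scaling and linear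
  substitution, and so are its linear and antilinear parts in z.  They determine the rank and separate
  the exceptional cases.\<close>

section \<open>Polynomial functions\<close>

text \<open>All algebra is done with z and conj z as independent variables. CR conditions are known
  only at the points (z, conj z), but these form a totally real set of full dimension, so polynomial
  identities spread from them to all points. Only then can one divide by linear forms in (z, conj
  z), cancel them, and set conj z = 0.

  On the geometric side the obstacle is that an equivalence is merely a local map with complex
  linear derivatives, so its second-order terms have to be extracted by hand. Restricting to points
  (s z, w) reduces this to two complex variables. Since w counts as second order, along w = s^2 k
  only the pure s-part to second order and the w-part to first order survive in the limit. The graph
  equation fixes this limit for real s, whereas the pure s-part scales correctly under complex s.
  This discrepancy is exactly what separates Q from the holomorphic remainder.\<close>

inductive polyfun_deg :: "nat \<Rightarrow> (('v::finite \<Rightarrow> complex) \<Rightarrow> complex) \<Rightarrow> bool" where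
  const: "polyfun_deg d (\<lambda>x. c)"
| add: "polyfun_deg d f \<Longrightarrow> polyfun_deg d g \<Longrightarrow> polyfun_deg d (\<lambda>x. f x + g x)"
| mult_var: "polyfun_deg d f \<Longrightarrow> polyfun_deg (Suc d) (\<lambda>x. x v * f x)"
| weaken: "polyfun_deg d f \<Longrightarrow> polyfun_deg (Suc d) f"

lemma polyfun_deg_mono: "polyfun_deg d f \<Longrightarrow> d \<le> e \<Longrightarrow> polyfun_deg e f"
  by (induction e) (auto simp: le_Suc_eq intro: weaken)

lemma polyfun_deg_cmult: "polyfun_deg d f \<Longrightarrow> polyfun_deg d (\<lambda>x. c * f x)"
proof (induction rule: polyfun_deg.induct)
  case (add d f g)
  then show ?case using polyfun_deg.add[OF add.IH] by (simp add: algebra_simps)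
next
  case (mult_var d f v)
  then show ?case using polyfun_deg.mult_var[OF mult_var.IH, of v] by (simp add: algebra_simps)
qed (auto intro: polyfun_deg.intros)

lemma polyfun_deg_sum:
  "finite S \<Longrightarrow> (\<And>s. s \<in> S \<Longrightarrow> polyfun_deg d (f s)) \<Longrightarrow> polyfun_deg d (\<lambda>x. \<Sum>s\<in>S. f s x)"
  by (induction rule: finite_induct) (auto intro: polyfun_deg.intros)

lemma polyfun_deg_0: "polyfun_deg d f \<Longrightarrow> d = 0 \<Longrightarrow> \<exists>c. f = (\<lambda>x. c)"
  by (induction rule: polyfun_deg.induct) auto

definition polyfun :: "(('v::finite \<Rightarrow> complex) \<Rightarrow> complex) \<Rightarrow> bool" where
  "polyfun f \<longleftrightarrow> (\<exists>d. polyfun_deg d f)"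

lemma polyfun_const: "polyfun (\<lambda>x. c)"
  by (auto simp: polyfun_def intro: polyfun_deg.intros)

lemma polyfun_add: assumes "polyfun f" "polyfun g" shows "polyfun (\<lambda>x. f x + g x)"
proof -
  obtain d e where "polyfun_deg d f" "polyfun_deg e g"
    using assms by (auto simp: polyfun_def)
  then have "polyfun_deg (max d e) f" "polyfun_deg (max d e) g"
    by (auto intro: polyfun_deg_mono)
  then show ?thesis by (auto simp: polyfun_def intro: polyfun_deg.intros)
qed

lemma polyfun_mult_var: "polyfun f \<Longrightarrow> polyfun (\<lambda>x. x v * f x)"
  by (auto simp: polyfun_def intro: polyfun_deg.intros)

lemma polyfun_var: "polyfun (\<lambda>x. x v)"
  using polyfun_mult_var[OF polyfun_const[of 1], of v] by simp

lemma polyfun_induct [consumes 1, case_names const add mult_var]: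
  assumes "polyfun f" "\<And>c. P (\<lambda>x. c)"
    and "\<And>f g. polyfun f \<Longrightarrow> polyfun g \<Longrightarrow> P f \<Longrightarrow> P g \<Longrightarrow> P (\<lambda>x. f x + g x)"
    and "\<And>f v. polyfun f \<Longrightarrow> P f \<Longrightarrow> P (\<lambda>x. x v * f x)"
  shows "P f"
proof -
  obtain d where "polyfun_deg d f" using assms(1) by (auto simp: polyfun_def)
  then have "polyfun f \<and> P f"
    by (induction rule: polyfun_deg.induct)
      (auto intro: assms(2-) polyfun_const polyfun_add polyfun_mult_var)
  then show ?thesis ..
qed

lemma polyfun_mult: "polyfun f \<Longrightarrow> polyfun g \<Longrightarrow> polyfun (\<lambda>x. f x * g x)"
proof (induction rule: polyfun_induct)
  case (const c)
  then show ?case by (auto simp: polyfun_def intro: polyfun_deg_cmult)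
next
  case (add f1 f2)
  then show ?case using polyfun_add[OF add.IH] by (simp add: algebra_simps)
next
  case (mult_var f v)
  then show ?case using polyfun_mult_var[OF mult_var.IH, of v] by (simp add: algebra_simps)
qed

lemma polyfun_minus: "polyfun f \<Longrightarrow> polyfun (\<lambda>x. - f x)"
  using polyfun_mult[OF polyfun_const[of "-1"]] by simp

lemma polyfun_diff: "polyfun f \<Longrightarrow> polyfun g \<Longrightarrow> polyfun (\<lambda>x. f x - g x)"
  using polyfun_add[OF _ polyfun_minus, of f g] by simp

lemma polyfun_sum: "finite S \<Longrightarrow> (\<And>s. s \<in> S \<Longrightarrow> polyfun (f s)) \<Longrightarrow> polyfun (\<lambda>x. \<Sum>s\<in>S. f s x)"
  by (induction rule: finite_induct) (auto intro: polyfun_const polyfun_add)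

lemma polyfun_prod: "finite S \<Longrightarrow> (\<And>s. s \<in> S \<Longrightarrow> polyfun (f s)) \<Longrightarrow> polyfun (\<lambda>x. \<Prod>s\<in>S. f s x)"
  by (induction rule: finite_induct) (auto intro: polyfun_const polyfun_mult)

lemma polyfun_power: "polyfun f \<Longrightarrow> polyfun (\<lambda>x. f x ^ n)"
  by (induction n) (auto intro: polyfun_const polyfun_mult)

lemmas polyfun_intros = polyfun_const polyfun_var polyfun_add polyfun_mult polyfun_minus
  polyfun_diff polyfun_sum polyfun_prod polyfun_power

lemma polyfun_compose: "polyfun f \<Longrightarrow> (\<And>v. polyfun (s v)) \<Longrightarrow> polyfun (\<lambda>y. f (\<lambda>v. s v y))"
  by (induction rule: polyfun_induct) (auto intro: polyfun_intros)

section \<open>Identity theorems for polynomial functions\<close>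

lemma polyfun_line:
  "polyfun f \<Longrightarrow> \<exists>p. \<forall>t. f (x(v := t)) = poly p t"
proof (induction rule: polyfun_induct)
  case (const c)
  then show ?case by (intro exI[of _ "[:c:]"]) simp
next
  case (add f g)
  then obtain p q where "\<forall>t. f (x(v := t)) = poly p t" "\<forall>t. g (x(v := t)) = poly q t" by blast
  then show ?case by (intro exI[of _ "p + q"]) (simp del: fun_upd_apply)
next
  case (mult_var f u)
  then obtain p where "\<forall>t. f (x(v := t)) = poly p t" by blast
  then show ?case by (intro exI[of _ "(if u = v then [:0, 1:] else [:x u:]) * p"])
      (cases "u = v"; simp add: fun_upd_same fun_upd_other del: fun_upd_apply)
qed

lemma polyfun_line_infinite_zeros:
  assumes "polyfun f" "infinite T" "\<And>t. t \<in> T \<Longrightarrow> f (x(v := t)) = 0"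
  shows "f (x(v := t)) = 0"
proof -
  obtain p where p: "\<forall>t. f (x(v := t)) = poly p t" using polyfun_line[OF assms(1)] by blast
  then have "T \<subseteq> {t. poly p t = 0}" using assms(3) by auto
  then have "p = 0" using assms(2) poly_roots_finite finite_subset by blast
  then show ?thesis using p by simp
qed

lemma infinite_range_of_real: "infinite (range complex_of_real)"
  using finite_imageD[of complex_of_real UNIV] by (auto simp: inj_def infinite_UNIV_char_0)

text \<open>The variables are freed one at a time: S is the set of those already allowed to be
  complex, and a polynomial in one more variable that vanishes on the real line vanishes
  everywhere.\<close>

lemma polyfun_zero_on_reals:
  assumes f: "polyfun f" and real: "\<And>x. (\<And>v. x v \<in> \<real>) \<Longrightarrow> f x = 0"
  shows "f x = 0"
proof -
  have "finite S \<Longrightarrow> \<forall>x. (\<forall>v. v \<notin> S \<longrightarrow> x v \<in> \<real>) \<longrightarrow> f x = 0" for S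
  proof (induction S rule: finite_induct)
    case empty
    then show ?case using real by auto
  next
    case (insert u S)
    show ?case
    proof (intro allI impI)
      fix x :: "'a \<Rightarrow> complex" assume x: "\<forall>v. v \<notin> insert u S \<longrightarrow> x v \<in> \<real>"
      have "f (x(u := t)) = 0" if "t \<in> \<real>" for t
        using insert.IH x that by auto
      moreover have "infinite (\<real> :: complex set)"
        using infinite_range_of_real by (simp add: Reals_def)
      ultimately have "f (x(u := x u)) = 0"
        using polyfun_line_infinite_zeros[OF f, of \<real>] by blast
      then show "f x = 0" by simp
    qed
  qed
  from this[of UNIV] show ?thesis by simp
qed

definition zz :: "complex ^ 'n::finite \<Rightarrow> 'n + 'n \<Rightarrow> complex" where
  "zz z = case_sum (\<lambda>j. z $ j) (\<lambda>j. cnj (z $ j))"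

lemma zz_simps [simp]: "zz z (Inl j) = z $ j" "zz z (Inr j) = cnj (z $ j)"
  by (simp_all add: zz_def)

text \<open>The substitution (a, b) \<mapsto> (a + i b, a - i b) in independent variables is an
  invertible linear map that takes real points to points (z, conj z), so the identity theorem on
  real points applies.\<close>

lemma polyfun_zero_on_zz:
  assumes f: "polyfun f" and zz: "\<And>z. f (zz z) = 0"
  shows "f x = 0"
proof -
  define s :: "'a + 'a \<Rightarrow> ('a + 'a \<Rightarrow> complex) \<Rightarrow> complex" where
    "s = case_sum (\<lambda>j y. y (Inl j) + \<i> * y (Inr j)) (\<lambda>j y. y (Inl j) - \<i> * y (Inr j))"
  have s: "polyfun (s v)" for v
    by (cases v) (auto simp: s_def intro!: polyfun_intros)
  \<comment> \<open>The preimage of x under the substitution, so that the value obtained is the one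
    at x.\<close>
  define y where "y = case_sum (\<lambda>j. (x (Inl j) + x (Inr j)) / 2) (\<lambda>j. (x (Inl j) - x (Inr j)) / (2 * \<i>))"
  have "(\<lambda>y. f (\<lambda>v. s v y)) y = 0"
  proof (rule polyfun_zero_on_reals[OF polyfun_compose[OF f s]])
    fix y :: "'a + 'a \<Rightarrow> complex" assume y: "\<And>v. y v \<in> \<real>"
    have "(\<lambda>v. s v y) = zz (\<chi> j. y (Inl j) + \<i> * y (Inr j))"
      using y by (auto simp: s_def zz_def fun_eq_iff Reals_cnj_iff split: sum.split)
    then show "f (\<lambda>v. s v y) = 0" using zz by simp
  qed
  moreover have "(\<lambda>v. s v y) = x"
    by (auto simp: s_def y_def fun_eq_iff field_simps split: sum.split)
  ultimately show ?thesis by simp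
qed

text \<open>A line in the direction of u meets the hyperplane in a single point because the
  coefficient of u is nonzero, so f has infinitely many zeros on it.\<close>

lemma polyfun_zero_off_hyperplane:
  assumes f: "polyfun f" and c: "c u \<noteq> 0"
    and z: "\<And>x. (\<Sum>v\<in>UNIV. c v * x v) \<noteq> 0 \<Longrightarrow> f x = 0"
  shows "f x = 0"
proof -
  have e: "(\<Sum>v\<in>UNIV. c v * (x(u := t)) v) = c u * t + (\<Sum>v\<in>UNIV - {u}. c v * x v)" for t
    by (subst sum.remove[of _ u]) auto
  have "infinite (UNIV - {- (\<Sum>v\<in>UNIV - {u}. c v * x v) / c u} :: complex set)"
    by (simp add: infinite_UNIV_char_0)
  moreover have "f (x(u := t)) = 0" if "t \<in> UNIV - {- (\<Sum>v\<in>UNIV - {u}. c v * x v) / c u}" for t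
    using that c by (intro z) (auto simp: e field_simps add_eq_0_iff simp del: fun_upd_apply)
  ultimately have "f (x(u := x u)) = 0"
    by (rule polyfun_line_infinite_zeros[OF f])
  then show ?thesis by simp
qed

section \<open>Coordinate derivatives and antiderivatives\<close>

definition pd :: "'v \<Rightarrow> (('v \<Rightarrow> complex) \<Rightarrow> complex) \<Rightarrow> ('v \<Rightarrow> complex) \<Rightarrow> complex" where
  "pd v f x = deriv (\<lambda>t. f (x(v := t))) (x v)"

lemma polyfun_has_pd:
  assumes "polyfun f"
  shows "((\<lambda>t. f (x(v := t))) has_field_derivative pd v f (x(v := t))) (at t)"
proof -
  obtain p where p: "\<And>t. f (x(v := t)) = poly p t" using polyfun_line[OF assms] by blast
  then have "(\<lambda>t. f (x(v := t))) field_differentiable (at t)"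
    by (simp add: field_differentiable_def) (meson poly_DERIV)
  then show ?thesis
    by (simp add: pd_def field_differentiable_derivI)
qed

lemma polyfun_has_pd': "polyfun f \<Longrightarrow> ((\<lambda>t. f (x(v := t))) has_field_derivative pd v f x) (at (x v))"
  using polyfun_has_pd[of f x v "x v"] by simp

lemma pd_const [simp]: "pd v (\<lambda>x. c) = (\<lambda>x. 0)"
  by (simp add: pd_def fun_eq_iff)

lemma pd_var [simp]: "pd v (\<lambda>x. x u) = (\<lambda>x. if u = v then 1 else 0)"
  by (auto simp: pd_def fun_eq_iff)

lemma pd_add: "polyfun f \<Longrightarrow> polyfun g \<Longrightarrow> pd v (\<lambda>x. f x + g x) = (\<lambda>x. pd v f x + pd v g x)"
  unfolding fun_eq_iff pd_def[of v "\<lambda>x. f x + g x"]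
  by (auto intro!: DERIV_imp_deriv DERIV_add polyfun_has_pd')

lemma pd_mult: "polyfun f \<Longrightarrow> polyfun g \<Longrightarrow>
    pd v (\<lambda>x. f x * g x) = (\<lambda>x. pd v f x * g x + f x * pd v g x)"
  unfolding fun_eq_iff pd_def[of v "\<lambda>x. f x * g x"]
  by (auto intro!: DERIV_imp_deriv derivative_eq_intros polyfun_has_pd')

lemma pd_cmult: "polyfun f \<Longrightarrow> pd v (\<lambda>x. c * f x) = (\<lambda>x. c * pd v f x)"
  using pd_mult[OF polyfun_const] by simp

lemma pd_mult_var:
  "polyfun f \<Longrightarrow> pd v (\<lambda>x. x u * f x) = (\<lambda>x. (if u = v then f x else 0) + x u * pd v f x)"
  using pd_mult[OF polyfun_var[of u], of f v] by (auto simp: fun_eq_iff)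

lemma pd_diff: "polyfun f \<Longrightarrow> polyfun g \<Longrightarrow> pd v (\<lambda>x. f x - g x) = (\<lambda>x. pd v f x - pd v g x)"
  using pd_add[OF _ polyfun_minus, of f g v] pd_cmult[of g v "-1"] by simp

lemma pd_sum: "finite S \<Longrightarrow> (\<And>s. s \<in> S \<Longrightarrow> polyfun (f s)) \<Longrightarrow>
    pd v (\<lambda>x. \<Sum>s\<in>S. f s x) = (\<lambda>x. \<Sum>s\<in>S. pd v (f s) x)"
  by (induction rule: finite_induct) (auto simp: pd_add polyfun_sum)

lemma polyfun_deg_pd: "polyfun_deg d f \<Longrightarrow> polyfun_deg (d - 1) (pd v f)"
proof (induction rule: polyfun_deg.induct)
  case (const d c)
  then show ?case by (auto intro: polyfun_deg.intros)
next
  case (add d f g)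
  then have "polyfun f" "polyfun g" by (auto simp: polyfun_def)
  then show ?case using add.IH by (simp add: pd_add polyfun_deg.add)
next
  case (mult_var d f u)
  have "polyfun_deg d (\<lambda>x. x u * pd v f x)"
  proof (cases d)
    case 0
    then obtain c where "f = (\<lambda>x. c)" using polyfun_deg_0 mult_var by blast
    then show ?thesis by (auto intro: polyfun_deg.intros)
  next
    case (Suc e)
    then show ?thesis using mult_var polyfun_deg.mult_var[of e "pd v f"] by simp
  qed
  moreover have "polyfun_deg d (\<lambda>x. if u = v then f x else 0)"
    using mult_var by (cases "u = v") (auto intro: polyfun_deg.intros)
  moreover have "polyfun f" using mult_var by (auto simp: polyfun_def)
  ultimately show ?case by (simp add: pd_mult_var polyfun_deg.add)
next
  case (weaken d f)
  then show ?case using polyfun_deg_mono[of "d - 1" "pd v f" d] by simp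
qed

lemma polyfun_pd: "polyfun f \<Longrightarrow> polyfun (pd v f)"
  using polyfun_deg_pd by (auto simp: polyfun_def)

lemma pd_commute: "polyfun f \<Longrightarrow> pd u (pd v f) = pd v (pd u f)"
proof (induction rule: polyfun_induct)
  case (add f g)
  then show ?case by (simp add: pd_add polyfun_pd)
next
  case (mult_var f w)
  have "polyfun (\<lambda>x. if w = a then f x else 0)" for a
    using mult_var by (cases "w = a") (auto intro: polyfun_intros)
  moreover have "pd b (\<lambda>x. if w = a then f x else 0) = (\<lambda>x. if w = a then pd b f x else 0)" for a b
    by (cases "w = a") auto
  ultimately show ?case using mult_var
    by (simp add: pd_mult_var pd_add polyfun_pd polyfun_mult polyfun_var fun_eq_iff)
qed simp

lemma polyfun_fixed_if_pd_0:
  assumes f: "polyfun f" and z: "\<And>v x. v \<in> S \<Longrightarrow> pd v f x = 0" and e: "\<And>v. v \<notin> S \<Longrightarrow> x v = y v"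
  shows "f x = f y"
proof -
  have "finite T \<Longrightarrow> T \<subseteq> S \<Longrightarrow> \<forall>x y. (\<forall>v. v \<notin> T \<longrightarrow> x v = y v) \<longrightarrow> f x = f y" for T
  proof (induction T rule: finite_induct)
    case empty
    then have "x = y" if "\<forall>v. v \<notin> {} \<longrightarrow> x v = y v" for x y :: "'a \<Rightarrow> complex" using that by auto
    then show ?case by blast
  next
    case (insert u T)
    show ?case
    proof (intro allI impI)
      fix x y :: "'a \<Rightarrow> complex" assume xy: "\<forall>v. v \<notin> insert u T \<longrightarrow> x v = y v"
      have "((\<lambda>t. f (x(u := t))) has_field_derivative 0) (at t)" for t
        using polyfun_has_pd[OF f, of x u t] z insert.prems by simp
      then have "\<exists>c. \<forall>t. f (x(u := t)) = c"
        using has_field_derivative_zero_constant[of UNIV "\<lambda>t. f (x(u := t))"] by auto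
      then have "f (x(u := x u)) = f (x(u := y u))" by metis
      also have "\<dots> = f y" using insert.IH insert.prems xy
        by (metis fun_upd_apply insert_iff insert_subset)
      finally show "f x = f y" by simp
    qed
  qed
  from this[of S] show ?thesis using e by (simp add: finite_subset[OF subset_UNIV])
qed

lemma polyfun_antiderivative:
  fixes H :: "('n::finite option \<Rightarrow> complex) \<Rightarrow> complex"
  assumes "polyfun H"
  obtains G where "polyfun G" "pd None G = H"
proof -
  \<comment> \<open>The power of w is carried along because antidifferentiation does not commute
    with multiplication by w; a new factor w is absorbed by raising k.\<close>
  from assms have "\<exists>G. polyfun G \<and> pd None G = (\<lambda>x. x None ^ k * H x)" for k
  proof (induction arbitrary: k rule: polyfun_induct)
    case (const c)
    have p: "polyfun (\<lambda>x::'n option \<Rightarrow> complex. c / (of_nat k + 1) * x None ^ Suc k)"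
      by (intro polyfun_intros)
    have "pd None (\<lambda>x::'n option \<Rightarrow> complex. c / (of_nat k + 1) * x None ^ Suc k) x
        = x None ^ k * c" for x
    proof -
      have "of_nat (Suc k) \<noteq> (0::complex)" by (rule of_nat_neq_0)
      then show ?thesis unfolding pd_def fun_upd_same
        by (intro DERIV_imp_deriv derivative_eq_intros refl) (auto simp: field_simps)
    qed
    with p show ?case by blast
  next
    case (add f g)
    obtain F1 where "polyfun F1" "pd None F1 = (\<lambda>x. x None ^ k * f x)" using add.IH(1) by blast
    moreover obtain F2 where "polyfun F2" "pd None F2 = (\<lambda>x. x None ^ k * g x)" using add.IH(2) by blast
    ultimately show ?case
      by (intro exI[of _ "\<lambda>x. F1 x + F2 x"]) (auto simp: pd_add polyfun_add algebra_simps)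
  next
    case (mult_var f v)
    show ?case
    proof (cases v)
      case None
      then show ?thesis using mult_var.IH[of "Suc k"] by (auto simp: algebra_simps)
    next
      case (Some j)
      obtain F1 where "polyfun F1" "pd None F1 = (\<lambda>x. x None ^ k * f x)" using mult_var.IH by blast
      then show ?thesis using Some
        by (intro exI[of _ "\<lambda>x. x v * F1 x"]) (auto simp: pd_mult_var polyfun_mult_var)
    qed
  qed
  from this[of 0] show ?thesis using that by auto
qed

section \<open>Evaluation of polynomials and homogeneous parts\<close>

lemma mpol_eval_superset:
  assumes "finite S" "Poly_Mapping.keys P \<subseteq> S"
  shows "mpol_eval P x = (\<Sum>m\<in>S. Poly_Mapping.lookup P m * (\<Prod>v\<in>UNIV. x v ^ Poly_Mapping.lookup m v))"
  unfolding mpol_eval_def using assms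
  by (intro sum.mono_neutral_left) (auto simp: in_keys_iff)

lemma mpol_eval_add: "mpol_eval (P + R) x = mpol_eval P x + mpol_eval R x"
proof -
  let ?S = "Poly_Mapping.keys P \<union> Poly_Mapping.keys R"
  have "Poly_Mapping.keys (P + R) \<subseteq> ?S" by (rule keys_add)
  then show ?thesis
    by (simp add: mpol_eval_superset[of ?S] lookup_add sum.distrib algebra_simps)
qed

lemma mpol_eval_uminus: "mpol_eval (- P) x = - mpol_eval P x"
  by (simp add: mpol_eval_def sum_negf)

lemma mpol_eval_diff: "mpol_eval (P - R) x = mpol_eval P x - mpol_eval R x"
  using mpol_eval_add[of P "- R" x] by (simp add: mpol_eval_uminus)

lemma mpol_eval_0 [simp]: "mpol_eval 0 x = 0"
  by (simp add: mpol_eval_def)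

lemma mpol_eval_single:
  "mpol_eval (Poly_Mapping.single m c) x = c * (\<Prod>v\<in>UNIV. x v ^ Poly_Mapping.lookup m v)"
  by (subst mpol_eval_superset[of "{m}"]) auto

lemma mpol_eval_sum:
  "finite S \<Longrightarrow> mpol_eval (\<Sum>s\<in>S. P s) x = (\<Sum>s\<in>S. mpol_eval (P s) x)"
  by (induction rule: finite_induct) (auto simp: mpol_eval_add)

lemma polyfun_mpol_eval: "polyfun (mpol_eval P)"
  unfolding mpol_eval_def[abs_def] by (intro polyfun_intros) auto

lemma polyfun_imp_mpol_eval: "polyfun f \<Longrightarrow> \<exists>P. f = mpol_eval P"
proof (induction rule: polyfun_induct)
  case (const c)
  then show ?case
    by (intro exI[of _ "Poly_Mapping.single 0 c"]) (auto simp: fun_eq_iff mpol_eval_single)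
next
  case (add f g)
  then show ?case by (metis (no_types, lifting) ext mpol_eval_add)
next
  case (mult_var f v)
  then obtain P where P: "f = mpol_eval P" by blast
  let ?R = "\<Sum>m\<in>Poly_Mapping.keys P.
    Poly_Mapping.single (m + Poly_Mapping.single v 1) (Poly_Mapping.lookup P m)"
  have "(\<Prod>w\<in>UNIV. x w ^ Poly_Mapping.lookup (Poly_Mapping.single v (1::nat)) w) = x v" for x :: "'a \<Rightarrow> complex"
  proof -
    have "(\<Prod>w\<in>UNIV. x w ^ Poly_Mapping.lookup (Poly_Mapping.single v (1::nat)) w)
      = (\<Prod>w\<in>UNIV. if w = v then x v else 1)"
      by (intro prod.cong) (auto simp: lookup_single when_def)
    then show ?thesis by simp
  qed
  then have "x v * f x = mpol_eval ?R x" for x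
    by (simp add: P mpol_eval_sum mpol_eval_single lookup_add power_add prod.distrib)
      (simp add: mpol_eval_def sum_distrib_left algebra_simps)
  then show ?case by blast
qed

section \<open>Weighted homogeneous parts\<close>

definition hom_part :: "('v::finite \<Rightarrow> nat) \<Rightarrow> nat \<Rightarrow> 'v mpol \<Rightarrow> 'v mpol" where
  "hom_part wt d P = (\<Sum>m\<in>{m\<in>Poly_Mapping.keys P. exp_weight wt m = d}.
     Poly_Mapping.single m (Poly_Mapping.lookup P m))"

lemma lookup_hom_part:
  "Poly_Mapping.lookup (hom_part wt d P) m = (if exp_weight wt m = d then Poly_Mapping.lookup P m else 0)"
  by (auto simp: hom_part_def lookup_sum lookup_single when_def sum.delta in_keys_iff)

lemma hom_part_eq_0_iff:
  "hom_part wt d P = 0 \<longleftrightarrow> d \<notin> exp_weight wt ` Poly_Mapping.keys P"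
  by (auto simp: poly_mapping_eq_iff fun_eq_iff lookup_hom_part in_keys_iff)

lemma weighted_homogeneous_iff:
  "weighted_homogeneous wt d P \<longleftrightarrow> (\<forall>e. e \<noteq> d \<longrightarrow> hom_part wt e P = 0)"
  by (auto simp: weighted_homogeneous_def hom_part_eq_0_iff)

text \<open>The degree is read off from the set of weights with nonzero homogeneous part, so that
  polynomials in different sets of variables can be compared.\<close>

lemma weighted_degree_cong:
  assumes "\<And>d. hom_part wt d P = 0 \<longleftrightarrow> hom_part wt' d P' = 0"
  shows "weighted_degree wt P = weighted_degree wt' P'"
proof -
  have e: "exp_weight wt ` Poly_Mapping.keys P = exp_weight wt' ` Poly_Mapping.keys P'"
    using assms by (auto simp: hom_part_eq_0_iff)
  then have "P = 0 \<longleftrightarrow> P' = 0" by (metis image_is_empty keys_eq_empty)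
  then show ?thesis using e by (simp add: weighted_degree_def)
qed

lemma mpol_eval_scale:
  assumes N: "\<And>m. m \<in> Poly_Mapping.keys P \<Longrightarrow> exp_weight wt m \<le> N"
  shows "mpol_eval P (\<lambda>v. t ^ wt v * x v) = (\<Sum>d\<le>N. t ^ d * mpol_eval (hom_part wt d P) x)"
proof -
  have "mpol_eval P (\<lambda>v. t ^ wt v * x v) = (\<Sum>m\<in>Poly_Mapping.keys P. t ^ exp_weight wt m *
     (Poly_Mapping.lookup P m * (\<Prod>v\<in>UNIV. x v ^ Poly_Mapping.lookup m v)))"
    unfolding mpol_eval_def exp_weight_def
    by (intro sum.cong refl) (simp add: power_mult_distrib prod.distrib power_sum power_mult)
  also have "\<dots> = (\<Sum>d\<le>N. \<Sum>m\<in>{m\<in>Poly_Mapping.keys P. exp_weight wt m = d}. t ^ exp_weight wt m *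
     (Poly_Mapping.lookup P m * (\<Prod>v\<in>UNIV. x v ^ Poly_Mapping.lookup m v)))"
    by (rule sum.group[symmetric]) (use N in auto)
  also have "\<dots> = (\<Sum>d\<le>N. t ^ d * mpol_eval (hom_part wt d P) x)"
    by (intro sum.cong refl)
      (auto simp: hom_part_def mpol_eval_sum mpol_eval_single sum_distrib_left)
  finally show ?thesis .
qed

lemma exp_weight_bound: "\<exists>N. \<forall>m\<in>Poly_Mapping.keys P. exp_weight wt m \<le> N"
  using finite_keys[of P] by (intro exI[of _ "Max (exp_weight wt ` Poly_Mapping.keys P)"]) auto

text \<open>A polynomial in t is determined by its values on an infinite set. The set is left open
  since only real scalings are available for Q.\<close>

lemma power_sums_coeff_eq:
  assumes "infinite T" "\<And>t. t \<in> T \<Longrightarrow> (\<Sum>d\<le>N. t ^ d * a d) = (\<Sum>d\<le>N. t ^ d * (b d :: complex))" "d \<le> N"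
  shows "a d = b d"
proof -
  let ?p = "\<Sum>d\<le>N. monom (a d - b d) d"
  have "poly ?p t = 0" if "t \<in> T" for t
    using assms(2)[OF that] by (simp add: poly_sum poly_monom algebra_simps sum_subtractf)
  then have "T \<subseteq> {t. poly ?p t = 0}" by auto
  then have "?p = 0" using assms(1) poly_roots_finite finite_subset by blast
  then have "coeff ?p d = 0" by simp
  then show ?thesis using assms(3) by (simp add: coeff_sum sum.delta)
qed

lemma hom_part_vanishes:
  assumes "\<And>x. mpol_eval P x = 0"
  shows "mpol_eval (hom_part wt d P) x = 0"
proof -
  obtain N where N: "\<forall>m\<in>Poly_Mapping.keys P. exp_weight wt m \<le> N" using exp_weight_bound by blast
  show ?thesis
  proof (cases "d \<le> N")
    case True
    show ?thesis
      by (rule power_sums_coeff_eq[OF infinite_UNIV_char_0 _ True, of _ "\<lambda>_. 0"])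
        (use assms mpol_eval_scale[of P wt N _ x] N in auto)
  next
    case False
    then have "hom_part wt d P = 0" using N by (auto simp: hom_part_eq_0_iff)
    then show ?thesis by simp
  qed
qed

text \<open>For the weight that is 1 on one variable and 0 elsewhere, a homogeneous part collects
  the monomials with a given exponent in that variable, and it vanishes identically with the
  polynomial. Doing this for every variable isolates one monomial, whose value at (1, ..., 1) is its
  coefficient.\<close>

lemma mpol_eq_0_if_eval_0:
  assumes "\<And>x. mpol_eval P x = 0"
  shows "P = 0"
proof (rule poly_mapping_eqI)
  fix m0
  have "finite S \<Longrightarrow> \<exists>R. (\<forall>x. mpol_eval R x = 0) \<and> (\<forall>m. Poly_Mapping.lookup R m =
    (if \<forall>v\<in>S. Poly_Mapping.lookup m v = Poly_Mapping.lookup m0 v then Poly_Mapping.lookup P m else 0))" for S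
  proof (induction S rule: finite_induct)
    case empty
    then show ?case using assms by auto
  next
    case (insert u S)
    then obtain R where R: "\<And>x. mpol_eval R x = 0" "\<And>m. Poly_Mapping.lookup R m =
      (if \<forall>v\<in>S. Poly_Mapping.lookup m v = Poly_Mapping.lookup m0 v then Poly_Mapping.lookup P m else 0)"
      by blast
    have "exp_weight (\<lambda>v. if v = u then 1 else 0) m = Poly_Mapping.lookup m u" for m
      by (simp add: exp_weight_def sum.delta if_distrib[of "\<lambda>x. x * _"] cong: if_cong)
    then show ?case
      using hom_part_vanishes[OF R(1)]
      by (intro exI[of _ "hom_part (\<lambda>v. if v = u then 1 else 0) (Poly_Mapping.lookup m0 u) R"])
        (auto simp: lookup_hom_part R(2))
  qed
  from this[of UNIV] obtain R where R: "\<And>x. mpol_eval R x = 0" "\<And>m. Poly_Mapping.lookup R m =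
    (if m = m0 then Poly_Mapping.lookup P m else 0)"
    by (auto simp: poly_mapping_eq_iff fun_eq_iff)
  have "R = Poly_Mapping.single m0 (Poly_Mapping.lookup P m0)"
    by (rule poly_mapping_eqI) (simp add: R(2) lookup_single when_def)
  then have "mpol_eval R (\<lambda>_. 1) = Poly_Mapping.lookup P m0"
    by (simp add: mpol_eval_single)
  then show "Poly_Mapping.lookup P m0 = Poly_Mapping.lookup 0 m0" using R by simp
qed

lemma eval_zzbar_eq: "eval_zzbar f z = mpol_eval f (zz z)"
  by (simp add: eval_zzbar_def zz_def)

lemma zzbar_eq_0_if_eval_0: "(\<And>z. eval_zzbar f z = 0) \<Longrightarrow> f = 0"
  using mpol_eq_0_if_eval_0 polyfun_zero_on_zz[OF polyfun_mpol_eval] by (metis eval_zzbar_eq)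

text \<open>Replacing z by t z multiplies the part of degree d of f, and the part of weight d of F
  on the graph, by t^d. Homogeneity of Q holds for real t, which is enough to separate the powers of
  t.\<close>

lemma eval_hom_parts_agree:
  fixes Q :: "complex ^ 'n::finite \<Rightarrow> complex"
  assumes Q: "\<And>t z. Q (complex_of_real t *s z) = (complex_of_real t)\<^sup>2 * Q z"
    and fF: "\<And>z. eval_zzbar f z = eval_zw F z (Q z)"
  shows "eval_zzbar (hom_part unit_weight d f) z = eval_zw (hom_part zw_weight d F) z (Q z)"
proof -
  obtain N1 where N1: "\<forall>m\<in>Poly_Mapping.keys f. exp_weight unit_weight m \<le> N1"
    using exp_weight_bound by blast
  obtain N2 where N2: "\<forall>m\<in>Poly_Mapping.keys F. exp_weight zw_weight m \<le> N2"
    using exp_weight_bound by blast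
  define N where "N = max d (max N1 N2)"
  show ?thesis
  proof (rule power_sums_coeff_eq)
    show "infinite (range complex_of_real)"
      by (rule infinite_range_of_real)
    show "d \<le> N" by (simp add: N_def)
    fix t assume "t \<in> range complex_of_real"
    then obtain r where r: "t = complex_of_real r" by blast
    have "(\<Sum>d\<le>N. t ^ d * eval_zzbar (hom_part unit_weight d f) z)
      = mpol_eval f (\<lambda>v. t ^ unit_weight v * zz z v)"
      unfolding eval_zzbar_eq by (subst mpol_eval_scale[of _ _ N]) (use N1 in \<open>auto simp: N_def\<close>)
    also have "(\<lambda>v. t ^ unit_weight v * zz z v) = zz (t *s z)"
      by (auto simp: fun_eq_iff zz_def r unit_weight_def split: sum.split)
    also have "mpol_eval f (zz (t *s z)) = eval_zw F (t *s z) (Q (t *s z))"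
      using fF by (simp add: eval_zzbar_eq)
    also have "\<dots> = mpol_eval F (\<lambda>v. t ^ zw_weight v * case_option (Q z) (\<lambda>j. z $ j) v)"
      unfolding eval_zw_def
      by (rule arg_cong[of _ _ "mpol_eval F"])
        (auto simp: fun_eq_iff r zw_weight_def Q split: option.split)
    also have "\<dots> = (\<Sum>d\<le>N. t ^ d * eval_zw (hom_part zw_weight d F) z (Q z))"
      unfolding eval_zw_def by (subst mpol_eval_scale[of _ _ N]) (use N2 in \<open>auto simp: N_def\<close>)
    finally show "(\<Sum>d\<le>N. t ^ d * eval_zzbar (hom_part unit_weight d f) z)
      = (\<Sum>d\<le>N. t ^ d * eval_zw (hom_part zw_weight d F) z (Q z))" .
  qed
qed

text \<open>Degree and homogeneity depend only on which homogeneous parts vanish, and those of f and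
  F agree on the graph. \<open>unique\<close> lets vanishing pass from a part of f to the part of
  F.\<close>

lemma degree_of_extension:
  fixes Q :: "complex ^ 'n::finite \<Rightarrow> complex"
  assumes Q: "\<And>t z. Q (complex_of_real t *s z) = (complex_of_real t)\<^sup>2 * Q z"
    and fF: "\<And>z. eval_zzbar f z = eval_zw F z (Q z)"
    and unique: "\<And>G. (\<And>z. eval_zw G z (Q z) = 0) \<Longrightarrow> G = 0"
  shows "weighted_degree zw_weight F = weighted_degree unit_weight f"
    and "weighted_homogeneous unit_weight d f \<Longrightarrow> weighted_homogeneous zw_weight d F"
proof -
  note h = eval_hom_parts_agree[OF Q fF]
  have e: "hom_part zw_weight d F = 0 \<longleftrightarrow> hom_part unit_weight d f = 0" for d
  proof
    assume "hom_part zw_weight d F = 0"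
    then show "hom_part unit_weight d f = 0"
      using h[of d] by (intro zzbar_eq_0_if_eval_0) (simp add: eval_zw_def)
  next
    assume "hom_part unit_weight d f = 0"
    then show "hom_part zw_weight d F = 0"
      using h[of d] by (intro unique) (simp add: eval_zzbar_eq)
  qed
  show "weighted_degree zw_weight F = weighted_degree unit_weight f"
    by (rule weighted_degree_cong) (rule e)
  show "weighted_homogeneous unit_weight d f \<Longrightarrow> weighted_homogeneous zw_weight d F"
    by (simp add: weighted_homogeneous_iff e)
qed

section \<open>Extension of CR polynomials\<close>

text \<open>Division with remainder by a linear form that contains x_v. The clause for d = 0
  counters the truncated d - 1: a nonzero constant quotient there would break the degree bound after
  multiplication by a variable.\<close>

lemma polyfun_deg_divide_linear:
  assumes c: "c v \<noteq> 0"
  shows "polyfun_deg d f \<Longrightarrow> \<exists>g r. polyfun_deg (d - 1) g \<and> (d = 0 \<longrightarrow> g = (\<lambda>x. 0)) \<and> polyfun_deg d r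
    \<and> (\<forall>x t. r (x(v := t)) = r x) \<and> (\<forall>x. f x = (\<Sum>u\<in>UNIV. c u * x u) * g x + r x)"
proof (induction rule: polyfun_deg.induct)
  case (const d k)
  then show ?case
    by (intro exI[of _ "\<lambda>x. 0"] exI[of _ "\<lambda>x. k"]) (auto intro: polyfun_deg.intros)
next
  case (add d f1 f2)
  obtain g1 r1 where 1: "polyfun_deg (d - 1) g1" "d = 0 \<longrightarrow> g1 = (\<lambda>x. 0)" "polyfun_deg d r1"
    "\<And>x t. r1 (x(v := t)) = r1 x" "\<And>x. f1 x = (\<Sum>u\<in>UNIV. c u * x u) * g1 x + r1 x"
    using add.IH(1) by blast
  obtain g2 r2 where 2: "polyfun_deg (d - 1) g2" "d = 0 \<longrightarrow> g2 = (\<lambda>x. 0)" "polyfun_deg d r2"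
    "\<And>x t. r2 (x(v := t)) = r2 x" "\<And>x. f2 x = (\<Sum>u\<in>UNIV. c u * x u) * g2 x + r2 x"
    using add.IH(2) by blast
  show ?case
    by (rule exI[of _ "\<lambda>x. g1 x + g2 x"], rule exI[of _ "\<lambda>x. r1 x + r2 x"], intro conjI allI)
      (use 1 2 in \<open>auto simp del: fun_upd_apply simp: algebra_simps intro: polyfun_deg.add\<close>)
next
  case (mult_var d f w)
  obtain g r where gr: "polyfun_deg (d - 1) g" "d = 0 \<longrightarrow> g = (\<lambda>x. 0)" "polyfun_deg d r"
    "\<And>x t. r (x(v := t)) = r x" "\<And>x. f x = (\<Sum>u\<in>UNIV. c u * x u) * g x + r x"
    using mult_var.IH by blast
  have g: "polyfun_deg d (\<lambda>x. x w * g x)"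
    using gr(1,2) polyfun_deg.mult_var[of "d - 1" g w] by (cases d) (auto intro: polyfun_deg.intros)
  show ?case
  proof (cases "w = v")
    case False
    have "(\<lambda>x. x w * r x) (x(v := t)) = x w * r x" for x t
      using gr(4)[of x t] False by (simp add: fun_upd_other del: fun_upd_apply)
    moreover have "x w * f x = (\<Sum>u\<in>UNIV. c u * x u) * (x w * g x) + x w * r x" for x
      by (simp add: gr(5) algebra_simps)
    ultimately show ?thesis
      using g polyfun_deg.mult_var[OF gr(3), of w]
      by - (rule exI[of _ "\<lambda>x. x w * g x"], rule exI[of _ "\<lambda>x. x w * r x"], simp del: fun_upd_apply)
  next
    case True
    \<comment> \<open>Solving the linear form for x_v writes x_v * r as the form times r / c_v plus
      this sum, which is free of x_v.\<close>
    let ?s = "\<lambda>x. \<Sum>u\<in>UNIV - {v}. (- c u / c v) * (x u * r x)"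
    have s: "(\<Sum>u\<in>UNIV. c u * x u) = c v * x v + (\<Sum>u\<in>UNIV - {v}. c u * x u)" for x
      by (rule sum.remove) auto
    have h: "x v * r x = (\<Sum>u\<in>UNIV. c u * x u) * (1 / c v * r x) + ?s x" for x
    proof -
      have "?s x = - (\<Sum>u\<in>UNIV - {v}. c u * x u) * (1 / c v * r x)"
        unfolding sum_distrib_right sum_negf[symmetric] by (intro sum.cong) (auto simp: field_simps)
      then show ?thesis using c by (simp add: s field_simps)
    qed
    have "x w * f x = (\<Sum>u\<in>UNIV. c u * x u) * (x w * g x + 1 / c v * r x) + ?s x" for x
    proof -
      have "x w * f x = (\<Sum>u\<in>UNIV. c u * x u) * (x w * g x) + x v * r x"
        by (simp add: True gr(5) distrib_left mult.left_commute)
      then show ?thesis by (simp only: h[of x] distrib_left add.assoc)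
    qed
    moreover have "?s (x(v := t)) = ?s x" for x t
      using gr(4)[of x t] by (intro sum.cong) (auto simp: fun_upd_other simp del: fun_upd_apply)
    moreover have "polyfun_deg (Suc d) ?s"
      by (intro polyfun_deg_sum polyfun_deg_cmult polyfun_deg.mult_var gr) auto
    moreover have "polyfun_deg d (\<lambda>x. x w * g x + 1 / c v * r x)"
      by (intro polyfun_deg.add g polyfun_deg_cmult gr)
    ultimately show ?thesis
      by - (rule exI[of _ "\<lambda>x. x w * g x + 1 / c v * r x"], rule exI[of _ ?s],
        simp del: fun_upd_apply)
  qed
next
  case (weaken d f)
  then obtain g r where gr: "polyfun_deg (d - 1) g" "d = 0 \<longrightarrow> g = (\<lambda>x. 0)" "polyfun_deg d r"
    "\<And>x t. r (x(v := t)) = r x" "\<And>x. f x = (\<Sum>u\<in>UNIV. c u * x u) * g x + r x"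
    by blast
  then show ?case
    by - (rule exI[of _ g], rule exI[of _ r],
      auto intro: polyfun_deg.weaken polyfun_deg_mono simp del: fun_upd_apply)
qed

lemma polyfun_weighted:
  assumes "polyfun G" and Q: "polyfun Qx"
  shows "polyfun (\<lambda>x. G (case_option (Qx x) (\<lambda>j. x (Inl j))))"
  using assms(1)
proof (induction rule: polyfun_induct)
  case (mult_var f v)
  then show ?case by (cases v) (auto intro: polyfun_mult polyfun_mult_var Q)
qed (auto intro: polyfun_intros)

text \<open>Chain rule at the point (z, Q) encoded by \<open>case_option\<close>: the coordinates
  z_j do not involve the variables \<open>Inr j\<close>, so only the w-slot contributes.\<close>

lemma pd_weighted:
  assumes "polyfun G" and Q: "polyfun Qx"
  shows "pd (Inr j) (\<lambda>x. G (case_option (Qx x) (\<lambda>j. x (Inl j)))) =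
    (\<lambda>x. pd None G (case_option (Qx x) (\<lambda>j. x (Inl j))) * pd (Inr j) Qx x)"
  using assms(1)
proof (induction rule: polyfun_induct)
  case (add f g)
  then show ?case by (simp add: pd_add polyfun_weighted Q fun_eq_iff algebra_simps)
next
  case (mult_var f v)
  then show ?case
    by (cases v) (auto simp: pd_mult pd_mult_var polyfun_weighted Q polyfun_var fun_eq_iff algebra_simps)
qed simp

lemma polyfun_cancel_linear:
  assumes f: "polyfun f" "polyfun g" and c: "c u \<noteq> 0"
    and e: "\<And>x. (\<Sum>u\<in>UNIV. c u * x u) * f x = (\<Sum>u\<in>UNIV. c u * x u) * g x"
  shows "f = g"
proof
  fix x
  have "(\<lambda>x. f x - g x) x = 0"
    by (rule polyfun_zero_off_hyperplane[of _ c u]) (use f c e in \<open>auto intro: polyfun_diff\<close>)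
  then show "f x = g x" by simp
qed

text \<open>If all dbar-derivatives of f are proportional to those of Q, two of which are independent
  linear forms, then they are polynomial multiples l * dbar Q, and l has lower degree and the same
  property.  Antidifferentiating the extension of l in w extends f up to a holomorphic polynomial
  in z.\<close>

lemma CR_polyfun_extends:
  fixes Qx f :: "('n::finite + 'n \<Rightarrow> complex) \<Rightarrow> complex"
  assumes Q: "polyfun Qx"
    and q: "\<And>j x. pd (Inr j) Qx x = (\<Sum>u\<in>UNIV. W j u * x u)"
    and W1: "W j1 u1 \<noteq> 0"
    and W2: "W j1 u1 * W j2 u2 \<noteq> W j2 u1 * W j1 u2"
    and f: "polyfun_deg d f"
    and CR: "\<And>x j k. pd (Inr k) Qx x * pd (Inr j) f x = pd (Inr j) Qx x * pd (Inr k) f x"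
  shows "\<exists>F. polyfun F \<and> (\<forall>x. f x = F (case_option (Qx x) (\<lambda>j. x (Inl j))))"
  using f CR
proof (induction d arbitrary: f rule: less_induct)
  case (less d)
  have pf: "polyfun f" using less.prems by (auto simp: polyfun_def)
  show ?case
  proof (cases "d = 0")
    case True
    then obtain c where "f = (\<lambda>x. c)" using polyfun_deg_0 less.prems by blast
    then show ?thesis by (auto intro: polyfun_const)
  next
    case False
    let ?q = "\<lambda>j x. \<Sum>u\<in>UNIV. W j u * x u"
    have CR: "?q k x * pd (Inr j) f x = ?q j x * pd (Inr k) f x" for x j k
      using less.prems(2) by (simp add: q)
    obtain l r where l: "polyfun_deg (d - 1 - 1) l" and r: "polyfun_deg (d - 1) r"
      "\<And>x t. r (x(u1 := t)) = r x" and div: "\<And>x. pd (Inr j1) f x = ?q j1 x * l x + r x"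
      using polyfun_deg_divide_linear[of "W j1", OF W1 polyfun_deg_pd[OF less.prems(1)]] by blast
    have "r x = 0" for x
    proof -
      \<comment> \<open>The j2-form after eliminating x_u1 with the help of the j1-form; by
        \<open>W2\<close> its coefficient at u2 survives.\<close>
      let ?c = "\<lambda>u. W j2 u - W j2 u1 / W j1 u1 * W j1 u"
      show ?thesis
      proof (rule polyfun_zero_off_hyperplane[of r ?c u2])
        show "polyfun r" using r by (auto simp: polyfun_def)
        show "?c u2 \<noteq> 0" using W1 W2 by (auto simp: field_simps)
        fix x assume x: "(\<Sum>u\<in>UNIV. ?c u * x u) \<noteq> 0"
        \<comment> \<open>Slide x along u1 onto the zero set of the j1-form. The remainder r does
          not change, and at y the CR relation between j1 and j2 reads 0 = (j2-form) * r.\<close>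
        define y where "y = x(u1 := x u1 - ?q j1 x / W j1 u1)"
        have y: "?q j y = ?q j x - W j u1 * (?q j1 x / W j1 u1)" for j
          unfolding y_def by (subst (1 2) sum.remove[of _ u1]) (auto simp: algebra_simps)
        have "?q j1 y = 0" using y[of j1] W1 by simp
        moreover have "?q j2 y = ?q j2 x - W j2 u1 / W j1 u1 * ?q j1 x"
          unfolding y by simp
        then have "?q j2 y = (\<Sum>u\<in>UNIV. ?c u * x u)"
          by (simp only: left_diff_distrib sum_subtractf sum_distrib_left mult.assoc)
        ultimately have "r y = 0" using CR[of j1 y j2] div[of y] x by auto
        then show "r x = 0" using r(2) by (simp add: y_def del: fun_upd_apply)
      qed
    qed
    then have j1: "pd (Inr j1) f x = ?q j1 x * l x" for x using div by simp
    have pl: "polyfun l" using l by (auto simp: polyfun_def)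
    have pq: "polyfun (?q j)" for j by (auto intro!: polyfun_intros)
    have fj: "pd (Inr j) f = (\<lambda>x. ?q j x * l x)" for j
    proof (rule polyfun_cancel_linear[of _ _ "W j1", OF _ _ W1])
      show "?q j1 x * pd (Inr j) f x = ?q j1 x * (?q j x * l x)" for x
        using CR[of j1 x j] j1 by (simp add: algebra_simps)
    qed (auto intro: polyfun_pd pf polyfun_mult pq pl)
    have q': "pd (Inr j) Qx = ?q j" for j using q by auto
    \<comment> \<open>The quotient l inherits the CR relations: mixed derivatives of f commute, and
      the terms with second derivatives of Qx cancel by symmetry.\<close>
    have "pd (Inr k) Qx x * pd (Inr j) l x = pd (Inr j) Qx x * pd (Inr k) l x" for x j k
    proof -
      have "pd (Inr k) (\<lambda>x. ?q j x * l x) x = pd (Inr j) (\<lambda>x. ?q k x * l x) x"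
        using pd_commute[OF pf, of "Inr k" "Inr j"] unfolding fj by (rule fun_cong)
      then have "pd (Inr k) (?q j) x * l x + ?q j x * pd (Inr k) l x
        = pd (Inr j) (?q k) x * l x + ?q k x * pd (Inr j) l x"
        unfolding pd_mult[OF pq pl] .
      moreover have "pd (Inr k) (?q j) x = pd (Inr j) (?q k) x"
        using pd_commute[OF Q, of "Inr k" "Inr j"] unfolding q' by (rule fun_cong)
      ultimately show ?thesis unfolding q' by simp
    qed
    \<comment> \<open>One degree is lost by differentiating f and another by dividing by a linear
      form.\<close>
    moreover have "d - 1 - 1 < d" using False by simp
    ultimately obtain H where H: "polyfun H" "\<And>x. l x = H (case_option (Qx x) (\<lambda>j. x (Inl j)))"
      using less.IH l by metis
    obtain G where G: "polyfun G" "pd None G = H" using polyfun_antiderivative[OF H(1)] .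
    let ?G = "\<lambda>x. G (case_option (Qx x) (\<lambda>j. x (Inl j)))"
    let ?h = "\<lambda>x. f x - ?G x"
    have ph: "polyfun ?h" by (intro polyfun_diff pf polyfun_weighted G Q)
    have "pd (Inr j) ?h x = 0" for j x
      by (simp add: pd_diff pf polyfun_weighted G Q pd_weighted fj q H(2))
    \<comment> \<open>f - G(z, Q) has zero derivative in every conj z-variable, so these may be set
      to 0.\<close>
    then have h: "?h x = ?h (case_sum (\<lambda>j. x (Inl j)) (\<lambda>j. 0))" for x
      by (intro polyfun_fixed_if_pd_0[OF ph, of "range Inr"]) (auto split: sum.split)
    let ?F = "\<lambda>y. ?h (\<lambda>v. case_sum (\<lambda>j. y (Some j)) (\<lambda>j. 0) v) + G y"
    have "polyfun (\<lambda>y::'n option \<Rightarrow> complex. ?h (\<lambda>v. case_sum (\<lambda>j y. y (Some j)) (\<lambda>j y. 0) v y))"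
      by (rule polyfun_compose[OF ph]) (auto intro: polyfun_intros split: sum.split)
    also have "(\<lambda>(v::'n + 'n) y::'n option \<Rightarrow> complex. case_sum (\<lambda>j y. y (Some j)) (\<lambda>j y. 0) v y)
      = (\<lambda>v y. case_sum (\<lambda>j. y (Some j)) (\<lambda>j. 0) v)"
      by (auto simp: fun_eq_iff split: sum.split)
    finally have "polyfun ?F" by (rule polyfun_add[OF _ G(1)])
    moreover have "f x = ?F (case_option (Qx x) (\<lambda>j. x (Inl j)))" for x
      using h[of x] by (simp add: algebra_simps cong del: sum.case_cong_weak)
    ultimately show ?thesis by blast
  qed
qed

section \<open>The CR structure of a graph\<close>

text \<open>Differentiating G(z, Q) = 0 in conj z_j gives (dG/dw)(z, Q) * q_j = 0 with q_j a nonzero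
  linear form, so dG/dw vanishes on the graph too. By induction on the degree it vanishes
  identically; then G is free of w, and every z occurs on the graph.\<close>

lemma polyfun_zero_on_graph:
  fixes Qx :: "('n::finite + 'n \<Rightarrow> complex) \<Rightarrow> complex"
  assumes Q: "polyfun Qx"
    and q: "\<And>x. pd (Inr j) Qx x = (\<Sum>u\<in>UNIV. W u * x u)" and W: "W u1 \<noteq> 0"
    and G: "polyfun_deg d G" and z: "\<And>x. G (case_option (Qx x) (\<lambda>j. x (Inl j))) = 0"
  shows "G = (\<lambda>y. 0)"
  using G z
proof (induction d arbitrary: G rule: less_induct)
  case (less d)
  have pG: "polyfun G" using less.prems by (auto simp: polyfun_def)
  show ?case
  proof (cases "d = 0")
    case True
    then show ?thesis using polyfun_deg_0 less.prems by fastforce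
  next
    case False
    let ?H = "\<lambda>x. pd None G (case_option (Qx x) (\<lambda>j. x (Inl j)))"
    have "?H = (\<lambda>x. 0)"
    proof (rule polyfun_cancel_linear[of _ _ W, OF _ _ W])
      show "polyfun ?H" by (rule polyfun_weighted[OF polyfun_pd[OF pG] Q])
      fix x
      have "?H x * pd (Inr j) Qx x = 0"
        using fun_cong[OF pd_weighted[OF pG Q, of j], of x] less.prems(2) by simp
      then show "(\<Sum>u\<in>UNIV. W u * x u) * ?H x = (\<Sum>u\<in>UNIV. W u * x u) * 0" by (auto simp: q)
    qed (rule polyfun_const)
    then have "?H x = 0" for x by metis
    moreover have "polyfun_deg (d - 1) (pd None G)" using less.prems polyfun_deg_pd by blast
    ultimately have 0: "pd None G = (\<lambda>y. 0)" using less.IH[of "d - 1"] False by auto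
    show ?thesis
    proof
      fix y :: "'n option \<Rightarrow> complex"
      let ?x = "case_sum (\<lambda>j. y (Some j)) (\<lambda>j. 0)"
      have "G y = G (case_option (Qx ?x) (\<lambda>j. ?x (Inl j)))"
        by (rule polyfun_fixed_if_pd_0[OF pG, of "{None}"]) (auto simp: 0 split: option.split)
      then show "G y = 0" using less.prems(2)[of ?x] by (rule trans)
    qed
  qed
qed

section \<open>Real derivatives in terms of z and conj z\<close>

lemma zz_has_derivative:
  "polyfun f \<Longrightarrow> ((\<lambda>z. f (zz z)) has_derivative (\<lambda>v. \<Sum>u\<in>UNIV. pd u f (zz z) * zz v u)) (at z)"
proof (induction rule: polyfun_induct)
  case (add f g)
  then show ?case
    using has_derivative_add[OF add.IH] by (simp add: pd_add sum.distrib algebra_simps)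
next
  case (mult_var f w)
  have "((\<lambda>z. zz z w) has_derivative (\<lambda>v. zz v w)) (at z)"
    by (cases w) (auto intro!: derivative_eq_intros bounded_linear.has_derivative[OF bounded_linear_cnj]
      bounded_linear.has_derivative[OF bounded_linear_vec_nth])
  from has_derivative_mult[OF this mult_var.IH]
  have "((\<lambda>z. zz z w * f (zz z)) has_derivative
      (\<lambda>v. zz z w * (\<Sum>u\<in>UNIV. pd u f (zz z) * zz v u) + zz v w * f (zz z))) (at z)" .
  also have "(\<lambda>v. zz z w * (\<Sum>u\<in>UNIV. pd u f (zz z) * zz v u) + zz v w * f (zz z)) =
    (\<lambda>v. \<Sum>u\<in>UNIV. pd u (\<lambda>x. x w * f x) (zz z) * zz v u)"
  proof
    fix v
    have "(\<Sum>u\<in>UNIV. (if w = u then f (zz z) else 0) * zz v u) = f (zz z) * zz v w"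
      by (simp add: if_distrib[of "\<lambda>x. x * _"] cong: if_cong)
    then show "zz z w * (\<Sum>u\<in>UNIV. pd u f (zz z) * zz v u) + zz v w * f (zz z) =
      (\<Sum>u\<in>UNIV. pd u (\<lambda>x. x w * f x) (zz z) * zz v u)"
      by (simp add: pd_mult_var[OF mult_var.hyps] distrib_right sum.distrib sum_distrib_left mult.assoc)
  qed
  finally show ?case .
qed simp

definition zderiv :: "(('n::finite + 'n \<Rightarrow> complex) \<Rightarrow> complex) \<Rightarrow> complex ^ 'n \<Rightarrow> complex ^ 'n \<Rightarrow> complex" where
  "zderiv f z v = (\<Sum>u\<in>UNIV. pd u f (zz z) * zz v u)"

lemma has_zderiv: "polyfun f \<Longrightarrow> ((\<lambda>z. f (zz z)) has_derivative zderiv f z) (at z)"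
  using zz_has_derivative[of f z] by (simp add: zderiv_def[abs_def])

lemma sum_UNIV_Plus: "(\<Sum>u\<in>(UNIV :: ('a::finite + 'b::finite) set). g u) = (\<Sum>j\<in>UNIV. g (Inl j)) + (\<Sum>j\<in>UNIV. g (Inr j))"
  by (simp add: UNIV_Plus_UNIV[symmetric] sum.Plus del: UNIV_Plus_UNIV)

lemma zderiv_split:
  "zderiv f z v = (\<Sum>j\<in>UNIV. pd (Inl j) f (zz z) * v $ j) + (\<Sum>j\<in>UNIV. pd (Inr j) f (zz z) * cnj (v $ j))"
  by (simp add: zderiv_def sum_UNIV_Plus)

text \<open>The z-part of the differential commutes with multiplication by i and the conj z-part
  anticommutes, so the failure of complex linearity isolates the conj z-derivatives.\<close>

lemma zderiv_i:
  "zderiv f z (\<i> *s v) = \<i> * zderiv f z v - 2 * \<i> * (\<Sum>j\<in>UNIV. pd (Inr j) f (zz z) * cnj (v $ j))"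
proof -
  have "(\<Sum>j\<in>UNIV. pd (Inl j) f (zz z) * (\<i> * v $ j)) = \<i> * (\<Sum>j\<in>UNIV. pd (Inl j) f (zz z) * v $ j)"
    by (simp add: sum_distrib_left mult.left_commute)
  moreover have "(\<Sum>j\<in>UNIV. pd (Inr j) f (zz z) * cnj (\<i> * v $ j)) = - \<i> * (\<Sum>j\<in>UNIV. pd (Inr j) f (zz z) * cnj (v $ j))"
    by (simp add: sum_distrib_left mult.left_commute sum_negf)
  ultimately show ?thesis by (simp add: zderiv_split algebra_simps)
qed

text \<open>Ties the Wirtinger derivative to an ordinary complex derivative in an independent
  variable: by \<open>zderiv_i\<close>, adding i times the derivative along i e_j cancels the z-part
  and doubles the other.\<close>

lemma dbar_eq_pd:
  assumes "polyfun f" shows "dbar (\<lambda>z. f (zz z)) z j = pd (Inr j) f (zz z)"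
proof -
  have e: "frechet_derivative (\<lambda>z. f (zz z)) (at z) = zderiv f z"
    by (rule frechet_derivative_at[symmetric]) (rule has_zderiv[OF assms])
  have i: "axis j \<i> = \<i> *s axis j (1::complex)" by (simp add: vec_eq_iff axis_def)
  have "(\<Sum>k\<in>UNIV. pd (Inr k) f (zz z) * cnj (axis j 1 $ k)) = pd (Inr j) f (zz z)"
    by (simp add: axis_def if_distrib[of cnj] if_distrib[of "\<lambda>x. _ * x"] cong: if_cong)
  then show ?thesis unfolding dbar_def e i zderiv_i by (simp add: algebra_simps)
qed

section \<open>Tangent and (0,1) spaces of a graph\<close>

lemma tangent_space_fun_graph:
  assumes "(Q has_derivative Q') (at z)"
  shows "tangent_space (fun_graph Q) (z, Q z) = {(v, Q' v) | v. True}"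
proof (intro set_eqI iffI)
  fix X assume "X \<in> tangent_space (fun_graph Q) (z, Q z)"
  then obtain \<gamma> where \<gamma>: "\<gamma> 0 = (z, Q z)" "\<And>t::real. \<gamma> t \<in> fun_graph Q"
    and d: "(\<gamma> has_vector_derivative X) (at 0)"
    by (auto simp: tangent_space_def)
  have s: "snd (\<gamma> t) = Q (fst (\<gamma> t))" for t using \<gamma>(2)[of t] by (auto simp: fun_graph_def split_beta)
  have 1: "((\<lambda>t. fst (\<gamma> t)) has_vector_derivative fst X) (at 0)"
    using bounded_linear.has_vector_derivative[OF bounded_linear_fst d] by simp
  have 2: "((\<lambda>t. snd (\<gamma> t)) has_vector_derivative snd X) (at 0)"
    using bounded_linear.has_vector_derivative[OF bounded_linear_snd d] by simp
  have "(Q has_derivative Q') (at (fst (\<gamma> 0)))" using assms \<gamma> by simp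
  then have "((\<lambda>t. Q (fst (\<gamma> t))) has_derivative (\<lambda>t. Q' (t *\<^sub>R fst X))) (at 0)"
    using 1 unfolding has_vector_derivative_def by (rule has_derivative_compose[rotated])
  then have "((\<lambda>t. snd (\<gamma> t)) has_vector_derivative Q' (fst X)) (at 0)"
    using assms by (simp add: s has_vector_derivative_def linear_cmul[OF has_derivative_linear])
  then have "snd X = Q' (fst X)" using 2 vector_derivative_unique_at by blast
  then show "X \<in> {(v, Q' v) | v. True}" by (metis (mono_tags, lifting) mem_Collect_eq prod.collapse)
next
  fix X assume "X \<in> {(v, Q' v) | v. True}"
  then obtain v where v: "X = (v, Q' v)" by blast
  have 1: "((\<lambda>t. z + t *\<^sub>R v) has_vector_derivative v) (at 0)"
    by (auto intro!: derivative_eq_intros)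
  have "(Q has_derivative Q') (at (z + 0 *\<^sub>R v))" using assms by simp
  then have "((\<lambda>t. Q (z + t *\<^sub>R v)) has_derivative (\<lambda>t. Q' (t *\<^sub>R v))) (at 0)"
    using 1 unfolding has_vector_derivative_def by (rule has_derivative_compose[rotated])
  then have 2: "((\<lambda>t. Q (z + t *\<^sub>R v)) has_vector_derivative Q' v) (at 0)"
    using assms by (simp add: has_vector_derivative_def linear_cmul[OF has_derivative_linear])
  have "((\<lambda>t. (z + t *\<^sub>R v, Q (z + t *\<^sub>R v))) has_vector_derivative (v, Q' v)) (at 0)"
    by (rule has_vector_derivative_Pair[OF 1 2])
  then show "X \<in> tangent_space (fun_graph Q) (z, Q z)"
    unfolding tangent_space_def v
    by (intro CollectI exI[of _ "\<lambda>t. (z + t *\<^sub>R v, Q (z + t *\<^sub>R v))"]) (auto simp: fun_graph_def)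
qed

text \<open>On pairs (X, iX) the formal imaginary unit acts on X as -i, so formal scalars act by
  their conjugates. This is the origin of the conjugates in the coefficients and parametrizations
  below.\<close>

lemma cx_scale_i_pair: "cx_scale c (X, pt_scale \<i> X) = (pt_scale (cnj c) X, pt_scale \<i> (pt_scale (cnj c) X))"
  for X :: "'n::finite pt"
  by (auto simp: cx_scale_def pt_scale_def vec_eq_iff complex_eq_iff prod_eq_iff)

text \<open>Each generator is the pair formed by half a coordinate vector and i times it, and the
  pairs of this shape are closed under formal scalars.\<close>

lemma span_01: "cx.span (insert d_wbar (range d_zbar)) = {(X, pt_scale \<i> X) | X :: 'n::finite pt. True}"
proof
  have w: "d_wbar = ((0, 1/2), pt_scale \<i> (0, 1/2))"
    by (simp add: d_wbar_def pt_scale_def scaleR_conv_of_real vec_eq_iff)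
  have z: "d_zbar j = ((axis j (1/2), 0), pt_scale \<i> (axis j (1/2), 0))" for j :: 'n
    by (simp add: d_zbar_def pt_scale_def vec_eq_iff axis_def scaleR_conv_of_real[where 'a=complex])
  show "cx.span (insert d_wbar (range d_zbar)) \<subseteq> {(X, pt_scale \<i> X) | X :: 'n::finite pt. True}"
  proof (rule cx.span_minimal)
    show "cx.subspace {(X, pt_scale \<i> X) | X :: 'n pt. True}"
    proof (rule cx.subspaceI)
      show "0 \<in> {(X, pt_scale \<i> X) | X :: 'n pt. True}"
        by (auto simp: zero_prod_def pt_scale_def)
      show "x + y \<in> {(X, pt_scale \<i> X) | X :: 'n pt. True}"
        if "x \<in> {(X, pt_scale \<i> X) | X :: 'n pt. True}" "y \<in> {(X, pt_scale \<i> X) | X :: 'n pt. True}" for x y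
        using that by (auto simp: pt_scale_def algebra_simps vector_add_ldistrib)
      show "cx_scale c x \<in> {(X, pt_scale \<i> X) | X :: 'n pt. True}"
        if "x \<in> {(X, pt_scale \<i> X) | X :: 'n pt. True}" for c x
        using that cx_scale_i_pair by blast
    qed
  qed (use w z in blast)
  show "{(X, pt_scale \<i> X) | X :: 'n::finite pt. True} \<subseteq> cx.span (insert d_wbar (range d_zbar))"
  proof
    fix Y assume "Y \<in> {(X, pt_scale \<i> X) | X :: 'n::finite pt. True}"
    then obtain X where X: "Y = (X, pt_scale \<i> X)" by blast
    \<comment> \<open>The generators carry a factor 1/2 and scalars act by conjugation, hence the
      coefficients 2 conj(X_j).\<close>
    have "Y = (\<Sum>j\<in>UNIV. cx_scale (2 * cnj (fst X $ j)) (d_zbar j)) + cx_scale (2 * cnj (snd X)) d_wbar"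
      unfolding w z cx_scale_i_pair X
      by (simp add: prod_eq_iff fst_sum snd_sum pt_scale_def vec_eq_iff
          axis_def if_distrib[of "\<lambda>x. _ * x"] cong: if_cong)
    also have "\<dots> \<in> cx.span (insert d_wbar (range d_zbar))"
      by (intro cx.span_add cx.span_sum cx.span_scale cx.span_base) auto
    finally show "Y \<in> cx.span (insert d_wbar (range d_zbar))" .
  qed
qed

text \<open>Write D for the real differential of the graph function. The pair (X, iX) with X = (v, D
  v) consists of tangent vectors iff D (i v) = i D v, and by \<open>zderiv_i\<close> this says that
  the antilinear part of D kills v.\<close>

lemma T01_fun_graph:
  fixes f :: "('n::finite + 'n \<Rightarrow> complex) \<Rightarrow> complex"
  assumes f: "polyfun f"
  shows "T01 (fun_graph (\<lambda>z. f (zz z))) (z, f (zz z)) =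
    {((v, zderiv f z v), pt_scale \<i> (v, zderiv f z v)) | v.
      (\<Sum>j\<in>UNIV. pd (Inr j) f (zz z) * cnj (v $ j)) = 0}"
proof -
  have e: "pt_scale \<i> (v, zderiv f z v) = (\<i> *s v, zderiv f z (\<i> *s v)) \<longleftrightarrow>
    (\<Sum>j\<in>UNIV. pd (Inr j) f (zz z) * cnj (v $ j)) = 0" for v
    unfolding zderiv_i by (simp add: pt_scale_def)
  show ?thesis
    unfolding T01_def span_01 tangent_space_fun_graph[OF has_zderiv[OF f]]
  proof (intro set_eqI iffI)
    fix Y assume "Y \<in> {(v, zderiv f z v) | v. True} \<times> {(v, zderiv f z v) | v. True} \<inter> {(X, pt_scale \<i> X) | X. True}"
    then obtain v w where v: "Y = ((v, zderiv f z v), (w, zderiv f z w))"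
      "(w, zderiv f z w) = pt_scale \<i> (v, zderiv f z v)" by (smt (verit) CollectD IntD1 IntD2 mem_Sigma_iff old.prod.exhaust prod.inject)
    from v(2) have w: "w = \<i> *s v" by (simp add: pt_scale_def)
    have "(\<Sum>j\<in>UNIV. pd (Inr j) f (zz z) * cnj (v $ j)) = 0"
      using v(2) unfolding e[symmetric] w by (rule sym)
    then show "Y \<in> {((v, zderiv f z v), pt_scale \<i> (v, zderiv f z v)) | v.
      (\<Sum>j\<in>UNIV. pd (Inr j) f (zz z) * cnj (v $ j)) = 0}"
      unfolding v(1) v(2) by blast
  next
    fix Y assume "Y \<in> {((v, zderiv f z v), pt_scale \<i> (v, zderiv f z v)) | v.
      (\<Sum>j\<in>UNIV. pd (Inr j) f (zz z) * cnj (v $ j)) = 0}"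
    then obtain v where v: "Y = ((v, zderiv f z v), pt_scale \<i> (v, zderiv f z v))"
      "pt_scale \<i> (v, zderiv f z v) = (\<i> *s v, zderiv f z (\<i> *s v))" using iffD2[OF e] by blast
    show "Y \<in> {(v, zderiv f z v) | v. True} \<times> {(v, zderiv f z v) | v. True} \<inter> {(X, pt_scale \<i> X) | X. True}"
      unfolding v(1)
      by (intro IntI SigmaI CollectI exI[of _ v] exI[of _ "\<i> *s v"] exI[of _ "(v, zderiv f z v)"]
          conjI TrueI v(2) refl)
  qed
qed

section \<open>Dimension of the (0,1) space and the CR points\<close>

lemma dim_hyperplane_vec:
  fixes q :: "complex ^ 'n::finite"
  assumes "q \<noteq> 0"
  shows "Suc (vec.dim {u. (\<Sum>j\<in>UNIV. q $ j * u $ j) = 0}) = CARD('n)"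
proof -
  let ?H = "{u. (\<Sum>j\<in>UNIV. q $ j * u $ j) = 0}"
  obtain k where k: "q $ k \<noteq> 0" using assms by (auto simp: vec_eq_iff)
  have sub: "vec.subspace ?H"
  proof (rule vec.subspaceI)
    fix c x assume x: "x \<in> ?H"
    have "(\<Sum>j\<in>UNIV. q $ j * (c *s x) $ j) = c * (\<Sum>j\<in>UNIV. q $ j * x $ j)"
      unfolding sum_distrib_left by (intro sum.cong) auto
    then show "c *s x \<in> ?H" using x by simp
  next
    fix x y assume "x \<in> ?H" "y \<in> ?H"
    moreover have "(\<Sum>j\<in>UNIV. q $ j * (x + y) $ j) = (\<Sum>j\<in>UNIV. q $ j * x $ j) + (\<Sum>j\<in>UNIV. q $ j * y $ j)"
      unfolding sum.distrib[symmetric] by (intro sum.cong) (auto simp: distrib_left)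
    ultimately show "x + y \<in> ?H" by simp
  qed simp
  \<comment> \<open>The form takes the value 1 on this vector, which therefore spans a complement of
    the kernel.\<close>
  define a where "a = axis k (1 / q $ k)"
  have "(\<Sum>j\<in>UNIV. q $ j * a $ j) = (\<Sum>j\<in>UNIV. if j = k then 1 else 0)"
    using k by (intro sum.cong) (auto simp: a_def axis_def)
  then have a: "(\<Sum>j\<in>UNIV. q $ j * a $ j) = 1" by simp
  then have "a \<notin> ?H" by simp
  then have na: "a \<notin> vec.span ?H" unfolding vec.span_eq_iff[THEN iffD2, OF sub] .
  have "x \<in> vec.span (insert a ?H)" for x
  proof -
    let ?c = "\<Sum>j\<in>UNIV. q $ j * x $ j"
    have "(\<Sum>j\<in>UNIV. q $ j * (x - c *s a) $ j) = ?c - c * (\<Sum>j\<in>UNIV. q $ j * a $ j)" for c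
      unfolding sum_distrib_left sum_subtractf[symmetric] by (intro sum.cong) (auto simp: algebra_simps)
    from this[of ?c] have "(\<Sum>j\<in>UNIV. q $ j * (x - ?c *s a) $ j) = 0" unfolding a by simp
    then have "x - ?c *s a \<in> ?H" by simp
    then have "?c *s a + (x - ?c *s a) \<in> vec.span (insert a ?H)"
      by (intro vec.span_add vec.span_scale vec.span_base) auto
    then show ?thesis by simp
  qed
  then have "vec.span (insert a ?H) = UNIV" by blast
  then have "vec.dim (insert a ?H) = CARD('n)"
    using vec.dim_span[of "insert a ?H"] vec_dim_card[where 'a=complex and 'n='n] by simp
  then show ?thesis using na by (simp add: vec.dim_insert)
qed

text \<open>The parameter is u = conj v, not v: formal scalars act by conjugation on (0,1) vectors,
  so this makes the parametrization \<open>L\<close> complex linear and the dimension that of the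
  kernel of a linear form.\<close>

lemma dim_T01:
  fixes f :: "('n::finite + 'n \<Rightarrow> complex) \<Rightarrow> complex"
  assumes f: "polyfun f"
  shows "cx.dim (T01 (fun_graph (\<lambda>z. f (zz z))) (z, f (zz z))) =
    vec.dim {u :: complex ^ 'n. (\<Sum>j\<in>UNIV. pd (Inr j) f (zz z) * u $ j) = 0}"
proof -
  interpret finite_dimensional_vector_space_pair_1 "(*s)" "cart_basis :: (complex ^ 'n) set"
    "cx_scale :: complex \<Rightarrow> 'n pt \<times> 'n pt \<Rightarrow> _" ..
  let ?S = "{u :: complex ^ 'n. (\<Sum>j\<in>UNIV. pd (Inr j) f (zz z) * u $ j) = 0}"
  define X :: "complex ^ 'n \<Rightarrow> 'n pt" where
    "X u = ((\<chi> j. cnj (u $ j)), \<Sum>j\<in>UNIV. pd (Inl j) f (zz z) * cnj (u $ j))" for u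
  define L where "L u = (X u, pt_scale \<i> (X u))" for u
  have X1: "X (u + v) = X u + X v" for u v
    by (simp add: X_def vec_eq_iff distrib_left sum.distrib)
  have "(\<Sum>j\<in>UNIV. pd (Inl j) f (zz z) * cnj ((c *s u) $ j)) =
    cnj c * (\<Sum>j\<in>UNIV. pd (Inl j) f (zz z) * cnj (u $ j))" for u c
    unfolding sum_distrib_left by (intro sum.cong) auto
  then have X2: "X (c *s u) = pt_scale (cnj c) (X u)" for u c
    by (simp add: X_def pt_scale_def vec_eq_iff)
  have L1: "L (u + v) = L u + L v" for u v
    by (simp add: L_def X1 pt_scale_def vector_add_ldistrib distrib_left)
  have L2: "L (c *s u) = cx_scale c (L u)" for u c
    unfolding L_def cx_scale_i_pair X2 ..
  have "Vector_Spaces.linear (*s) cx_scale L"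
    by unfold_locales (fact L1 L2)+
  moreover have "inj L"
    by (auto simp: inj_def L_def X_def vec_eq_iff)
  ultimately have "cx.dim (L ` ?S) = vec.dim ?S"
    by (intro dim_image_eq) (auto intro: inj_on_subset)
  moreover have "L ` ?S = T01 (fun_graph (\<lambda>z. f (zz z))) (z, f (zz z))"
    unfolding T01_fun_graph[OF f]
  proof (intro set_eqI iffI)
    fix Y assume "Y \<in> L ` ?S"
    then obtain u where u: "Y = L u" "(\<Sum>j\<in>UNIV. pd (Inr j) f (zz z) * u $ j) = 0" by blast
    let ?v = "\<chi> j. cnj (u $ j)"
    have "X u = (?v, zderiv f z ?v)" using u(2) by (simp add: X_def zderiv_split)
    then have "Y = ((?v, zderiv f z ?v), pt_scale \<i> (?v, zderiv f z ?v))"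
      unfolding u(1) L_def by (rule arg_cong)
    moreover have "(\<Sum>j\<in>UNIV. pd (Inr j) f (zz z) * cnj (?v $ j)) = 0" using u(2) by simp
    ultimately show "Y \<in> {((v, zderiv f z v), pt_scale \<i> (v, zderiv f z v)) | v.
      (\<Sum>j\<in>UNIV. pd (Inr j) f (zz z) * cnj (v $ j)) = 0}"
      by (intro CollectI exI[of _ ?v] conjI)
  next
    fix Y assume "Y \<in> {((v, zderiv f z v), pt_scale \<i> (v, zderiv f z v)) | v.
      (\<Sum>j\<in>UNIV. pd (Inr j) f (zz z) * cnj (v $ j)) = 0}"
    then obtain v where v: "Y = ((v, zderiv f z v), pt_scale \<i> (v, zderiv f z v))"
      "(\<Sum>j\<in>UNIV. pd (Inr j) f (zz z) * cnj (v $ j)) = 0" by blast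
    let ?u = "\<chi> j. cnj (v $ j)"
    have "X ?u = (v, zderiv f z v)" using v(2) by (simp add: X_def zderiv_split vec_eq_iff)
    then have "Y = L ?u" unfolding v(1) L_def by (rule arg_cong[OF sym])
    moreover have "?u \<in> ?S" using v(2) by simp
    ultimately show "Y \<in> L ` ?S" by (rule image_eqI)
  qed
  ultimately show ?thesis by simp
qed

lemma continuous_zz: "polyfun f \<Longrightarrow> isCont (\<lambda>z. f (zz z)) z"
  using has_zderiv has_derivative_continuous by blast

text \<open>On the real line from z to any y the function is a polynomial in t; if it vanishes for
  small positive t, it vanishes at t = 1. The identity theorem at the points (z, conj z) then
  finishes.\<close>

lemma polyfun_zz_nonzero_dense:
  assumes f: "polyfun f" "f \<noteq> (\<lambda>x. 0)" and U: "open U" "z \<in> U"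
  shows "\<exists>z'\<in>U. f (zz z') \<noteq> 0"
proof (rule ccontr)
  assume "\<not> ?thesis"
  then have 0: "f (zz z') = 0" if "z' \<in> U" for z' using that by blast
  have "f (zz y) = 0" for y
  proof -
    have "\<exists>p. \<forall>t::real. f (zz (z + t *\<^sub>R (y - z))) = poly p (complex_of_real t)"
      using f(1)
    proof (induction rule: polyfun_induct)
      case (const c)
      then show ?case by (intro exI[of _ "[:c:]"]) simp
    next
      case (add f g)
      then obtain p q where "\<forall>t::real. f (zz (z + t *\<^sub>R (y - z))) = poly p (complex_of_real t)"
        "\<forall>t::real. g (zz (z + t *\<^sub>R (y - z))) = poly q (complex_of_real t)" by blast
      then show ?case by (intro exI[of _ "p + q"]) simp
    next
      case (mult_var f w)
      then obtain p where p: "\<forall>t::real. f (zz (z + t *\<^sub>R (y - z))) = poly p (complex_of_real t)" by blast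
      have e: "zz (z + t *\<^sub>R (y - z)) w = poly [:zz z w, zz y w - zz z w:] (complex_of_real t)" for t :: real
        by (cases w) (simp_all add: scaleR_conv_of_real[where 'a=complex])
      show ?case
        by (rule exI[of _ "[:zz z w, zz y w - zz z w:] * p"]) (simp only: poly_mult p e simp_thms)
    qed
    then obtain p where p: "\<And>t::real. f (zz (z + t *\<^sub>R (y - z))) = poly p (complex_of_real t)" by blast
    have "\<forall>\<^sub>F t in at (0::real). z + t *\<^sub>R (y - z) \<in> U"
    proof (rule topological_tendstoD[OF _ U(1)])
      have "((\<lambda>t::real. z + t *\<^sub>R (y - z)) \<longlongrightarrow> z + 0 *\<^sub>R (y - z)) (at 0)"
        by (intro tendsto_intros)
      then show "((\<lambda>t::real. z + t *\<^sub>R (y - z)) \<longlongrightarrow> z) (at 0)" by simp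
    qed (use U in simp)
    then obtain d where d: "d > 0" "\<And>t::real. t \<noteq> 0 \<Longrightarrow> \<bar>t\<bar> < d \<Longrightarrow> z + t *\<^sub>R (y - z) \<in> U"
      by (auto simp: eventually_at dist_real_def)
    have "poly p (complex_of_real t) = 0" if "t \<in> {0<..<d}" for t
      unfolding p[symmetric] using that by (intro 0 d(2)) auto
    then have "complex_of_real ` {0<..<d} \<subseteq> {t. poly p t = 0}" by blast
    moreover have "infinite (complex_of_real ` {0<..<d})"
      using d(1) by (simp add: finite_image_iff inj_on_def)
    ultimately have "p = 0" using poly_roots_finite finite_subset by blast
    then show "f (zz y) = 0" using p[of 1] by simp
  qed
  then have "f x = 0" for x by (rule polyfun_zero_on_zz[OF f(1)])
  then show False using f(2) by blast
qed

text \<open>The (0,1) space has dimension n - 1 where dbar of the graph function is nonzero and n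
  where it is zero. The first set is open and, by \<open>nz\<close>, dense, so near a point of the
  second kind the dimension is never constant.\<close>

lemma CR_points_fun_graph:
  fixes f :: "('n::finite + 'n \<Rightarrow> complex) \<Rightarrow> complex"
  assumes f: "polyfun f" and nz: "pd (Inr j0) f \<noteq> (\<lambda>x. 0)"
  shows "CR_points (fun_graph (\<lambda>z. f (zz z))) =
    {(z, f (zz z)) | z. \<exists>j. pd (Inr j) f (zz z) \<noteq> 0}"
proof -
  let ?M = "fun_graph (\<lambda>z. f (zz z))"
  define D where "D z = cx.dim (T01 ?M (z, f (zz z)))" for z
  have D1: "Suc (D z) = CARD('n)" if "pd (Inr j) f (zz z) \<noteq> 0" for z j
    unfolding D_def dim_T01[OF f]
    using dim_hyperplane_vec[of "\<chi> j. pd (Inr j) f (zz z)"] that by (auto simp: vec_eq_iff)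
  have D0: "D z = CARD('n)" if "\<forall>j. pd (Inr j) f (zz z) = 0" for z
    unfolding D_def dim_T01[OF f] using that vec_dim_card[where 'a=complex and 'n='n] by simp
  have M: "p \<in> ?M \<longleftrightarrow> p = (fst p, f (zz (fst p)))" for p by (auto simp: fun_graph_def)
  show ?thesis
  proof (intro set_eqI iffI)
    fix p assume "p \<in> CR_points ?M"
    then obtain U where p: "p \<in> ?M" and U: "open U" "p \<in> U"
      and const: "\<And>q. q \<in> ?M \<inter> U \<Longrightarrow> cx.dim (T01 ?M q) = cx.dim (T01 ?M p)"
      by (auto simp: CR_points_def)
    obtain z where z: "p = (z, f (zz z))" using p M by blast
    have "continuous_on UNIV (\<lambda>z. (z, f (zz z)))"
      using continuous_zz[OF f] by (intro continuous_intros) (simp add: continuous_on_eq_continuous_at)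
    then have "open ((\<lambda>z. (z, f (zz z))) -` U)" using U(1) open_vimage by blast
    then obtain z' where z': "(z', f (zz z')) \<in> U" "pd (Inr j0) f (zz z') \<noteq> 0"
      using polyfun_zz_nonzero_dense[OF polyfun_pd[OF f] nz, of "(\<lambda>z. (z, f (zz z))) -` U" z] U z by auto
    have "D z' = D z" using const[of "(z', f (zz z'))"] z' z by (simp add: D_def fun_graph_def)
    then have "\<exists>j. pd (Inr j) f (zz z) \<noteq> 0" using D0[of z] D1[OF z'(2)] by auto
    then show "p \<in> {(z, f (zz z)) | z. \<exists>j. pd (Inr j) f (zz z) \<noteq> 0}" using z by blast
  next
    fix p assume "p \<in> {(z, f (zz z)) | z. \<exists>j. pd (Inr j) f (zz z) \<noteq> 0}"
    then obtain z j where z: "p = (z, f (zz z))" "pd (Inr j) f (zz z) \<noteq> 0" by blast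
    let ?V = "(\<lambda>z. pd (Inr j) f (zz z)) -` (- {0})"
    have "continuous_on UNIV (\<lambda>z. pd (Inr j) f (zz z))"
      using continuous_zz[OF polyfun_pd[OF f]] by (simp add: continuous_on_eq_continuous_at)
    then have "open ?V" by (intro open_vimage) auto
    then have "open (?V \<times> (UNIV :: complex set))" by (intro open_Times) auto
    moreover have "cx.dim (T01 ?M q) = cx.dim (T01 ?M p)" if "q \<in> ?M \<inter> (?V \<times> UNIV)" for q
    proof -
      have "q = (fst q, f (zz (fst q)))" using that M by blast
      moreover have "pd (Inr j) f (zz (fst q)) \<noteq> 0" using that by (auto simp: mem_Times_iff)
      ultimately obtain y where y: "q = (y, f (zz y))" "pd (Inr j) f (zz y) \<noteq> 0" by blast
      then show ?thesis using D1[OF y(2)] D1[OF z(2)] z(1) by (simp add: D_def)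
    qed
    moreover have "p \<in> ?M" "p \<in> ?V \<times> UNIV" using z by (auto simp: fun_graph_def)
    ultimately show "p \<in> CR_points ?M" unfolding CR_points_def by blast
  qed
qed

section \<open>CR vector fields and CR functions\<close>

lemma frechet_derivative_within_tangent:
  assumes g: "(g has_derivative g') (at p)" and v: "v \<in> tangent_space M p"
  shows "frechet_derivative g (at p within M) v = g' v"
proof -
  let ?D = "frechet_derivative g (at p within M)"
  have g1: "(g has_derivative g') (at p within M)" by (rule has_derivative_at_withinI[OF g])
  then have g2: "(g has_derivative ?D) (at p within M)"
    by (meson differentiableI frechet_derivative_works)
  obtain \<gamma> where \<gamma>: "\<gamma> 0 = p" "\<And>t::real. \<gamma> t \<in> M" and d: "(\<gamma> has_derivative (\<lambda>t. t *\<^sub>R v)) (at 0)"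
    using v by (auto simp: tangent_space_def has_vector_derivative_def)
  have sub: "range \<gamma> \<subseteq> M" using \<gamma> by auto
  \<comment> \<open>A derivative within M need not be unique, but composition with a curve in M of
    velocity v gives a derivative in one real variable, which is.\<close>
  have comp: "((\<lambda>t. g (\<gamma> t)) has_derivative (\<lambda>t. h (t *\<^sub>R v))) (at 0)"
    if "(g has_derivative h) (at p within M)" for h
    by (rule has_derivative_in_compose[OF d]) (use that \<gamma>(1) sub has_derivative_subset in auto)
  have "(\<lambda>t. ?D (t *\<^sub>R v)) = (\<lambda>t. g' (t *\<^sub>R v))"
    by (rule has_derivative_unique[OF comp[OF g2] comp[OF g1]])
  from fun_cong[OF this, of 1] show ?thesis by simp
qed

text \<open>A class closed under directional derivatives, so that membership alone yields
  \<open>Ck_on\<close> of every order. The linear factor places a scalar polynomial into a component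
  of the target.\<close>

inductive zpoly_map :: "('n::finite pt \<Rightarrow> 'b::real_normed_vector) \<Rightarrow> bool" where
  base: "polyfun \<phi> \<Longrightarrow> bounded_linear \<Lambda> \<Longrightarrow> zpoly_map (\<lambda>p. \<Lambda> (\<phi> (zz (fst p))))"
| add: "zpoly_map f \<Longrightarrow> zpoly_map g \<Longrightarrow> zpoly_map (\<lambda>p. f p + g p)"

lemma zpoly_map_derivative:
  "zpoly_map f \<Longrightarrow> \<exists>f'. (\<forall>p. (f has_derivative f' p) (at p)) \<and> (\<forall>v. zpoly_map (\<lambda>p. f' p v))"
proof (induction rule: zpoly_map.induct)
  case (base \<phi> \<Lambda>)
  have 1: "((\<lambda>p. \<Lambda> (\<phi> (zz (fst p)))) has_derivative (\<lambda>v. \<Lambda> (zderiv \<phi> (fst p) (fst v)))) (at p)" for p :: "'a pt"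
  proof -
    have "((\<lambda>p. \<phi> (zz (fst p))) has_derivative (\<lambda>v. zderiv \<phi> (fst p) (fst v))) (at p)"
      by (rule has_derivative_compose[OF has_derivative_fst[OF has_derivative_ident] has_zderiv[OF base(1)]])
    then show ?thesis by (rule bounded_linear.has_derivative[OF base(2)])
  qed
  have 2: "zpoly_map (\<lambda>p :: 'a pt. \<Lambda> (zderiv \<phi> (fst p) (fst v)))" for v :: "'a pt"
  proof -
    have "polyfun (\<lambda>x. \<Sum>u\<in>UNIV. pd u \<phi> x * zz (fst v) u)"
      by (intro polyfun_intros polyfun_pd base) auto
    from zpoly_map.base[OF this base(2)] show ?thesis by (simp add: zderiv_def)
  qed
  show ?case
    by (rule exI[of _ "\<lambda>p v. \<Lambda> (zderiv \<phi> (fst p) (fst v))"]) (use 1 2 in blast)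
next
  case (add f g)
  then obtain f' g' where fg: "\<And>p. (f has_derivative f' p) (at p)" "\<And>v. zpoly_map (\<lambda>p. f' p v)"
    "\<And>p. (g has_derivative g' p) (at p)" "\<And>v. zpoly_map (\<lambda>p. g' p v)" by blast
  show ?case
    by (rule exI[of _ "\<lambda>p v. f' p v + g' p v"])
      (intro conjI allI has_derivative_add zpoly_map.add fg)
qed

lemma zpoly_map_Ck: "zpoly_map f \<Longrightarrow> Ck_on k f UNIV"
proof (induction k arbitrary: f)
  case 0
  then show ?case using zpoly_map_derivative[OF 0]
    by (auto simp: continuous_on_eq_continuous_at intro: has_derivative_continuous)
next
  case (Suc k)
  obtain f' where f': "\<And>p. (f has_derivative f' p) (at p)" "\<And>v. zpoly_map (\<lambda>p. f' p v)"
    using zpoly_map_derivative[OF Suc.prems] by blast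
  have e: "frechet_derivative f (at p) = f' p" for p
    using frechet_derivative_at[OF f'(1)] by simp
  show ?case using Suc.IH[OF f'(2)] differentiableI[OF f'(1)] by (simp add: e)
qed

text \<open>Conjugation swaps z_j and conj z_j. It is needed because the CR vector fields used as
  tests have conjugated coefficients.\<close>

lemma polyfun_cnj:
  fixes f :: "('n::finite + 'n \<Rightarrow> complex) \<Rightarrow> complex"
  shows "polyfun f \<Longrightarrow> \<exists>g. polyfun g \<and> (\<forall>z. g (zz z) = cnj (f (zz z)))"
proof (induction rule: polyfun_induct)
  case (const c)
  show ?case by (rule exI[of _ "\<lambda>x. cnj c"]) (simp add: polyfun_const)
next
  case (add f1 f2)
  then obtain g1 g2 where "polyfun g1" "\<forall>z. g1 (zz z) = cnj (f1 (zz z))"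
    "polyfun g2" "\<forall>z. g2 (zz z) = cnj (f2 (zz z))" by blast
  then show ?case by (intro exI[of _ "\<lambda>x. g1 x + g2 x"]) (simp add: polyfun_add)
next
  case (mult_var f v)
  then obtain g where g: "polyfun g" "\<forall>z. g (zz z) = cnj (f (zz z))" by blast
  let ?w = "case v of Inl j \<Rightarrow> Inr j | Inr j \<Rightarrow> Inl j"
  have "zz z ?w = cnj (zz z v)" for z by (cases v) simp_all
  with g show ?case by (intro exI[of _ "\<lambda>x. x ?w * g x"]) (simp add: polyfun_mult_var)
qed

text \<open>The factor 2 arises because h'(v) + i h'(i v) is twice the antilinear part of h' at v,
  by \<open>zderiv_i\<close>.\<close>

lemma apply_vector_T01:
  fixes f h :: "('n::finite + 'n \<Rightarrow> complex) \<Rightarrow> complex"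
  assumes f: "polyfun f" and h: "polyfun h"
    and v: "(\<Sum>j\<in>UNIV. pd (Inr j) f (zz z) * cnj (v $ j)) = 0"
  shows "apply_vector (fun_graph (\<lambda>z. f (zz z))) ((v, zderiv f z v), pt_scale \<i> (v, zderiv f z v))
    (\<lambda>p. h (zz (fst p))) (z, f (zz z)) = 2 * (\<Sum>j\<in>UNIV. pd (Inr j) h (zz z) * cnj (v $ j))"
proof -
  let ?M = "fun_graph (\<lambda>z. f (zz z))"
  have i: "pt_scale \<i> (v, zderiv f z v) = (\<i> *s v, zderiv f z (\<i> *s v))"
    using v by (simp add: pt_scale_def zderiv_i)
  have t: "(u, zderiv f z u) \<in> tangent_space ?M (z, f (zz z))" for u
    unfolding tangent_space_fun_graph[OF has_zderiv[OF f]] by blast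
  have "((\<lambda>p. h (zz (fst p))) has_derivative (\<lambda>v. zderiv h z (fst v))) (at (z, f (zz z)))"
    using has_derivative_compose[OF has_derivative_fst[OF has_derivative_ident] has_zderiv[OF h], of "(z, f (zz z))"]
    by simp
  note d = frechet_derivative_within_tangent[OF this t]
  show ?thesis unfolding apply_vector_def i fst_conv snd_conv d zderiv_i[of h] by (simp add: algebra_simps)
qed

text \<open>At a CR point the admissible v form the hyperplane q . conj v = 0 for q = dbar f, and
  dbar h vanishes on it iff it is proportional to q; the 2 x 2 minors express this. Elsewhere q = 0
  and the minors vanish trivially, so all z may be quantified over.\<close>

lemma CR_function_fun_graph_iff:
  fixes f h :: "('n::finite + 'n \<Rightarrow> complex) \<Rightarrow> complex"
  assumes f: "polyfun f" and nz: "pd (Inr j0) f \<noteq> (\<lambda>x. 0)" and h: "polyfun h"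
  shows "CR_function (fun_graph (\<lambda>z. f (zz z))) (\<lambda>p. h (zz (fst p))) \<longleftrightarrow>
    (\<forall>z j k. pd (Inr k) f (zz z) * pd (Inr j) h (zz z) = pd (Inr j) f (zz z) * pd (Inr k) h (zz z))"
    (is "?L \<longleftrightarrow> ?R")
proof
  let ?M = "fun_graph (\<lambda>z. f (zz z))"
  assume L: ?L
  show ?R
  proof (intro allI)
    fix z j k
    show "pd (Inr k) f (zz z) * pd (Inr j) h (zz z) = pd (Inr j) f (zz z) * pd (Inr k) h (zz z)"
    proof (cases "j = k \<or> (\<forall>j. pd (Inr j) f (zz z) = 0)")
      case True
      then show ?thesis by auto
    next
      case False
      then have jk: "j \<noteq> k" and CR: "(z, f (zz z)) \<in> CR_points ?M"
        unfolding CR_points_fun_graph[OF f nz] by blast+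
      \<comment> \<open>conj V = q_k e_j - q_j e_k lies in the kernel of q and is polynomial in (z,
        conj z); pairing dbar h with it gives the minor for j and k.\<close>
      define V where "V z = axis j (cnj (pd (Inr k) f (zz z))) + axis k (- cnj (pd (Inr j) f (zz z)))" for z
      have V: "(\<Sum>l\<in>UNIV. g l * V z $ l) = g j * cnj (pd (Inr k) f (zz z)) - g k * cnj (pd (Inr j) f (zz z))" for g z
      proof -
        have "(\<Sum>l\<in>UNIV. g l * V z $ l) = (\<Sum>l\<in>UNIV. (if l = j then g j * cnj (pd (Inr k) f (zz z)) else 0)
           + (if l = k then - g k * cnj (pd (Inr j) f (zz z)) else 0))"
          using jk by (intro sum.cong) (auto simp: V_def axis_def)
        then show ?thesis by (simp add: sum.distrib)
      qed
      have Vc: "(\<Sum>l\<in>UNIV. g l * cnj (V z $ l)) = g j * pd (Inr k) f (zz z) - g k * pd (Inr j) f (zz z)" for g z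
      proof -
        have "(\<Sum>l\<in>UNIV. g l * cnj (V z $ l)) = cnj (\<Sum>l\<in>UNIV. cnj (g l) * V z $ l)" by simp
        then show ?thesis unfolding V by simp
      qed
      have V0: "(\<Sum>l\<in>UNIV. pd (Inr l) f (zz z) * cnj (V z $ l)) = 0" for z
        unfolding Vc by simp
      define X where "X p = ((V (fst p), zderiv f (fst p) (V (fst p))),
        pt_scale \<i> (V (fst p), zderiv f (fst p) (V (fst p))))" for p :: "'n pt"
      obtain qj qk where qj: "polyfun qj" "\<And>z. qj (zz z) = - cnj (pd (Inr j) f (zz z))"
        and qk: "polyfun qk" "\<And>z. qk (zz z) = cnj (pd (Inr k) f (zz z))"
      proof -
        obtain g1 where "polyfun g1" "\<forall>z. g1 (zz z) = cnj (pd (Inr j) f (zz z))"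
          using polyfun_cnj[OF polyfun_pd[OF f]] by blast
        moreover obtain g2 where "polyfun g2" "\<forall>z. g2 (zz z) = cnj (pd (Inr k) f (zz z))"
          using polyfun_cnj[OF polyfun_pd[OF f]] by blast
        ultimately show ?thesis using that[of "\<lambda>x. - g1 x" g2] polyfun_minus[of g1] by simp
      qed
      \<comment> \<open>X is split along e_j, e_k and the w-axis to bring it into the form required
        by \<open>zpoly_map\<close>.\<close>
      define \<Lambda> where "\<Lambda> l a = ((axis l a, 0 :: complex), pt_scale \<i> (axis l a, 0))" for l :: 'n and a :: complex
      define \<Lambda>w where "\<Lambda>w a = ((0 :: complex ^ 'n, a), pt_scale \<i> (0 :: complex ^ 'n, a))" for a :: complex
      have "linear (\<Lambda> l)" for l
        by (rule linearI) (simp_all add: \<Lambda>_def pt_scale_def vec_eq_iff axis_def algebra_simps)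
      then have bl: "bounded_linear (\<Lambda> l)" for l by (simp add: linear_conv_bounded_linear)
      have "linear \<Lambda>w"
        by (rule linearI) (simp_all add: \<Lambda>w_def pt_scale_def algebra_simps)
      then have bw: "bounded_linear \<Lambda>w" by (simp add: linear_conv_bounded_linear)
      let ?s = "\<lambda>x. pd (Inl j) f x * qk x + pd (Inl k) f x * qj x"
      have "X p = \<Lambda> j (qk (zz (fst p))) + \<Lambda> k (qj (zz (fst p))) + \<Lambda>w (?s (zz (fst p)))" for p
      proof -
        have "zderiv f (fst p) (V (fst p)) = ?s (zz (fst p))"
          unfolding zderiv_split V0 V qj qk by simp
        then show ?thesis
          by (simp add: X_def V_def \<Lambda>_def \<Lambda>w_def qj qk pt_scale_def vector_add_ldistrib)
      qed
      then have X: "X = (\<lambda>p. \<Lambda> j (qk (zz (fst p))) + \<Lambda> k (qj (zz (fst p))) + \<Lambda>w (?s (zz (fst p))))" ..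
      have "zpoly_map X" unfolding X
        by (intro zpoly_map.intros bl bw qj qk polyfun_add polyfun_mult polyfun_pd f)
      then have "smooth_on X (CR_points ?M)"
        unfolding smooth_on_def using zpoly_map_Ck[of X] by (metis UNIV_I open_UNIV)
      moreover have "X p \<in> T01 ?M p" if p: "p \<in> CR_points ?M" for p
      proof -
        obtain y where y: "p = (y, f (zz y))"
          using p unfolding CR_points_fun_graph[OF f nz] by blast
        show ?thesis unfolding y T01_fun_graph[OF f] X_def fst_conv using V0[of y] by blast
      qed
      ultimately have "CR_vector_field ?M X" by (simp add: CR_vector_field_def)
      then have "apply_vector ?M (X (z, f (zz z))) (\<lambda>p. h (zz (fst p))) (z, f (zz z)) = 0"
        using L CR unfolding CR_function_def by blast
      then have "(\<Sum>l\<in>UNIV. pd (Inr l) h (zz z) * cnj (V z $ l)) = 0"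
        unfolding X_def fst_conv apply_vector_T01[OF f h V0] by simp
      then show ?thesis unfolding Vc by (simp add: algebra_simps)
    qed
  qed
next
  let ?M = "fun_graph (\<lambda>z. f (zz z))"
  assume R: ?R
  have "(\<lambda>p. h (zz (fst p))) differentiable (at p within ?M)" for p
    using has_derivative_compose[OF has_derivative_fst[OF has_derivative_ident] has_zderiv[OF h], of p UNIV]
    by (meson differentiableI has_derivative_at_withinI)
  moreover have "apply_vector ?M (X p) (\<lambda>p. h (zz (fst p))) p = 0"
    if X: "CR_vector_field ?M X" and p: "p \<in> CR_points ?M" for X p
  proof -
    obtain z k where z: "p = (z, f (zz z))" and k: "pd (Inr k) f (zz z) \<noteq> 0"
      using p unfolding CR_points_fun_graph[OF f nz] by blast
    have "X p \<in> T01 ?M p" using X p by (simp add: CR_vector_field_def)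
    then obtain v where v: "X p = ((v, zderiv f z v), pt_scale \<i> (v, zderiv f z v))"
      "(\<Sum>j\<in>UNIV. pd (Inr j) f (zz z) * cnj (v $ j)) = 0"
      unfolding z T01_fun_graph[OF f] by blast
    \<comment> \<open>Multiplying by q_k, which is nonzero at this point, lets \<open>R\<close>
      trade dbar h for a multiple of q.\<close>
    have "pd (Inr k) f (zz z) * (\<Sum>j\<in>UNIV. pd (Inr j) h (zz z) * cnj (v $ j)) =
      (\<Sum>j\<in>UNIV. (pd (Inr k) f (zz z) * pd (Inr j) h (zz z)) * cnj (v $ j))"
      unfolding sum_distrib_left by (simp only: mult.assoc)
    also have "\<dots> = pd (Inr k) h (zz z) * (\<Sum>j\<in>UNIV. pd (Inr j) f (zz z) * cnj (v $ j))"
      unfolding sum_distrib_left R[rule_format, of k z] by (intro sum.cong) auto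
    finally have "(\<Sum>j\<in>UNIV. pd (Inr j) h (zz z) * cnj (v $ j)) = 0" using k v(2) by simp
    then show ?thesis unfolding v(1) unfolding z apply_vector_T01[OF f h v(2)] by simp
  qed
  ultimately show ?L unfolding CR_function_def by blast
qed

section \<open>Second-order expansion of biholomorphic maps\<close>

text \<open>An estimate of Schwarz type: the divided difference (D w - D 0) / w extends
  holomorphically over 0 and is at most 2 e / r on the circle of radius r, hence on the
  disc.\<close>

lemma holomorphic_increment_bound:
  assumes D: "D holomorphic_on ball 0 R" and r: "0 < r" "r < R"
    and b: "\<And>w. norm w \<le> r \<Longrightarrow> norm (D w) \<le> e" and w: "norm w \<le> r"
  shows "norm (D w - D 0) \<le> 2 * e / r * norm w"
proof -
  define k where "k w = (if w = 0 then deriv D 0 else (D w - D 0) / (w - 0))" for w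
  have k: "k holomorphic_on ball 0 R"
    unfolding k_def[abs_def] by (rule pole_lemma[OF D]) (use r in auto)
  have sub: "cball 0 r \<subseteq> ball (0::complex) R" using r by auto
  have kb: "norm (k w) \<le> 2 * e / r"
  proof (rule maximum_modulus_frontier[of k "cball 0 r"])
    show "k holomorphic_on interior (cball 0 r)"
      by (rule holomorphic_on_subset[OF k]) (use r in auto)
    show "continuous_on (closure (cball 0 r)) k"
      using holomorphic_on_imp_continuous_on[OF holomorphic_on_subset[OF k sub]] by simp
    show "norm (k z) \<le> 2 * e / r" if "z \<in> frontier (cball 0 r)" for z
    proof -
      have z: "norm z = r" using that r by simp
      have "norm (D z - D 0) \<le> e + e"
        using b[of z] b[of 0] norm_triangle_ineq4[of "D z" "D 0"] z r by auto
      moreover have "z \<noteq> 0" using z r by auto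
      ultimately show ?thesis using z r by (simp add: k_def norm_divide divide_right_mono)
    qed
  qed (use w in auto)
  have "norm (D w - D 0) = norm (k w) * norm w"
    by (simp add: k_def norm_divide)
  then show ?thesis using mult_right_mono[OF kb norm_ge_zero[of w]] by (simp only:)
qed

text \<open>Dividing out one zero leaves a holomorphic function that still vanishes at 0; its
  derivative there is the limit.\<close>

lemma holomorphic_second_order_limit:
  assumes f: "f holomorphic_on ball 0 R" "0 < R" and 0: "f 0 = 0" "deriv f 0 = 0"
  shows "\<exists>g. ((\<lambda>s. f s / s\<^sup>2) \<longlongrightarrow> g) (at 0)"
proof -
  define k where "k w = (if w = 0 then deriv f 0 else (f w - f 0) / (w - 0))" for w
  have k: "k holomorphic_on ball 0 R"
    unfolding k_def[abs_def] by (rule pole_lemma[OF f(1)]) (use f in auto)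
  then have "k field_differentiable (at 0)"
    using f by (simp add: holomorphic_on_imp_differentiable_at)
  then have "(k has_field_derivative deriv k 0) (at 0)"
    by (simp add: field_differentiable_derivI)
  then have "((\<lambda>s. (k s - k 0) / (s - 0)) \<longlongrightarrow> deriv k 0) (at 0)"
    by (simp add: has_field_derivative_iff)
  note lim = this
  have "\<forall>\<^sub>F s in at 0. (k s - k 0) / (s - 0) = f s / s\<^sup>2"
    by (rule eventually_mono[OF eventually_neq_at_within[of 0]]) (simp add: k_def 0 power2_eq_square)
  from iffD1[OF tendsto_cong[OF this] lim] show ?thesis by blast
qed

text \<open>The partial derivative in w is continuous by Cauchy's estimate; this is where holomorphy in
  the second variable is used.\<close>

lemma weighted_second_order_limit:
  fixes \<gamma> :: "complex \<times> complex \<Rightarrow> complex"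
  assumes W: "open W" "(0, 0) \<in> W"
    and hol: "\<And>p. p \<in> W \<Longrightarrow> \<exists>D. (\<gamma> has_derivative D) (at p) \<and> (\<forall>c a b. D (c * a, c * b) = c * D (a, b))"
    and D0: "(\<gamma> has_derivative D0) (at (0, 0))" "\<And>c a b. D0 (c * a, c * b) = c * D0 (a, b)"
    and 0: "\<gamma> (0, 0) = 0" "D0 (1, 0) = 0"
  shows "\<exists>g. \<forall>k. ((\<lambda>s. \<gamma> (s, s\<^sup>2 * k) / s\<^sup>2) \<longlongrightarrow> g + D0 (0, 1) * k) (at 0)"
proof -
  obtain A B where AB: "open A" "open B" "(0::complex) \<in> A" "(0::complex) \<in> B" "A \<times> B \<subseteq> W"
    by (rule open_prod_elim[OF W]) simp
  obtain \<rho> where \<rho>: "\<rho> > 0" "ball 0 \<rho> \<subseteq> A" using AB(1,3) open_contains_ball by blast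
  obtain R where R: "R > 0" "ball 0 R \<subseteq> B" using AB(2,4) open_contains_ball by blast
  have inW: "(s, w) \<in> W" if "norm s < \<rho>" "norm w < R" for s w
  proof -
    have "s \<in> A" "w \<in> B" using subsetD[OF \<rho>(2), of s] subsetD[OF R(2), of w] that by simp_all
    then show ?thesis using AB(5) by blast
  qed
  have hol2: "(\<lambda>w. \<gamma> (s, w)) holomorphic_on ball 0 R" if "norm s < \<rho>" for s
  proof -
    have "\<exists>f'. ((\<lambda>w. \<gamma> (s, w)) has_field_derivative f') (at w)" if w: "w \<in> ball 0 R" for w
    proof -
      obtain D where D: "(\<gamma> has_derivative D) (at (s, w))" "\<And>c a b. D (c * a, c * b) = c * D (a, b)"
        using hol[of "(s, w)"] inW[of s w] \<open>norm s < \<rho>\<close> w by auto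
      have "((\<lambda>w. (s, w)) has_derivative (\<lambda>h. (0, h))) (at w)"
        by (intro has_derivative_Pair has_derivative_const has_derivative_ident)
      from has_derivative_compose[OF this D(1)]
      have "((\<lambda>w. \<gamma> (s, w)) has_derivative (\<lambda>h. D (0, h))) (at w)" .
      moreover have "D (0, h) = D (0, 1) * h" for h
        using D(2)[of h 0 1] by (simp add: mult.commute)
      then have "(\<lambda>h. D (0, h)) = (*) (D (0, 1))" by (rule ext)
      ultimately show ?thesis by (auto simp: has_field_derivative_def)
    qed
    then show ?thesis by (auto simp: holomorphic_on_open)
  qed
  have hol1: "(\<lambda>s. \<gamma> (s, 0)) holomorphic_on ball 0 \<rho>"
  proof -
    have "\<exists>f'. ((\<lambda>s. \<gamma> (s, 0)) has_field_derivative f') (at s)" if s: "s \<in> ball 0 \<rho>" for s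
    proof -
      obtain D where D: "(\<gamma> has_derivative D) (at (s, 0))" "\<And>c a b. D (c * a, c * b) = c * D (a, b)"
        using hol[of "(s, 0)"] inW[of s 0] s R by auto
      have "((\<lambda>s. (s, 0::complex)) has_derivative (\<lambda>h. (h, 0))) (at s)"
        by (intro has_derivative_Pair has_derivative_const has_derivative_ident)
      from has_derivative_compose[OF this D(1)]
      have "((\<lambda>s. \<gamma> (s, 0)) has_derivative (\<lambda>h. D (h, 0))) (at s)" .
      moreover have "D (h, 0) = D (1, 0) * h" for h
        using D(2)[of h 1 0] by (simp add: mult.commute)
      then have "(\<lambda>h. D (h, 0)) = (*) (D (1, 0))" by (rule ext)
      ultimately show ?thesis by (auto simp: has_field_derivative_def)
    qed
    then show ?thesis by (auto simp: holomorphic_on_open)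
  qed
  have d1: "((\<lambda>s. \<gamma> (s, 0)) has_field_derivative 0) (at 0)"
  proof -
    have "((\<lambda>s. (s, 0::complex)) has_derivative (\<lambda>h. (h, 0))) (at 0)"
      by (intro has_derivative_Pair has_derivative_const has_derivative_ident)
    from has_derivative_compose[OF this D0(1)]
    have "((\<lambda>s. \<gamma> (s, 0)) has_derivative (\<lambda>h. D0 (h, 0))) (at 0)" .
    moreover have "D0 (h, 0) = 0 * h" for h
      using D0(2)[of h 1 0] 0(2) by simp
    then have "(\<lambda>h. D0 (h, 0)) = (*) 0" by (rule ext)
    ultimately show ?thesis by (simp add: has_field_derivative_def)
  qed
  have d2: "((\<lambda>w. \<gamma> (0, w)) has_field_derivative D0 (0, 1)) (at 0)"
  proof -
    have "((\<lambda>w. (0::complex, w)) has_derivative (\<lambda>h. (0, h))) (at 0)"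
      by (intro has_derivative_Pair has_derivative_const has_derivative_ident)
    from has_derivative_compose[OF this D0(1)]
    have "((\<lambda>w. \<gamma> (0, w)) has_derivative (\<lambda>h. D0 (0, h))) (at 0)" .
    moreover have "D0 (0, h) = D0 (0, 1) * h" for h
      using D0(2)[of h 0 1] by (simp add: mult.commute)
    then have "(\<lambda>h. D0 (0, h)) = (*) (D0 (0, 1))" by (rule ext)
    ultimately show ?thesis by (simp add: has_field_derivative_def)
  qed
  obtain g where g: "((\<lambda>s. \<gamma> (s, 0) / s\<^sup>2) \<longlongrightarrow> g) (at 0)"
    using holomorphic_second_order_limit[OF hol1 \<rho>(1) 0(1) DERIV_imp_deriv[OF d1]] by blast
  have lim2: "((\<lambda>s. \<gamma> (0, s\<^sup>2 * k) / s\<^sup>2) \<longlongrightarrow> D0 (0, 1) * k) (at 0)" for k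
  \<comment> \<open>The difference quotient is taken at s^2 k, which must be nonzero.\<close>
  proof (cases "k = 0")
    case True
    then show ?thesis using 0 by simp
  next
    case False
    have "((\<lambda>w. (\<gamma> (0, w) - \<gamma> (0, 0)) / (w - 0)) \<longlongrightarrow> D0 (0, 1)) (at 0)"
      using d2 by (simp add: has_field_derivative_iff)
    moreover have "filterlim (\<lambda>s. s\<^sup>2 * k) (at 0) (at 0)"
      unfolding filterlim_at
    proof
      have "((\<lambda>s. s\<^sup>2 * k) \<longlongrightarrow> 0\<^sup>2 * k) (at 0)" by (intro tendsto_intros)
      then show "((\<lambda>s. s\<^sup>2 * k) \<longlongrightarrow> 0) (at 0)" by simp
      show "\<forall>\<^sub>F s in at 0. s\<^sup>2 * k \<in> UNIV \<and> s\<^sup>2 * k \<noteq> 0"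
        by (rule eventually_mono[OF eventually_neq_at_within[of 0]]) (simp add: False)
    qed
    ultimately have "((\<lambda>s. (\<gamma> (0, s\<^sup>2 * k) - \<gamma> (0, 0)) / (s\<^sup>2 * k - 0)) \<longlongrightarrow> D0 (0, 1)) (at 0)"
      by (rule filterlim_compose)
    from tendsto_mult_right[OF this, of k]
    show ?thesis using False 0 by simp
  qed
  define r where "r = R / 2"
  have r: "0 < r" "r < R" using R by (auto simp: r_def)
  let ?K = "cball 0 (\<rho>/2) \<times> cball 0 r :: (complex \<times> complex) set"
  have "continuous_on W \<gamma>"
    using hol has_derivative_continuous by (blast intro: continuous_at_imp_continuous_on)
  moreover have "?K \<subseteq> W" using inW \<rho>(1) r by auto
  ultimately have "uniformly_continuous_on ?K \<gamma>"
    by (intro compact_uniformly_continuous compact_Times compact_cball) (rule continuous_on_subset)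
  note uc = this[unfolded uniformly_continuous_on_def]
  \<comment> \<open>The mixed part. For small s, the function w \<mapsto> \<gamma>(s, w) -
    \<gamma>(0, w) is uniformly small on a disc, so its increment from 0 is small compared with |w|
    = |s|^2 |k|.\<close>
  have lim3: "((\<lambda>s. (\<gamma> (s, s\<^sup>2 * k) - \<gamma> (s, 0)) / s\<^sup>2 - \<gamma> (0, s\<^sup>2 * k) / s\<^sup>2) \<longlongrightarrow> 0) (at 0)" for k
  proof (rule tendstoI)
    fix e :: real assume e: "e > 0"
    \<comment> \<open>Chosen so that (2 e' / r) |k| = e |k| / (2 (|k| + 1)) < e; the + 1 covers k =
      0.\<close>
    define e' where "e' = e * r / (4 * (norm k + 1))"
    have nk: "norm k + 1 > 0" using norm_ge_zero[of k] by linarith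
    have e': "e' > 0" using e r nk by (simp add: e'_def)
    obtain d where d: "d > 0" "\<And>x y. x \<in> ?K \<Longrightarrow> y \<in> ?K \<Longrightarrow> dist y x < d \<Longrightarrow> dist (\<gamma> y) (\<gamma> x) < e'"
      using uc e' by meson
    have bound: "norm (\<gamma> (s, w) - \<gamma> (0, w) - (\<gamma> (s, 0) - \<gamma> (0, 0))) \<le> 2 * e' / r * norm w"
      if s: "norm s < d" "norm s < \<rho> / 2" and w: "norm w \<le> r" for s w
    proof (rule holomorphic_increment_bound[OF _ r])
      show "(\<lambda>w. \<gamma> (s, w) - \<gamma> (0, w)) holomorphic_on ball 0 R"
        using hol2[of s] hol2[of 0] s \<rho>(1) by (intro holomorphic_intros) auto
      show "norm (\<gamma> (s, w) - \<gamma> (0, w)) \<le> e'" if "norm w \<le> r" for w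
        using d(2)[of "(0, w)" "(s, w)"] s that \<rho>(1) by (simp add: dist_norm dist_Pair_Pair)
    qed (rule w)
    have "((\<lambda>s. s\<^sup>2 * k) \<longlongrightarrow> 0\<^sup>2 * k) (at 0)" by (intro tendsto_intros)
    then have "\<forall>\<^sub>F s in at 0. norm (s\<^sup>2 * k) < r"
      using r(1) by (auto dest: tendstoD)
    moreover have "\<forall>\<^sub>F s in at (0::complex). norm s < min d (\<rho> / 2)"
      using d(1) \<rho>(1) unfolding eventually_at
      by (intro exI[of _ "min d (\<rho> / 2)"]) (auto simp: dist_norm)
    moreover have "\<forall>\<^sub>F s in at (0::complex). s \<noteq> 0" by (rule eventually_neq_at_within)
    ultimately show "\<forall>\<^sub>F s in at 0. dist ((\<gamma> (s, s\<^sup>2 * k) - \<gamma> (s, 0)) / s\<^sup>2 - \<gamma> (0, s\<^sup>2 * k) / s\<^sup>2) 0 < e"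
    proof eventually_elim
      case (elim s)
      have "dist ((\<gamma> (s, s\<^sup>2 * k) - \<gamma> (s, 0)) / s\<^sup>2 - \<gamma> (0, s\<^sup>2 * k) / s\<^sup>2) 0
        = norm (\<gamma> (s, s\<^sup>2 * k) - \<gamma> (0, s\<^sup>2 * k) - (\<gamma> (s, 0) - \<gamma> (0, 0))) / norm (s\<^sup>2)"
        by (simp add: 0 dist_norm norm_divide[symmetric] diff_divide_distrib[symmetric] algebra_simps del: norm_power)
      also have "\<dots> \<le> (2 * e' / r * norm (s\<^sup>2 * k)) / norm (s\<^sup>2)"
        using elim by (intro divide_right_mono bound) auto
      also have "\<dots> = 2 * e' / r * norm k" using elim by (simp add: norm_mult del: norm_power)
      also have "\<dots> = e * (norm k / (2 * (norm k + 1)))"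
      proof -
        have gen: "2 * (e * r / (4 * m)) / r * n = e * (n / (2 * m))" if "m \<noteq> 0" for m n :: real
          using r that by (simp add: field_simps)
        show ?thesis unfolding e'_def by (rule gen) (use nk in linarith)
      qed
      also have "\<dots> < e * 1"
      proof (rule mult_strict_left_mono[OF _ e])
        have gen: "x / (2 * (x + 1)) < 1" if "0 \<le> x" for x :: real
          using that by (simp add: divide_less_eq)
        show "norm k / (2 * (norm k + 1)) < 1" by (rule gen[OF norm_ge_zero])
      qed
      finally show ?case by simp
    qed
  qed
  have "((\<lambda>s. \<gamma> (s, s\<^sup>2 * k) / s\<^sup>2) \<longlongrightarrow> g + D0 (0, 1) * k) (at 0)" for k
  proof -
    have "((\<lambda>s. ((\<gamma> (s, s\<^sup>2 * k) - \<gamma> (s, 0)) / s\<^sup>2 - \<gamma> (0, s\<^sup>2 * k) / s\<^sup>2) +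
        (\<gamma> (s, 0) / s\<^sup>2 + \<gamma> (0, s\<^sup>2 * k) / s\<^sup>2)) \<longlongrightarrow> 0 + (g + D0 (0, 1) * k)) (at 0)"
      by (intro tendsto_add lim3 lim2 g)
    then show ?thesis by (simp add: diff_divide_distrib)
  qed
  then show ?thesis by blast
qed

section \<open>Quadratic forms and the second-order terms of an equivalence\<close>

definition polar :: "('a::plus \<Rightarrow> complex) \<Rightarrow> 'a \<Rightarrow> 'a \<Rightarrow> complex" where
  "polar Q z v = Q (z + v) - Q z - Q v"

text \<open>Quadratic forms over the reals with complex values: Q mixes z and conj z, so homogeneity
  is asked for real t. Additivity in one argument suffices since \<open>polar\<close> is
  symmetric.\<close>

definition quadratic :: "(complex ^ 'n::finite \<Rightarrow> complex) \<Rightarrow> bool" where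
  "quadratic Q \<longleftrightarrow> continuous_on UNIV Q \<and> (\<forall>t z. Q (t *\<^sub>R z) = (complex_of_real t)\<^sup>2 * Q z) \<and>
     (\<forall>x y z. polar Q (x + y) z = polar Q x z + polar Q y z)"

lemma scaleR_vec_eq: "t *\<^sub>R z = complex_of_real t *s z" for z :: "complex ^ 'n"
  by (simp add: vec_eq_iff scaleR_conv_of_real[where 'a=complex])

lemma vector_derivative_quotient_limit:
  assumes "(f has_vector_derivative D) (at 0)" "f 0 = 0"
  shows "((\<lambda>t. (1 / t) *\<^sub>R f t) \<longlongrightarrow> D) (at (0::real))"
proof -
  have "((\<lambda>t. norm (f (0 + t) - f 0 - t *\<^sub>R D) / norm t) \<longlongrightarrow> 0) (at 0)"
    using assms(1) unfolding has_vector_derivative_def has_derivative_at by blast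
  moreover have "\<forall>\<^sub>F t in at 0. norm (f (0 + t) - f 0 - t *\<^sub>R D) / norm t = norm ((1 / t) *\<^sub>R f t - D)"
  proof (rule eventually_mono[OF eventually_neq_at_within[of 0]])
    fix t :: real assume t: "t \<noteq> 0"
    have "(1 / t) *\<^sub>R f t - D = (1 / t) *\<^sub>R (f t - t *\<^sub>R D)"
      using t by (simp add: scaleR_diff_right)
    then show "norm (f (0 + t) - f 0 - t *\<^sub>R D) / norm t = norm ((1 / t) *\<^sub>R f t - D)"
      using assms(2) by simp
  qed
  ultimately have "((\<lambda>t. norm ((1 / t) *\<^sub>R f t - D)) \<longlongrightarrow> 0) (at 0)"
    by (rule Lim_transform_eventually)
  then show ?thesis by (rule LIM_zero_cancel[OF tendsto_norm_zero_cancel])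
qed

text \<open>Both sides of G(z, Q z) = Q' (H (z, Q z)) are expanded to second order along the parabola
  t \<mapsto> (t z, t^2 Q z); complex homogeneity of the remainder says that it is holomorphic.\<close>

lemma biholomorphic_quadratic_linear:
  fixes Q Q' :: "complex ^ 'n::finite \<Rightarrow> complex"
  assumes Q: "quadratic Q" and Q': "quadratic Q'"
    and eq: "biholomorphically_equivalent (fun_graph Q) (fun_graph Q')"
  shows "\<exists>L c. (\<forall>x y. L (x + y) = L x + L y) \<and> (\<forall>a x. L (a *s x) = a *s L x) \<and> c \<noteq> 0 \<and>
    (\<forall>a z. Q' (L (a *s z)) - c * Q (a *s z) = a\<^sup>2 * (Q' (L z) - c * Q z))"
proof -
  obtain U V \<Phi> \<Psi> where U: "open U" "0 \<in> U" and V: "open V" "0 \<in> V" and "\<Phi> ` U = V" "\<Psi> ` V = U"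
    and inv': "\<forall>p\<in>U. \<Psi> (\<Phi> p) = p" "\<forall>q\<in>V. \<Phi> (\<Psi> q) = q"
    and hol: "holomorphic_map_on \<Phi> U" "holomorphic_map_on \<Psi> V"
    and 0: "\<Phi> 0 = 0" and MN: "\<Phi> ` (fun_graph Q \<inter> U) = fun_graph Q' \<inter> V"
    using eq unfolding biholomorphically_equivalent_def by (elim exE conjE) (rule that; assumption)
  note inv = inv'[rule_format]
  obtain L0 where L0: "(\<Phi> has_derivative L0) (at 0)" "\<And>c v. L0 (pt_scale c v) = pt_scale c (L0 v)"
    using hol(1) U(2) unfolding holomorphic_map_on_def by blast
  obtain L1 where L1: "(\<Psi> has_derivative L1) (at 0)"
    using hol(2) V(2) unfolding holomorphic_map_on_def by blast
  have \<Psi>0: "\<Psi> 0 = 0" using inv(1)[OF U(2)] 0 by simp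
  have L01: "L0 (L1 v) = v" for v
  proof -
    have "((\<lambda>q. \<Phi> (\<Psi> q)) has_derivative (\<lambda>v. L0 (L1 v))) (at 0)"
      by (rule has_derivative_compose[OF L1]) (simp add: \<Psi>0 L0)
    then have "((\<lambda>q. q) has_derivative (\<lambda>v. L0 (L1 v))) (at 0)"
      by (rule has_derivative_transform_within_open[OF _ V]) (rule inv(2))
    from fun_cong[OF has_derivative_unique[OF has_derivative_ident this], of v] show ?thesis
      by (rule sym)
  qed
  have L0_add: "L0 (x + y) = L0 x + L0 y" for x y
    by (rule linear_add[OF has_derivative_linear[OF L0(1)]])
  have homQ: "Q (complex_of_real t *s z) = (complex_of_real t)\<^sup>2 * Q z" for t z
    using Q unfolding quadratic_def scaleR_vec_eq by blast
  have homQ': "Q' (t *\<^sub>R z) = (complex_of_real t)\<^sup>2 * Q' z" for t z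
    using Q' unfolding quadratic_def by blast
  \<comment> \<open>The w-component of \<Phi> at the points (s z, w), as a function of two complex
    variables.\<close>
  define \<gamma> where "\<gamma> z p = snd (\<Phi> (fst p *s z, snd p))" for z p
  define L where "L z = fst (L0 (z, 0))" for z
  define c where "c = snd (L0 (0, 1))"
  have lin: "bounded_linear (\<lambda>p :: complex \<times> complex. (fst p *s z, snd p))" for z :: "complex ^ 'n"
    unfolding linear_conv_bounded_linear[symmetric]
    by (rule linearI) (simp_all add: vec_eq_iff algebra_simps)
  have snd_L0: "snd (L0 (pt_scale a v)) = a * snd (L0 v)" for a v
    unfolding L0(2) by (simp add: pt_scale_def)
  \<comment> \<open>Over the real line through z the image stays in the second graph, so its
    w-component is Q' of its z-component. Dividing by t^2 gives the limit; in particular the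
    w-component is o(t), so L0 maps (z, 0) into w = 0.\<close>
  have key: "((\<lambda>t. \<gamma> z (complex_of_real t, (complex_of_real t)\<^sup>2 * Q z) / (complex_of_real t)\<^sup>2) \<longlongrightarrow> Q' (L z)) (at 0)
    \<and> snd (L0 (z, 0)) = 0" for z
  proof -
    define P where "P t = (complex_of_real t *s z, (complex_of_real t)\<^sup>2 * Q z)" for t
    have P0: "P 0 = 0" by (simp add: P_def zero_prod_def)
    have "((\<lambda>t. complex_of_real t *s z) has_vector_derivative z) (at 0)"
      unfolding scaleR_vec_eq[symmetric] by (auto intro!: derivative_eq_intros)
    moreover have "((\<lambda>s. s\<^sup>2 * Q z) has_field_derivative 0) (at (complex_of_real 0))"
      by (auto intro!: derivative_eq_intros)
    then have "((\<lambda>t. (complex_of_real t)\<^sup>2 * Q z) has_vector_derivative 0) (at 0)"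
      by (rule has_vector_derivative_real_field)
    ultimately have dP: "(P has_vector_derivative (z, 0)) (at 0)"
      unfolding P_def[abs_def] by (rule has_vector_derivative_Pair)
    then have "isCont P 0" by (rule has_vector_derivative_continuous)
    then have "\<forall>\<^sub>F t in at 0. P t \<in> U"
      using topological_tendstoD[OF _ U(1), of P 0 "at 0"] U(2) by (simp add: isCont_def P0)
    moreover have "snd (\<Phi> (P t)) = Q' (fst (\<Phi> (P t)))" if "P t \<in> U" for t
    proof -
      have "P t \<in> fun_graph Q" by (simp add: P_def fun_graph_def homQ)
      then have "\<Phi> (P t) \<in> fun_graph Q'" using that MN by blast
      then show ?thesis by (auto simp: fun_graph_def split_beta)
    qed
    ultimately have ev: "\<forall>\<^sub>F t in at 0. snd (\<Phi> (P t)) = Q' (fst (\<Phi> (P t)))"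
      by (auto elim: eventually_mono)
    have "(\<Phi> has_derivative L0) (at (P 0))" using L0(1) by (simp add: P0)
    then have "((\<lambda>t. \<Phi> (P t)) has_derivative (\<lambda>t. L0 (t *\<^sub>R (z, 0)))) (at 0)"
      using dP unfolding has_vector_derivative_def by (rule has_derivative_compose[rotated])
    then have "((\<lambda>t. \<Phi> (P t)) has_vector_derivative L0 (z, 0)) (at 0)"
      unfolding has_vector_derivative_def linear_cmul[OF has_derivative_linear[OF L0(1)]] .
    then have lim: "((\<lambda>t. (1 / t) *\<^sub>R \<Phi> (P t)) \<longlongrightarrow> L0 (z, 0)) (at 0)"
      by (rule vector_derivative_quotient_limit) (simp add: P0 0)
    have "isCont Q' (L z)" using Q' by (simp add: quadratic_def continuous_on_eq_continuous_at)
    moreover have "((\<lambda>t. fst ((1 / t) *\<^sub>R \<Phi> (P t))) \<longlongrightarrow> L z) (at 0)"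
      unfolding L_def by (rule tendsto_fst[OF lim])
    ultimately have "((\<lambda>t. Q' (fst ((1 / t) *\<^sub>R \<Phi> (P t)))) \<longlongrightarrow> Q' (L z)) (at 0)"
      by (rule isCont_tendsto_compose)
    moreover have "\<forall>\<^sub>F t in at 0. Q' (fst ((1 / t) *\<^sub>R \<Phi> (P t))) = snd (\<Phi> (P t)) / (complex_of_real t)\<^sup>2"
      using ev by (rule eventually_mono) (simp add: homQ' power_divide)
    ultimately have lim1: "((\<lambda>t. snd (\<Phi> (P t)) / (complex_of_real t)\<^sup>2) \<longlongrightarrow> Q' (L z)) (at 0)"
      by (rule Lim_transform_eventually)
    have "((\<lambda>t. complex_of_real t * (snd (\<Phi> (P t)) / (complex_of_real t)\<^sup>2)) \<longlongrightarrow> complex_of_real 0 * Q' (L z)) (at 0)"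
      by (intro tendsto_mult lim1 tendsto_of_real tendsto_ident_at)
    moreover have "\<forall>\<^sub>F t in at 0. complex_of_real t * (snd (\<Phi> (P t)) / (complex_of_real t)\<^sup>2) = snd ((1 / t) *\<^sub>R \<Phi> (P t))"
      by (rule eventually_mono[OF eventually_neq_at_within[of 0]])
        (simp add: power2_eq_square scaleR_conv_of_real)
    ultimately have "((\<lambda>t. snd ((1 / t) *\<^sub>R \<Phi> (P t))) \<longlongrightarrow> complex_of_real 0 * Q' (L z)) (at 0)"
      by (rule Lim_transform_eventually)
    from tendsto_unique[OF _ tendsto_snd[OF lim] this] have "snd (L0 (z, 0)) = 0" by simp
    then show ?thesis using lim1 by (simp add: \<gamma>_def P_def)
  qed
  have "\<exists>g. (\<forall>k. ((\<lambda>s. \<gamma> z (s, s\<^sup>2 * k) / s\<^sup>2) \<longlongrightarrow> g + c * k) (at 0))" for z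
  proof -
    let ?W = "(\<lambda>p. (fst p *s z, snd p)) -` U"
    have "\<exists>g. \<forall>k. ((\<lambda>s. \<gamma> z (s, s\<^sup>2 * k) / s\<^sup>2) \<longlongrightarrow> g + (\<lambda>h. snd (L0 (fst h *s z, snd h))) (0, 1) * k) (at 0)"
    proof (rule weighted_second_order_limit)
      show "open ?W"
        using U(1) lin by (intro open_vimage) (auto intro: linear_continuous_on)
      show "(0, 0) \<in> ?W" using U(2) by (simp add: zero_prod_def)
      have d: "(\<gamma> z has_derivative (\<lambda>h. snd (D (fst h *s z, snd h)))) (at p)"
        if "(\<Phi> has_derivative D) (at (fst p *s z, snd p))" for D p
        unfolding \<gamma>_def[abs_def]
        by (rule has_derivative_snd[OF has_derivative_compose[OF bounded_linear_imp_has_derivative[OF lin] that]])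
      have s: "(fst (a * x, a * y) *s z, snd (a * x, a * y)) = pt_scale a (fst (x, y) *s z, snd (x, y))" for a x y
        by (simp add: pt_scale_def vec_eq_iff)
      show "\<exists>D. (\<gamma> z has_derivative D) (at p) \<and> (\<forall>a x y. D (a * x, a * y) = a * D (x, y))" if p: "p \<in> ?W" for p
      proof -
        obtain D where D: "(\<Phi> has_derivative D) (at (fst p *s z, snd p))" "\<forall>c v. D (pt_scale c v) = pt_scale c (D v)"
          using hol(1) p unfolding holomorphic_map_on_def by auto
        show ?thesis
          by (rule exI[of _ "\<lambda>h. snd (D (fst h *s z, snd h))"], intro conjI allI d[OF D(1)])
            (simp only: s D(2)[rule_format], simp add: pt_scale_def)
      qed
      show "(\<gamma> z has_derivative (\<lambda>h. snd (L0 (fst h *s z, snd h)))) (at (0, 0))"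
        using L0(1) by (intro d) (simp add: zero_prod_def)
      show "snd (L0 (fst (a * x, a * y) *s z, snd (a * x, a * y))) = a * snd (L0 (fst (x, y) *s z, snd (x, y)))" for a x y
        unfolding s snd_L0 ..
      show "\<gamma> z (0, 0) = 0" using 0 by (simp add: \<gamma>_def zero_prod_def)
      show "snd (L0 (fst (1, 0) *s z, snd (1, 0))) = 0" using key[of z] by simp
    qed
    then show ?thesis by (simp add: c_def)
  qed
  then obtain g where g: "\<And>z k. ((\<lambda>s. \<gamma> z (s, s\<^sup>2 * k) / s\<^sup>2) \<longlongrightarrow> g z + c * k) (at 0)"
    by metis
  \<comment> \<open>For k = Q z and real s the limit is already known from the graph
    equation.\<close>
  have gQ: "g z = Q' (L z) - c * Q z" for z
  proof -
    have "filterlim complex_of_real (at 0) (at 0)"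
      unfolding filterlim_at
      by (auto intro!: tendsto_eq_intros simp: eventually_at_filter)
    from filterlim_compose[OF g this]
    have "((\<lambda>t. \<gamma> z (complex_of_real t, (complex_of_real t)\<^sup>2 * Q z) / (complex_of_real t)\<^sup>2) \<longlongrightarrow> g z + c * Q z) (at 0)" .
    from tendsto_unique[OF _ this conjunct1[OF key]] show ?thesis by (simp add: algebra_simps)
  qed
  have L0z: "L0 0 = 0" by (rule linear_0[OF has_derivative_linear[OF L0(1)]])
  \<comment> \<open>With k = 0 the parabola degenerates to the complex line through z, on which
    replacing s by a s amounts to replacing z by a z.\<close>
  have "g (a *s z) = a\<^sup>2 * g z" for a z
  proof (cases "a = 0")
    case True
    have "Q 0 = 0" "Q' 0 = 0" using homQ[of 0 0] homQ'[of 0 0] by simp_all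
    then show ?thesis using True L0z by (simp add: gQ L_def zero_prod_def)
  next
    case False
    have "filterlim (\<lambda>s. a * s) (at 0) (at 0)"
      unfolding filterlim_at
    proof
      have "((\<lambda>s. a * s) \<longlongrightarrow> a * 0) (at 0)" by (intro tendsto_intros)
      then show "((\<lambda>s. a * s) \<longlongrightarrow> 0) (at 0)" by simp
      show "\<forall>\<^sub>F s in at 0. a * s \<in> UNIV \<and> a * s \<noteq> 0"
        by (rule eventually_mono[OF eventually_neq_at_within[of 0]]) (simp add: False)
    qed
    from filterlim_compose[OF g[of z 0] this]
    have "((\<lambda>s. \<gamma> z (a * s, (a * s)\<^sup>2 * 0) / (a * s)\<^sup>2) \<longlongrightarrow> g z + c * 0) (at 0)" .
    from tendsto_mult_left[OF this, of "a\<^sup>2"]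
    have lim: "((\<lambda>s. \<gamma> (a *s z) (s, s\<^sup>2 * 0) / s\<^sup>2) \<longlongrightarrow> a\<^sup>2 * g z) (at 0)"
      using False by (simp add: \<gamma>_def power_mult_distrib vector_smult_assoc mult.commute)
    have "((\<lambda>s. \<gamma> (a *s z) (s, s\<^sup>2 * 0) / s\<^sup>2) \<longlongrightarrow> g (a *s z)) (at 0)"
      using g[of "a *s z" 0] by simp
    from tendsto_unique[OF _ this lim] show ?thesis by simp
  qed
  moreover have "L (x + y) = L x + L y" for x y
    using L0_add[of "(x, 0)" "(y, 0)"] by (simp add: L_def)
  moreover have "L (a *s x) = a *s L x" for a x
    using L0(2)[of a "(x, 0)"] by (simp add: L_def pt_scale_def)
  \<comment> \<open>L0 is onto by \<open>L01\<close> and its w-component vanishes on all (z, 0), so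
    that component cannot vanish on (0, 1).\<close>
  moreover have "c \<noteq> 0"
  proof
    assume "c = 0"
    obtain x y where xy: "L1 (0, 1) = (x, y)" by fastforce
    have "(x, y) = (x, 0) + pt_scale y (0, 1)" by (simp add: pt_scale_def)
    then have "L0 (x, y) = L0 (x, 0) + pt_scale y (L0 (0, 1))" using L0_add L0(2) by metis
    then have "snd (L0 (x, y)) = 0" using key[of x] \<open>c = 0\<close> by (simp add: pt_scale_def c_def)
    then show False using L01[of "(0, 1)"] xy by simp
  qed
  ultimately show ?thesis unfolding gQ by blast
qed

section \<open>Invariants and the exceptional quadrics\<close>

text \<open>For a quadric with dbar Q (z) = A z + 2 conj (B z), the pairing of dbar Q (z) with conj v is
  antilinear_part Q z v; its A- and B-terms are part_A and part_B.\<close>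

definition antilinear_part :: "(complex ^ 'n::finite \<Rightarrow> complex) \<Rightarrow> complex ^ 'n \<Rightarrow> complex ^ 'n \<Rightarrow> complex" where
  "antilinear_part Q z v = (polar Q z v + \<i> * polar Q z (\<i> *s v)) / 2"

definition part_A :: "(complex ^ 'n::finite \<Rightarrow> complex) \<Rightarrow> complex ^ 'n \<Rightarrow> complex ^ 'n \<Rightarrow> complex" where
  "part_A Q z v = (antilinear_part Q z v - \<i> * antilinear_part Q (\<i> *s z) v) / 2"

definition part_B :: "(complex ^ 'n::finite \<Rightarrow> complex) \<Rightarrow> complex ^ 'n \<Rightarrow> complex ^ 'n \<Rightarrow> complex" where
  "part_B Q z v = (antilinear_part Q z v + \<i> * antilinear_part Q (\<i> *s z) v) / 2"

lemma polar_commute: "polar Q x y = polar Q y x" for Q :: "'a::ab_semigroup_add \<Rightarrow> complex"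
  by (simp add: polar_def add.commute)

text \<open>A real quadratic form with g (a z) = a^2 g z for complex a is a holomorphic one.\<close>

lemma polar_i_if_homogeneous:
  fixes g :: "complex ^ 'n::finite \<Rightarrow> complex"
  assumes add: "\<And>x y z. polar g (x + y) z = polar g x z + polar g y z"
    and hom: "\<And>a z. g (a *s z) = a\<^sup>2 * g z"
  shows "polar g z (\<i> *s v) = \<i> * polar g z v"
proof -
  have add2: "polar g z (x + y) = polar g z x + polar g z y" for x y z
    using add polar_commute by metis
  have sc: "polar g (a *s x) (a *s y) = a\<^sup>2 * polar g x y" for a x y
    unfolding polar_def vector_add_ldistrib[symmetric] hom by (simp add: right_diff_distrib)
  \<comment> \<open>Take a = 1 + i, with a^2 = 2 i. Expanding bilinearly, the term at (i x, i y) is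
    minus the one at (x, y), and the cross terms remain.\<close>
  have E: "polar g x (\<i> *s y) + polar g (\<i> *s x) y = 2 * \<i> * polar g x y" for x y
  proof -
    have e: "(1 + \<i>) *s x = x + \<i> *s x" for x :: "complex ^ 'n"
      by (simp add: vector_sadd_rdistrib)
    have "polar g (x + \<i> *s x) (y + \<i> *s y) = 2 * \<i> * polar g x y"
      using sc[of "1 + \<i>" x y] unfolding e by (simp add: power2_eq_square algebra_simps)
    moreover have "polar g (\<i> *s x) (\<i> *s y) = - polar g x y" using sc[of \<i> x y] by simp
    ultimately show ?thesis by (simp add: add add2 add.commute)
  qed
  have "polar g x 0 = 0" for x using hom[of 0 0] by (simp add: polar_def)
  then have "polar g x (- y) = - polar g x y" for x y
    using add2[of x "- y" y] by (simp add: eq_neg_iff_add_eq_0)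
  moreover have "\<i> *s (\<i> *s v) = - v" by (simp add: vec_eq_iff)
  moreover have "polar g (\<i> *s z) (\<i> *s v) = - polar g z v" using sc[of \<i> z v] by simp
  ultimately have "- polar g z v = \<i> * polar g z (\<i> *s v)" using E[of z "\<i> *s v"] by simp
  then have "\<i> * (- polar g z v) = - polar g z (\<i> *s v)" by simp
  then show ?thesis by (simp add: minus_equation_iff)
qed

text \<open>The remainder Q' (L z) - c Q z is a holomorphic form, so its polarization is complex
  linear in v and drops out of the antilinear part. Since L is complex linear, the further split
  under z \<mapsto> i z is carried along.\<close>

lemma biholomorphic_parts:
  fixes Q Q' :: "complex ^ 'n::finite \<Rightarrow> complex"
  assumes Q: "quadratic Q" and Q': "quadratic Q'"
    and eq: "biholomorphically_equivalent (fun_graph Q) (fun_graph Q')"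
  obtains L c where "\<And>x y. L (x + y) = L x + L y" "\<And>a x. L (a *s x) = a *s L x" "c \<noteq> 0"
    "\<And>z v. part_A Q' (L z) (L v) = c * part_A Q z v"
    "\<And>z v. part_B Q' (L z) (L v) = c * part_B Q z v"
proof -
  obtain L c where L: "\<And>x y. L (x + y) = L x + L y" "\<And>a x. L (a *s x) = a *s L x" and c: "c \<noteq> 0"
    and hom: "\<And>a z. Q' (L (a *s z)) - c * Q (a *s z) = a\<^sup>2 * (Q' (L z) - c * Q z)"
    using biholomorphic_quadratic_linear[OF assms] by blast
  let ?g = "\<lambda>z. Q' (L z) - c * Q z"
  have pg: "polar ?g z v = polar Q' (L z) (L v) - c * polar Q z v" for z v
    by (simp add: polar_def L algebra_simps)
  have "polar ?g (x + y) z = polar ?g x z + polar ?g y z" for x y z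
    using Q Q' unfolding pg L quadratic_def by (simp add: algebra_simps)
  from polar_i_if_homogeneous[of ?g, OF this hom]
  have "polar Q' (L z) (\<i> *s L v) - c * polar Q z (\<i> *s v) = \<i> * (polar Q' (L z) (L v) - c * polar Q z v)" for z v
    unfolding pg L by simp
  then have i: "polar Q' (L z) (\<i> *s L v) = c * polar Q z (\<i> *s v) + \<i> * (polar Q' (L z) (L v) - c * polar Q z v)" for z v
    by (simp add: diff_eq_eq add.commute)
  have "antilinear_part Q' (L z) (L v) = c * antilinear_part Q z v" for z v
    unfolding antilinear_part_def i by (simp add: algebra_simps)
  note ap = this this[of "\<i> *s _", unfolded L]
  have "part_A Q' (L z) (L v) = c * part_A Q z v" "part_B Q' (L z) (L v) = c * part_B Q z v" for z v
    unfolding part_A_def part_B_def ap by (simp_all add: algebra_simps)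
  with L c show ?thesis using that by blast
qed

section \<open>The exceptional quadrics and their inequivalence\<close>

lemma biholomorphically_equivalent_sym:
  assumes "biholomorphically_equivalent M N"
  shows "biholomorphically_equivalent N M"
proof -
  obtain U V \<Phi> \<Psi> where h: "open U" "open V" "0 \<in> U" "0 \<in> V" "\<Phi> ` U = V" "\<Psi> ` V = U"
    "\<forall>p\<in>U. \<Psi> (\<Phi> p) = p" "\<forall>q\<in>V. \<Phi> (\<Psi> q) = q"
    "holomorphic_map_on \<Phi> U" "holomorphic_map_on \<Psi> V" "\<Phi> 0 = 0" "\<Phi> ` (M \<inter> U) = N \<inter> V"
    using assms unfolding biholomorphically_equivalent_def by (elim exE conjE) (rule that; assumption)
  have "\<Psi> 0 = 0" using h(3,7,11) by metis
  moreover have "\<Psi> ` (N \<inter> V) = M \<inter> U"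
  proof -
    have "\<Psi> ` (N \<inter> V) = (\<lambda>p. \<Psi> (\<Phi> p)) ` (M \<inter> U)" unfolding h(12)[symmetric] image_image ..
    also have "\<dots> = M \<inter> U" using h(7) by simp
    finally show ?thesis .
  qed
  ultimately show ?thesis unfolding biholomorphically_equivalent_def
    using h(1-10) by - (rule exI[of _ V], rule exI[of _ U], rule exI[of _ \<Psi>], rule exI[of _ \<Phi>],
      (intro conjI; assumption))
qed

text \<open>One family for all four cases, so that their parts are computed once: the triples
  (\<alpha>, \<rho>, b) are (1, 0, 1), (1, 0, 0), (0, 1, a) and (0, 0, 1), in this order.\<close>

definition exc_fun :: "'n \<Rightarrow> 'n \<Rightarrow> complex \<Rightarrow> complex \<Rightarrow> complex \<Rightarrow> complex ^ 'n::finite \<Rightarrow> complex" where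
  "exc_fun i j \<alpha> \<rho> b z = cnj (z $ i) * (\<alpha> * z $ j + \<rho> * z $ i) + b * (cnj (z $ i))\<^sup>2"

lemma polar_exc_fun: "polar (exc_fun i j \<alpha> \<rho> b) z v =
    cnj (z $ i) * (\<alpha> * v $ j + \<rho> * v $ i) + cnj (v $ i) * (\<alpha> * z $ j + \<rho> * z $ i) + 2 * b * cnj (z $ i) * cnj (v $ i)"
  by (simp add: polar_def exc_fun_def power2_eq_square algebra_simps)

lemma quadratic_exc_fun: "quadratic (exc_fun i j \<alpha> \<rho> b)"
  unfolding quadratic_def
proof (intro conjI allI)
  show "continuous_on UNIV (exc_fun i j \<alpha> \<rho> b)"
    unfolding exc_fun_def[abs_def] by (intro continuous_intros)
  show "exc_fun i j \<alpha> \<rho> b (t *\<^sub>R z) = (complex_of_real t)\<^sup>2 * exc_fun i j \<alpha> \<rho> b z" for t z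
    unfolding scaleR_vec_eq by (simp add: exc_fun_def power2_eq_square algebra_simps)
  show "polar (exc_fun i j \<alpha> \<rho> b) (x + y) z =
      polar (exc_fun i j \<alpha> \<rho> b) x z + polar (exc_fun i j \<alpha> \<rho> b) y z" for x y z
    by (simp add: polar_exc_fun algebra_simps)
qed

lemma antilinear_part_exc_fun:
  "antilinear_part (exc_fun i j \<alpha> \<rho> b) z v = cnj (v $ i) * (\<alpha> * z $ j + \<rho> * z $ i) + 2 * b * cnj (z $ i) * cnj (v $ i)"
  by (simp add: antilinear_part_def polar_exc_fun field_simps)

lemma parts_exc_fun:
  "part_A (exc_fun i j \<alpha> \<rho> b) z v = cnj (v $ i) * (\<alpha> * z $ j + \<rho> * z $ i)"
  "part_B (exc_fun i j \<alpha> \<rho> b) z v = 2 * b * cnj (z $ i) * cnj (v $ i)"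
  by (simp_all add: part_A_def part_B_def antilinear_part_exc_fun field_simps)

lemma exceptional_eq:
  "exceptional i j ! 0 = {fun_graph (exc_fun i j 1 0 1)}"
  "exceptional i j ! 1 = {fun_graph (exc_fun i j 1 0 0)}"
  "exceptional i j ! 2 = {fun_graph (exc_fun i j 0 1 (complex_of_real a)) | a. a \<ge> 0}"
  "exceptional i j ! 3 = {fun_graph (exc_fun i j 0 0 1)}"
proof -
  have "complex_of_real ((cmod (z $ i))\<^sup>2) = cnj (z $ i) * z $ i" for z :: "complex ^ 'a"
    by (metis complex_norm_square mult.commute)
  then show "exceptional i j ! 2 = {fun_graph (exc_fun i j 0 1 (complex_of_real a)) | a. a \<ge> 0}"
    by (simp add: exceptional_def exc_fun_def[abs_def])
qed (simp_all add: exceptional_def exc_fun_def[abs_def])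

lemma not_equivalent_part_A_0:
  assumes "biholomorphically_equivalent (fun_graph (exc_fun i j \<alpha> \<rho> b)) (fun_graph (exc_fun i j 0 0 b'))"
    and ij: "i \<noteq> j"
  shows "\<alpha> = 0 \<and> \<rho> = 0"
proof -
  obtain L c where "c \<noteq> 0" "\<And>z v. part_A (exc_fun i j 0 0 b') (L z) (L v) = c * part_A (exc_fun i j \<alpha> \<rho> b) z v"
    using biholomorphic_parts[OF quadratic_exc_fun quadratic_exc_fun assms(1)] by metis
  then have "part_A (exc_fun i j \<alpha> \<rho> b) z v = 0" for z v by (simp add: parts_exc_fun)
  from this[of "axis j 1" "axis i 1"] this[of "axis i 1" "axis i 1"] show ?thesis
    using ij by (simp add: parts_exc_fun axis_def)
qed

lemma not_equivalent_part_B_0: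
  assumes "biholomorphically_equivalent (fun_graph (exc_fun i j \<alpha> \<rho> b)) (fun_graph (exc_fun i j \<alpha>' \<rho>' 0))"
  shows "b = 0"
proof -
  obtain L c where "c \<noteq> 0" "\<And>z v. part_B (exc_fun i j \<alpha>' \<rho>' 0) (L z) (L v) = c * part_B (exc_fun i j \<alpha> \<rho> b) z v"
    using biholomorphic_parts[OF quadratic_exc_fun quadratic_exc_fun assms(1)] by metis
  then have "part_B (exc_fun i j \<alpha> \<rho> b) z v = 0" for z v by (simp add: parts_exc_fun)
  from this[of "axis i 1" "axis i 1"] show ?thesis by (simp add: parts_exc_fun axis_def)
qed

text \<open>For the target, the left and right kernels of part A coincide.\<close>

lemma not_equivalent_kernel:
  assumes "biholomorphically_equivalent (fun_graph (exc_fun i j 1 0 b)) (fun_graph (exc_fun i j 0 1 b'))"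
    and ij: "i \<noteq> j"
  shows False
proof -
  obtain L c where c: "c \<noteq> 0" and A: "\<And>z v. part_A (exc_fun i j 0 1 b') (L z) (L v) = c * part_A (exc_fun i j 1 0 b) z v"
    using biholomorphic_parts[OF quadratic_exc_fun quadratic_exc_fun assms(1)] by metis
  \<comment> \<open>At (e_i, e_i) the source has part A zero, while the target gives |(L e_i)_i|^2.
    With (L e_i)_i = 0 the target vanishes at (L e_j, L e_i), where c times the source is c.\<close>
  have "L (axis i 1) $ i = 0"
    using A[of "axis i 1" "axis i 1"] ij by (simp add: parts_exc_fun axis_def)
  then show False
    using A[of "axis j 1" "axis i 1"] c ij by (simp add: parts_exc_fun axis_def)
qed

lemma exceptional_cases:
  assumes "N \<in> exceptional i j ! k" "k < 4"
  shows "(k = 0 \<and> N = fun_graph (exc_fun i j 1 0 1)) \<or> (k = 1 \<and> N = fun_graph (exc_fun i j 1 0 0)) \<or>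
    (k = 2 \<and> (\<exists>a. N = fun_graph (exc_fun i j 0 1 a))) \<or> (k = 3 \<and> N = fun_graph (exc_fun i j 0 0 1))"
proof -
  consider "k = 0" | "k = 1" | "k = 2" | "k = 3" using assms(2) by linarith
  then show ?thesis
  proof cases
    case 1 with assms(1) show ?thesis by (simp only: exceptional_eq) simp
  next
    case 2 with assms(1) show ?thesis by (simp only: exceptional_eq) simp
  next
    case 3 with assms(1) show ?thesis by (simp only: exceptional_eq) auto
  next
    case 4 with assms(1) show ?thesis by (simp only: exceptional_eq) simp
  qed
qed

text \<open>Vanishing of part A singles out case (4), part B separates (1) from (2), and the kernels
  of part A separate (3) from both. Symmetry of equivalence provides the direction that each
  criterion needs.\<close>

lemma exceptional_inequivalent:
  assumes ij: "i \<noteq> j" and kl: "k < 4" "l < 4" "k \<noteq> l"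
    and N: "N \<in> exceptional i j ! k" "N' \<in> exceptional i j ! l"
  shows "\<not> biholomorphically_equivalent N N'"
proof
  assume eq: "biholomorphically_equivalent N N'"
  note both = eq biholomorphically_equivalent_sym[OF eq]
  note A = not_equivalent_part_A_0[OF _ ij] and B = not_equivalent_part_B_0
    and K = not_equivalent_kernel[OF _ ij]
  show False
    using exceptional_cases[OF N(1) kl(1)] exceptional_cases[OF N(2) kl(2)] kl(3) both
    by (elim disjE conjE exE; hypsubst; auto dest: A B K)
qed

section \<open>Quadrics of rank one\<close>

definition bil :: "complex ^ 'n ^ 'n \<Rightarrow> complex ^ 'n \<Rightarrow> complex ^ 'n::finite \<Rightarrow> complex" where
  "bil B z v = (\<Sum>i\<in>UNIV. \<Sum>j\<in>UNIV. z $ i * B $ i $ j * v $ j)"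

definition cnj_vec :: "complex ^ 'n \<Rightarrow> complex ^ 'n" where
  "cnj_vec z = (\<chi> i. cnj (z $ i))"

lemma cnj_vec: "cnj_vec (x + y) = cnj_vec x + cnj_vec y" "cnj_vec (a *s x) = cnj a *s cnj_vec x"
  by (simp_all add: cnj_vec_def vec_eq_iff)

lemma bil_add: "bil B (x + y) v = bil B x v + bil B y v" "bil B v (x + y) = bil B v x + bil B v y"
  unfolding bil_def sum.distrib[symmetric] by (intro sum.cong refl, simp add: algebra_simps)+

lemma bil_scale: "bil B (a *s x) v = a * bil B x v" "bil B v (a *s x) = a * bil B v x"
  unfolding bil_def sum_distrib_left by (intro sum.cong refl, simp)+

lemma bil_minus: "bil B (- x) v = - bil B x v"
  by (simp add: bil_def sum_negf)

lemma bil_axis: "bil B (axis i 1) (axis j 1) = B $ i $ j"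
proof -
  have "bil B (axis i 1) (axis j 1) = (\<Sum>k\<in>UNIV. \<Sum>l\<in>UNIV. if l = j then (if k = i then B $ k $ l else 0) else 0)"
    unfolding bil_def by (intro sum.cong refl) (simp add: axis_def)
  then show ?thesis by simp
qed

lemma quadric_fun_bil: "quadric_fun A B C z = bil A (cnj_vec z) z + cnj (bil B z z) + bil C z z"
  by (simp add: quadric_fun_def bil_def cnj_vec_def)

lemma polar_quadric_fun: "polar (quadric_fun A B C) z v =
    bil A (cnj_vec z) v + bil A (cnj_vec v) z + cnj (bil B z v + bil B v z) + (bil C z v + bil C v z)"
  by (simp add: polar_def quadric_fun_bil cnj_vec bil_add)

lemma quadratic_quadric_fun: "quadratic (quadric_fun A B C)"
  unfolding quadratic_def
proof (intro conjI allI)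
  show "continuous_on UNIV (quadric_fun A B C)"
    unfolding quadric_fun_def[abs_def] by (intro continuous_intros)
  show "quadric_fun A B C (t *\<^sub>R z) = (complex_of_real t)\<^sup>2 * quadric_fun A B C z" for t z
    by (simp add: scaleR_vec_eq quadric_fun_bil cnj_vec bil_scale power2_eq_square algebra_simps)
  show "polar (quadric_fun A B C) (x + y) z =
      polar (quadric_fun A B C) x z + polar (quadric_fun A B C) y z" for x y z
    by (simp add: polar_quadric_fun cnj_vec bil_add)
qed

lemma antilinear_part_quadric_fun:
  "antilinear_part (quadric_fun A B C) z v = bil A (cnj_vec v) z + cnj (bil B z v + bil B v z)"
  by (simp add: antilinear_part_def polar_quadric_fun cnj_vec bil_scale bil_minus field_simps)

lemma parts_quadric_fun:
  "part_A (quadric_fun A B C) z v = bil A (cnj_vec v) z"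
  "part_B (quadric_fun A B C) z v = cnj (bil B z v + bil B v z)"
  by (simp_all add: part_A_def part_B_def antilinear_part_quadric_fun bil_scale field_simps)

text \<open>Every row of A^* and of B is a multiple of the row r, with factors conj s and t. Zero
  factors are allowed, so this is rank at most one.\<close>

definition rank_one_form :: "('n::finite \<Rightarrow> complex) \<Rightarrow> ('n \<Rightarrow> complex) \<Rightarrow> ('n \<Rightarrow> complex) \<Rightarrow>
    complex ^ 'n ^ 'n \<Rightarrow> complex ^ 'n ^ 'n \<Rightarrow> bool" where
  "rank_one_form r s t A B \<longleftrightarrow> (\<forall>j k. A $ j $ k = cnj (r j) * s k \<and> B $ k $ j = t k * r j)"

text \<open>In an exceptional form the parts depend on v only through conj v_i. Pulled back by L,
  both parts of Q therefore factor through the single linear form v \<mapsto> (L v)_i, whose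
  coefficients are r.\<close>

lemma equivalent_exc_imp_rank_one:
  assumes B: "transpose B = B"
    and eq: "biholomorphically_equivalent (fun_graph (quadric_fun A B C)) (fun_graph (exc_fun i j \<alpha> \<rho> b))"
  shows "\<exists>r s t. rank_one_form r s t A B"
proof -
  obtain L c where c: "c \<noteq> 0"
    and a: "\<And>z v. part_A (exc_fun i j \<alpha> \<rho> b) (L z) (L v) = c * part_A (quadric_fun A B C) z v"
    and b: "\<And>z v. part_B (exc_fun i j \<alpha> \<rho> b) (L z) (L v) = c * part_B (quadric_fun A B C) z v"
    using biholomorphic_parts[OF quadratic_quadric_fun quadratic_exc_fun eq] by metis
  define r where "r k = L (axis k 1) $ i" for k
  have ax: "cnj_vec (axis k 1) = axis k 1" for k by (simp add: cnj_vec_def axis_def vec_eq_iff)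
  have Bs: "B $ l $ k = B $ k $ l" for k l using B by (metis transpose_def vec_lambda_beta)
  have "A $ l $ k = cnj (r l) * ((\<alpha> * L (axis k 1) $ j + \<rho> * r k) / c)" for l k
    using a[of "axis k 1" "axis l 1"] c
    by (simp add: parts_quadric_fun parts_exc_fun ax bil_axis r_def field_simps)
  moreover have "B $ k $ l = (cnj b * r k / cnj c) * r l" for k l
  proof -
    have "c * (2 * cnj (B $ k $ l)) = 2 * b * cnj (r k) * cnj (r l)"
      using b[of "axis k 1" "axis l 1"]
      by (simp add: parts_quadric_fun parts_exc_fun bil_axis r_def Bs[of l k])
    then have "cnj (c * cnj (B $ k $ l)) = cnj (b * cnj (r k) * cnj (r l))" by simp
    then show ?thesis using c by (simp add: field_simps)
  qed
  ultimately have "rank_one_form r (\<lambda>k. (\<alpha> * L (axis k 1) $ j + \<rho> * r k) / c) (\<lambda>k. cnj b * r k / cnj c) A B"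
    unfolding rank_one_form_def by blast
  then show ?thesis by blast
qed

lemma rank_stack_iff:
  fixes A B :: "complex ^ 'n ^ 'n::finite"
  shows "rank (stack (adjoint_mat A) B) \<ge> 2 \<longleftrightarrow> \<not> (\<exists>r s t. rank_one_form r s t A B)"
proof -
  let ?R = "rows (stack (adjoint_mat A) B)"
  have mem: "x \<in> ?R \<longleftrightarrow> (\<exists>k. x = (\<chi> j. cnj (A $ j $ k))) \<or> (\<exists>k. x = B $ k)" for x
  proof
    assume "x \<in> ?R"
    then obtain i where i: "x = row i (stack (adjoint_mat A) B)" by (auto simp: rows_def)
    show "(\<exists>k. x = (\<chi> j. cnj (A $ j $ k))) \<or> (\<exists>k. x = B $ k)"
      unfolding i row_def stack_def adjoint_mat_def by (cases i) auto
  next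
    assume "(\<exists>k. x = (\<chi> j. cnj (A $ j $ k))) \<or> (\<exists>k. x = B $ k)"
    then show "x \<in> ?R"
    proof (elim disjE exE)
      fix k assume "x = (\<chi> j. cnj (A $ j $ k))"
      then have "x = row (Inl k) (stack (adjoint_mat A) B)"
        by (simp add: row_def stack_def adjoint_mat_def)
      then show ?thesis by (auto simp: rows_def)
    next
      fix k assume "x = B $ k"
      then have "x = row (Inr k) (stack (adjoint_mat A) B)" by (simp add: row_def stack_def)
      then show ?thesis by (auto simp: rows_def)
    qed
  qed
  show ?thesis
  proof
    assume ge: "rank (stack (adjoint_mat A) B) \<ge> 2"
    show "\<not> (\<exists>r s t. rank_one_form r s t A B)"
    proof
      assume "\<exists>r s t. rank_one_form r s t A B"
      then obtain r s t where rst: "\<And>j k. A $ j $ k = cnj (r j) * s k" "\<And>j k. B $ k $ j = t k * r j"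
        unfolding rank_one_form_def by blast
      have "?R \<subseteq> vec.span {\<chi> j. r j}"
      proof
        fix x assume "x \<in> ?R"
        then consider k where "x = cnj (s k) *s (\<chi> j. r j)" | k where "x = t k *s (\<chi> j. r j)"
          unfolding mem by (auto simp: rst vec_eq_iff mult.commute)
        then show "x \<in> vec.span {\<chi> j. r j}"
          by cases (simp_all add: vec.span_scale vec.span_base)
      qed
      then have "vec.dim ?R \<le> card {\<chi> j. r j}" by (rule vec.dim_le_card) simp
      then show False using ge by (simp add: row_rank_def_gen)
    qed
  next
    assume no: "\<not> (\<exists>r s t. rank_one_form r s t A B)"
    show "rank (stack (adjoint_mat A) B) \<ge> 2"
    proof (rule ccontr)
      assume "\<not> rank (stack (adjoint_mat A) B) \<ge> 2"
      then have lt: "vec.dim ?R < 2" by (simp add: row_rank_def_gen)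
      obtain S where S: "S \<subseteq> ?R" "vec.independent S" "?R \<subseteq> vec.span S" "card S = vec.dim ?R"
        using vec.basis_exists by blast
      have "finite S" using S(2) vec.finiteI_independent by blast
      \<comment> \<open>Rank zero is included: \<open>S\<close> may be empty.\<close>
      then have "\<exists>x. S \<subseteq> {x}"
        using lt S(4) by (cases "card S = 0") (auto simp: card_Suc_eq less_2_cases_iff)
      then obtain x where "S \<subseteq> {x}" by blast
      then have "?R \<subseteq> vec.span {x}" using S(3) vec.span_mono by blast
      then have sp: "\<exists>a. y = a *s x" if "y \<in> ?R" for y using that by (auto simp: vec.span_singleton)
      have "\<forall>k. \<exists>a. (\<chi> j. cnj (A $ j $ k)) = a *s x" using sp mem by blast
      then obtain a where a: "\<And>k. (\<chi> j. cnj (A $ j $ k)) = a k *s x" by metis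
      have "\<forall>k. \<exists>a. B $ k = a *s x" using sp mem by blast
      then obtain t where t: "\<And>k. B $ k = t k *s x" by metis
      have "A $ j $ k = cnj (x $ j) * cnj (a k)" for j k
      proof -
        have "cnj (A $ j $ k) = a k * x $ j" using a[of k] by (simp add: vec_eq_iff)
        then have "cnj (cnj (A $ j $ k)) = cnj (a k * x $ j)" by simp
        then show ?thesis by (simp add: mult.commute)
      qed
      moreover have "B $ k $ j = t k * x $ j" for j k by (simp add: t)
      ultimately have "rank_one_form (\<lambda>j. x $ j) (\<lambda>k. cnj (a k)) t A B"
        unfolding rank_one_form_def by blast
      then show False using no by blast
    qed
  qed
qed

section \<open>Normal forms by linear changes of coordinates\<close>

lemma coordinates_with_two_forms:
  fixes x y :: "'n::finite \<Rightarrow> complex"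
  assumes ij: "i \<noteq> j" and det: "x k * y l - x l * y k \<noteq> 0"
  obtains F G :: "complex ^ 'n \<Rightarrow> complex ^ 'n" where "Vector_Spaces.linear (*s) (*s) F" "Vector_Spaces.linear (*s) (*s) G"
    "\<And>z. G (F z) = z" "\<And>z. F (G z) = z"
    "\<And>z. F z $ i = (\<Sum>m\<in>UNIV. x m * z $ m)" "\<And>z. F z $ j = (\<Sum>m\<in>UNIV. y m * z $ m)"
proof -
  have kl: "k \<noteq> l" using det by auto
  \<comment> \<open>A permutation with i to k and j to l; the second transposition corrects the
    image of j without moving k. The slots other than i and j then receive exactly the coordinates
    other than k and l.\<close>
  define \<pi> where "\<pi> = Transposition.transpose (Transposition.transpose i k j) l \<circ> Transposition.transpose i k"
  have \<pi>: "\<pi> i = k" "\<pi> j = l" "bij \<pi>"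
    using ij kl by (auto simp: \<pi>_def Transposition.transpose_def intro!: bij_comp)
  define F where "F z = (\<chi> m. if m = i then \<Sum>m\<in>UNIV. x m * z $ m
    else if m = j then \<Sum>m\<in>UNIV. y m * z $ m else z $ \<pi> m)" for z :: "complex ^ 'n"
  have lin: "Vector_Spaces.linear (*s) (*s) F"
  proof
    show "F (z + v) = F z + F v" for z v
      by (simp add: F_def vec_eq_iff distrib_left sum.distrib)
    have "(\<Sum>m\<in>UNIV. x m * (a *s z) $ m) = a * (\<Sum>m\<in>UNIV. x m * z $ m)" for a x and z :: "complex ^ 'n"
      unfolding sum_distrib_left by (intro sum.cong) auto
    then show "F (a *s z) = a *s F z" for a z
      by (simp add: F_def vec_eq_iff)
  qed
  have "z = 0" if z: "F z = 0" for z
  proof -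
    have 1: "(\<Sum>m\<in>UNIV. x m * z $ m) = 0"
      using arg_cong[OF z, of "\<lambda>v. v $ i"] by (simp add: F_def)
    have 2: "(\<Sum>m\<in>UNIV. y m * z $ m) = 0"
      using arg_cong[OF z, of "\<lambda>v. v $ j"] ij by (simp add: F_def)
    have 3: "z $ m = 0" if "m \<noteq> k" "m \<noteq> l" for m
    proof -
      obtain m' where m': "m = \<pi> m'" using \<pi>(3) by (metis bij_pointE)
      then have "m' \<noteq> i" "m' \<noteq> j" using that \<pi> by auto
      then show ?thesis using arg_cong[OF z, of "\<lambda>v. v $ m'"] m' by (simp add: F_def)
    qed
    have s: "(\<Sum>m\<in>UNIV. w m * z $ m) = w k * z $ k + w l * z $ l" for w
    proof -
      have "(\<Sum>m\<in>UNIV. w m * z $ m) = (\<Sum>m\<in>{k, l}. w m * z $ m)"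
        by (rule sum.mono_neutral_right) (use 3 in auto)
      then show ?thesis using kl by simp
    qed
    \<comment> \<open>Cramer's rule for the two remaining unknowns z_k and z_l.\<close>
    have "(x k * y l - x l * y k) * z $ k = 0"
    proof -
      have "(x k * y l - x l * y k) * z $ k = y l * (x k * z $ k + x l * z $ l) - x l * (y k * z $ k + y l * z $ l)"
        by (simp add: algebra_simps)
      then show ?thesis using 1 2 unfolding s by simp
    qed
    moreover have "(x k * y l - x l * y k) * z $ l = 0"
    proof -
      have "(x k * y l - x l * y k) * z $ l = x k * (y k * z $ k + y l * z $ l) - y k * (x k * z $ k + x l * z $ l)"
        by (simp add: algebra_simps)
      then show ?thesis using 1 2 unfolding s by simp
    qed
    ultimately have "z $ k = 0" "z $ l = 0" using det by auto
    then have "z $ m = 0" for m using 3 by (cases "m = k"; cases "m = l") auto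
    then show ?thesis by (simp add: vec_eq_iff)
  qed
  then have "inj F" using vec.linear_inj_iff_eq_0[OF lin] by blast
  then obtain G where G: "Vector_Spaces.linear (*s) (*s) G" "\<forall>z. G (F z) = z" "\<forall>z. F (G z) = z"
    using vec.linear_injective_isomorphism[OF lin] by blast
  show ?thesis
    by (rule that[OF lin G(1)]) (use G ij in \<open>simp_all add: F_def\<close>)
qed

lemma bil_has_derivative:
  "((\<lambda>z. bil C z z) has_derivative (\<lambda>v. bil C z v + bil C v z)) (at z)"
proof -
  have "bilinear (bil C)"
    unfolding bilinear_def
    by (intro conjI allI linearI) (simp_all add: bil_add scaleR_vec_eq bil_scale scaleR_conv_of_real)
  then have "bounded_bilinear (bil C)" by (simp add: bilinear_conv_bounded_bilinear)
  from bounded_bilinear.FDERIV[OF this has_derivative_ident has_derivative_ident] show ?thesis .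
qed

lemma complex_linear_bounded_linear:
  fixes F :: "complex ^ 'n::finite \<Rightarrow> complex ^ 'n"
  assumes "Vector_Spaces.linear (*s) (*s) F" shows "bounded_linear F"
proof -
  interpret Vector_Spaces.linear "(*s)" "(*s)" F by fact
  have "linear F" by (rule linearI) (simp_all add: add scaleR_vec_eq scale)
  then show ?thesis by (simp add: linear_conv_bounded_linear)
qed

text \<open>The shear w - z^t C z removes a holomorphic quadratic term; combined with F and the
  factor e it is a polynomial automorphism, so both neighborhoods can be the whole space.\<close>

lemma equivalent_by_linear_change:
  fixes F G :: "complex ^ 'n::finite \<Rightarrow> complex ^ 'n"
  assumes F: "Vector_Spaces.linear (*s) (*s) F" and G: "Vector_Spaces.linear (*s) (*s) G"
    and inv: "\<And>z. G (F z) = z" "\<And>z. F (G z) = z" and e: "e \<noteq> 0"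
    and Q: "\<And>z. Q' (F z) = e * (Q z - bil C z z)"
  shows "biholomorphically_equivalent (fun_graph Q) (fun_graph Q')"
proof -
  interpret F: Vector_Spaces.linear "(*s)" "(*s)" F by fact
  interpret G: Vector_Spaces.linear "(*s)" "(*s)" G by fact
  define \<Phi> where "\<Phi> p = (F (fst p), e * (snd p - bil C (fst p) (fst p)))" for p
  define \<Psi> where "\<Psi> q = (G (fst q), snd q / e + bil C (G (fst q)) (G (fst q)))" for q
  have dF: "(F has_derivative F) (at z)" for z
    by (rule bounded_linear_imp_has_derivative[OF complex_linear_bounded_linear[OF F]])
  have dG: "(G has_derivative G) (at z)" for z
    by (rule bounded_linear_imp_has_derivative[OF complex_linear_bounded_linear[OF G]])
  have fst': "(fst has_derivative fst) (at p)" and snd': "(snd has_derivative snd) (at p)" for p :: "'n pt"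
    by (rule bounded_linear_imp_has_derivative, rule bounded_linear_fst bounded_linear_snd)+
  have d\<Phi>: "(\<Phi> has_derivative (\<lambda>v. (F (fst v), e * (snd v - (bil C (fst p) (fst v) + bil C (fst v) (fst p)))))) (at p)" for p
    unfolding \<Phi>_def[abs_def]
    by (intro has_derivative_Pair has_derivative_mult_right has_derivative_diff snd'
        has_derivative_compose[OF fst' dF] has_derivative_compose[OF fst' bil_has_derivative])
  have d\<Psi>: "(\<Psi> has_derivative (\<lambda>v. (G (fst v), snd v / e + (bil C (G (fst q)) (G (fst v)) + bil C (G (fst v)) (G (fst q)))))) (at q)" for q
    unfolding \<Psi>_def[abs_def] divide_inverse
    by (intro has_derivative_Pair has_derivative_mult_left has_derivative_add snd'
        has_derivative_compose[OF fst' dG] has_derivative_compose[OF has_derivative_compose[OF fst' dG] bil_has_derivative])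
  have h\<Phi>: "holomorphic_map_on \<Phi> UNIV"
    unfolding holomorphic_map_on_def
  proof (intro ballI)
    fix p
    show "\<exists>L. (\<Phi> has_derivative L) (at p) \<and> (\<forall>c v. L (pt_scale c v) = pt_scale c (L v))"
      by (rule exI, rule conjI[OF d\<Phi>[of p]])
        (simp add: pt_scale_def F.scale bil_scale algebra_simps)
  qed
  have h\<Psi>: "holomorphic_map_on \<Psi> UNIV"
    unfolding holomorphic_map_on_def
  proof (intro ballI)
    fix p
    show "\<exists>L. (\<Psi> has_derivative L) (at p) \<and> (\<forall>c v. L (pt_scale c v) = pt_scale c (L v))"
      by (rule exI, rule conjI[OF d\<Psi>[of p]])
        (simp add: pt_scale_def G.scale bil_scale distrib_left)
  qed
  have 1: "\<Psi> (\<Phi> p) = p" and 2: "\<Phi> (\<Psi> p) = p" for p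
    using e by (simp_all add: \<Phi>_def \<Psi>_def inv)
  have s1: "\<Phi> ` UNIV = UNIV" and s2: "\<Psi> ` UNIV = UNIV" using 1 2 by (metis surjI)+
  have 0: "\<Phi> 0 = 0" by (simp add: \<Phi>_def bil_def zero_prod_def)
  have M: "\<Phi> p \<in> fun_graph Q' \<longleftrightarrow> p \<in> fun_graph Q" for p
    using e by (simp add: \<Phi>_def fun_graph_def Q split_beta)
  have im: "\<Phi> ` (fun_graph Q \<inter> UNIV) = fun_graph Q' \<inter> UNIV"
  proof (intro set_eqI iffI)
    fix q assume "q \<in> fun_graph Q' \<inter> UNIV"
    then have "\<Psi> q \<in> fun_graph Q" using M[of "\<Psi> q"] by (simp add: 2)
    then show "q \<in> \<Phi> ` (fun_graph Q \<inter> UNIV)" using 2[of q] by (metis Int_UNIV_right imageI)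
  qed (use M in auto)
  show ?thesis unfolding biholomorphically_equivalent_def
    by (rule exI[of _ UNIV], rule exI[of _ UNIV], rule exI[of _ \<Phi>], rule exI[of _ \<Psi>],
      intro conjI ballI open_UNIV UNIV_I s1 s2 1 2 h\<Phi> h\<Psi> 0 im)
qed

lemma equivalent_exc_fun:
  fixes x y :: "'n::finite \<Rightarrow> complex"
  assumes ij: "i \<noteq> j" and det: "x k * y l - x l * y k \<noteq> 0" and e: "e \<noteq> 0"
    and Q: "\<And>z u v. u = (\<Sum>m\<in>UNIV. x m * z $ m) \<Longrightarrow> v = (\<Sum>m\<in>UNIV. y m * z $ m) \<Longrightarrow>
      cnj u * (\<alpha> * v + \<rho> * u) + b * (cnj u)\<^sup>2 = e * (Q z - bil C z z)"
  shows "biholomorphically_equivalent (fun_graph Q) (fun_graph (exc_fun i j \<alpha> \<rho> b))"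
proof -
  obtain F G :: "complex ^ 'n \<Rightarrow> complex ^ 'n" where FG: "Vector_Spaces.linear (*s) (*s) F" "Vector_Spaces.linear (*s) (*s) G"
    "\<And>z. G (F z) = z" "\<And>z. F (G z) = z"
    and F: "\<And>z. F z $ i = (\<Sum>m\<in>UNIV. x m * z $ m)" "\<And>z. F z $ j = (\<Sum>m\<in>UNIV. y m * z $ m)"
    by (rule coordinates_with_two_forms[where x=x and y=y, OF ij det]) (rule that)
  show ?thesis
    by (rule equivalent_by_linear_change[OF FG e]) (simp only: exc_fun_def Q[OF F])
qed

lemma rank_one_quadric:
  fixes A B C :: "complex ^ 'n ^ 'n::finite"
  assumes ro: "rank_one_form r s t A B" and B: "\<And>k j. B $ k $ j = \<mu> * r k * r j"
    and u: "u = (\<Sum>m\<in>UNIV. r m * z $ m)"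
  shows "quadric_fun A B C z - bil C z z = cnj u * (\<Sum>m\<in>UNIV. s m * z $ m) + cnj \<mu> * (cnj u)\<^sup>2"
proof -
  have "bil A (cnj_vec z) z = cnj u * (\<Sum>m\<in>UNIV. s m * z $ m)"
    using ro unfolding bil_def u cnj_vec_def rank_one_form_def cnj_sum sum_product
    by (intro sum.cong refl) simp
  moreover have "bil B z z = (\<Sum>i\<in>UNIV. \<Sum>j\<in>UNIV. \<mu> * ((r i * z $ i) * (r j * z $ j)))"
    unfolding bil_def by (intro sum.cong refl) (simp add: B)
  then have "bil B z z = \<mu> * (u * u)"
    unfolding u sum_product by (simp only: sum_distrib_left)
  ultimately show ?thesis by (simp add: quadric_fun_bil power2_eq_square)
qed

text \<open>With u = r . z, removing z^t C z leaves conj u * (s . z) + \<nu> (conj u)^2. If r and s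
  are independent, s . z becomes the second coordinate and the case is (2) or (1), according to
  whether \<nu> = 0. If s = \<rho> r, it is (4) for \<rho> = 0 and (3) otherwise.\<close>

lemma rank_one_equivalent_exceptional:
  fixes A B C :: "complex ^ 'n ^ 'n::finite"
  assumes ij: "i \<noteq> j" and ro: "rank_one_form r s t A B" and Bt: "transpose B = B"
    and nz: "A \<noteq> 0 \<or> B \<noteq> 0"
  shows "\<exists>E \<in> set (exceptional i j). \<exists>N \<in> E. biholomorphically_equivalent (fun_graph (quadric_fun A B C)) N"
proof -
  let ?M = "fun_graph (quadric_fun A B C)"
  have "\<exists>p. r p \<noteq> 0"
  proof (rule ccontr)
    assume "\<not> (\<exists>p. r p \<noteq> 0)"
    then have "A = 0" "B = 0" using ro by (simp_all add: rank_one_form_def vec_eq_iff)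
    then show False using nz by simp
  qed
  then obtain p where p: "r p \<noteq> 0" by blast
  \<comment> \<open>Symmetry of B makes t proportional to r; this is the factor.\<close>
  define \<mu> where "\<mu> = t p / r p"
  have B: "B $ k $ l = \<mu> * r k * r l" for k l
  proof -
    have "B $ k $ p = B $ p $ k" using Bt by (metis transpose_def vec_lambda_beta)
    then have "t k * r p = t p * r k" using ro by (simp add: rank_one_form_def)
    then have "t k = \<mu> * r k" using p by (simp add: \<mu>_def field_simps)
    then show ?thesis using ro by (simp add: rank_one_form_def)
  qed
  note Q = rank_one_quadric[OF ro B refl]
  define \<nu> where "\<nu> = cnj \<mu>"
  have mem: "exceptional i j ! n \<in> set (exceptional i j)" if "n < 4" for n
    by (rule nth_mem) (use that in \<open>simp add: exceptional_def\<close>)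
  \<comment> \<open>When r and s are dependent, the coordinate z_q serves as the second form;
    \<open>det1\<close> says that it is independent of r.\<close>
  obtain q where q: "q \<noteq> p" using ij by (metis (full_types))
  have det1: "c * r p * (if q = q then 1 else 0) - c * r q * (if p = q then 1 else (0::complex)) \<noteq> 0" if "c \<noteq> 0" for c
    using p q that by simp
  show ?thesis
  proof (cases "\<exists>k l. r k * s l - r l * s k \<noteq> 0")
    case True
    then obtain k l where kl: "r k * s l - r l * s k \<noteq> 0" by blast
    show ?thesis
    proof (cases "\<nu> = 0")
      case True
      have "biholomorphically_equivalent ?M (fun_graph (exc_fun i j 1 0 0))"
        by (rule equivalent_exc_fun[where e=1 and C=C, OF ij kl])
          (use True in \<open>simp_all add: Q \<nu>_def\<close>)
      then show ?thesis using mem[of 1] unfolding exceptional_eq by auto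
    next
      case False
      \<comment> \<open>Dividing the equation by \<nu> normalizes the coefficient of (conj u)^2 to
        1, and the factor 1 / \<nu> is moved into the second form.\<close>
      have det: "r k * (s l / \<nu>) - r l * (s k / \<nu>) \<noteq> 0"
        using kl False by (simp add: diff_divide_distrib[symmetric])
      have "biholomorphically_equivalent ?M (fun_graph (exc_fun i j 1 0 1))"
        by (rule equivalent_exc_fun[where e="1 / \<nu>" and C=C, OF ij det])
          (use False in \<open>simp_all add: Q \<nu>_def[symmetric] distrib_left flip: sum_divide_distrib\<close>)
      then show ?thesis using mem[of 0] unfolding exceptional_eq by auto
    qed
  next
    case False
    define \<rho> where "\<rho> = s p / r p"
    have "s k = \<rho> * r k" for k
    proof -
      have "r p * s k = r k * s p" using False by auto
      then show ?thesis using p by (simp add: \<rho>_def field_simps)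
    qed
    then have s: "(\<Sum>m\<in>UNIV. s m * z $ m) = \<rho> * (\<Sum>m\<in>UNIV. r m * z $ m)" for z :: "complex ^ 'n"
      by (simp add: sum_distrib_left mult.assoc)
    show ?thesis
    proof (cases "\<rho> = 0")
      case True
      have nu: "\<nu> \<noteq> 0"
      proof
        assume "\<nu> = 0"
        then have "A = 0" "B = 0" using ro B True \<open>\<And>k. s k = \<rho> * r k\<close>
          by (simp_all add: rank_one_form_def vec_eq_iff \<nu>_def)
        then show False using nz by simp
      qed
      have "biholomorphically_equivalent ?M (fun_graph (exc_fun i j 0 0 1))"
        by (rule equivalent_exc_fun[where e="1 / \<nu>" and C=C and x=r, OF ij det1[of 1, simplified mult_1]])
          (use nu True in \<open>simp_all add: Q s \<nu>_def[symmetric]\<close>)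
      then show ?thesis using mem[of 3] unfolding exceptional_eq by auto
    next
      case False
      define \<tau> where "\<tau> = \<nu> / \<rho>"
      \<comment> \<open>A rotation u \<mapsto> \<omega> u leaves |u|^2 alone and multiplies (conj
        u)^2 by conj(\<omega>)^2. A square root of the phase of \<tau> thus makes the coefficient
        real and nonnegative.\<close>
      obtain \<omega> where \<omega>: "cmod \<omega> = 1" "\<tau> = complex_of_real (cmod \<tau>) * (cnj \<omega>)\<^sup>2"
      proof (cases "\<tau> = 0")
        case True
        then show ?thesis using that[of 1] by simp
      next
        case False
        let ?w = "csqrt (sgn \<tau>)"
        have "cmod ?w = 1" using False by (simp add: norm_sgn)
        moreover have "\<tau> = complex_of_real (cmod \<tau>) * (cnj (cnj ?w))\<^sup>2"
          using False by (simp add: sgn_eq)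
        ultimately show ?thesis using that[of "cnj ?w"] by simp
      qed
      have w1: "cnj \<omega> * \<omega> = 1"
        using complex_norm_square[of \<omega>] \<omega>(1) by (simp add: mult.commute)
      have w0: "\<omega> \<noteq> 0" using \<omega>(1) by auto
      have sw: "(\<Sum>m\<in>UNIV. \<omega> * r m * z $ m) = \<omega> * (\<Sum>m\<in>UNIV. r m * z $ m)" for z :: "complex ^ 'n"
        by (simp add: sum_distrib_left mult.assoc)
      have eqv: "biholomorphically_equivalent ?M (fun_graph (exc_fun i j 0 1 (complex_of_real (cmod \<tau>))))"
      proof (rule equivalent_exc_fun[where e="1 / \<rho>" and C=C and x="\<lambda>m. \<omega> * r m", OF ij det1[OF w0]])
        show "1 / \<rho> \<noteq> 0" using False by simp
        fix z :: "complex ^ 'n" and u v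
        define U where "U = (\<Sum>m\<in>UNIV. r m * z $ m)"
        assume "u = (\<Sum>m\<in>UNIV. \<omega> * r m * z $ m)"
        then have u: "u = \<omega> * U" by (simp add: sw U_def)
        have "cnj u * (0 * v + 1 * u) + complex_of_real (cmod \<tau>) * (cnj u)\<^sup>2
          = (cnj \<omega> * \<omega>) * (cnj U * U) + (complex_of_real (cmod \<tau>) * (cnj \<omega>)\<^sup>2) * (cnj U)\<^sup>2"
          unfolding u by (simp add: power_mult_distrib algebra_simps)
        also have "\<dots> = cnj U * U + \<tau> * (cnj U)\<^sup>2" unfolding w1 \<omega>(2)[symmetric] by simp
        also have "\<dots> = 1 / \<rho> * (quadric_fun A B C z - bil C z z)"
          unfolding Q s U_def[symmetric] \<nu>_def[symmetric] \<tau>_def using False by (simp add: field_simps)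
        finally show "cnj u * (0 * v + 1 * u) + complex_of_real (cmod \<tau>) * (cnj u)\<^sup>2
          = 1 / \<rho> * (quadric_fun A B C z - bil C z z)" .
      qed
      have "fun_graph (exc_fun i j 0 1 (complex_of_real (cmod \<tau>))) \<in> exceptional i j ! 2"
        unfolding exceptional_eq by (intro CollectI exI[of _ "cmod \<tau>"] conjI refl norm_ge_zero)
      with eqv have "\<exists>N\<in>exceptional i j ! 2. biholomorphically_equivalent ?M N" by (rule bexI)
      then show ?thesis by (rule bexI) (rule mem, simp)
    qed
  qed
qed

section \<open>The equivalences\<close>

definition quad_poly :: "complex ^ 'n ^ 'n \<Rightarrow> complex ^ 'n ^ 'n \<Rightarrow> complex ^ 'n ^ 'n \<Rightarrow>
    ('n::finite + 'n \<Rightarrow> complex) \<Rightarrow> complex" where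
  "quad_poly A B C x = (\<Sum>i\<in>UNIV. \<Sum>j\<in>UNIV. x (Inr i) * A $ i $ j * x (Inl j))
    + (\<Sum>i\<in>UNIV. \<Sum>j\<in>UNIV. x (Inr i) * cnj (B $ i $ j) * x (Inr j))
    + (\<Sum>i\<in>UNIV. \<Sum>j\<in>UNIV. x (Inl i) * C $ i $ j * x (Inl j))"

text \<open>Coefficients of the linear form q_j in the independent variables z and conj z; the 2
  comes from the symmetry of B.\<close>

definition dbar_coeff :: "complex ^ 'n ^ 'n \<Rightarrow> complex ^ 'n ^ 'n \<Rightarrow> 'n \<Rightarrow> 'n + 'n \<Rightarrow> complex" where
  "dbar_coeff A B j = case_sum (\<lambda>k. A $ j $ k) (\<lambda>k. 2 * cnj (B $ j $ k))"

lemma quadric_fun_eq_quad_poly: "quadric_fun A B C = (\<lambda>z. quad_poly A B C (zz z))"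
  by (simp add: fun_eq_iff quadric_fun_def quad_poly_def)

lemma polyfun_quad_poly: "polyfun (quad_poly A B C)"
  unfolding quad_poly_def[abs_def] by (intro polyfun_intros) auto

lemma pd_bilinear_form:
  "pd v (\<lambda>x. \<Sum>i\<in>UNIV. \<Sum>j\<in>UNIV. x (f i) * a i j * x (g j)) x =
    (\<Sum>i\<in>UNIV. \<Sum>j\<in>UNIV. (if f i = v then a i j * x (g j) else 0) + (if g j = v then x (f i) * a i j else 0))"
  for f :: "'i::finite \<Rightarrow> 'v::finite" and g :: "'j::finite \<Rightarrow> 'v"
proof -
  have 1: "polyfun (\<lambda>x. x (f i) * a i j * x (g j))" for i j by (intro polyfun_intros)
  have 2: "polyfun (\<lambda>x. \<Sum>j\<in>UNIV. x (f i) * a i j * x (g j))" for i by (intro polyfun_intros) auto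
  have "pd v (\<lambda>x. x (f i) * a i j * x (g j)) x =
    (if f i = v then a i j * x (g j) else 0) + (if g j = v then x (f i) * a i j else 0)" for i j
    by (simp add: pd_mult polyfun_mult polyfun_var polyfun_const)
  then show ?thesis by (simp add: pd_sum 1 2)
qed

lemma pd_quad_poly:
  assumes "transpose B = B"
  shows "pd (Inr j) (quad_poly A B C) x = (\<Sum>u\<in>UNIV. dbar_coeff A B j u * x u)"
proof -
  have Bs: "B $ i $ j = B $ j $ i" for i using assms by (metis transpose_def vec_lambda_beta)
  have p: "polyfun (\<lambda>x::'a + 'a \<Rightarrow> complex. \<Sum>i\<in>UNIV. \<Sum>j\<in>UNIV. x (f i) * a i j * x (g j))"
    for f g :: "'a \<Rightarrow> 'a + 'a" and a by (intro polyfun_intros) auto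
  have si: "(\<Sum>k\<in>S. if P then g k else 0) = (if P then sum g S else 0)" for P S and g :: "'a \<Rightarrow> complex"
    by simp
  have "pd (Inr j) (quad_poly A B C) x =
    (\<Sum>k\<in>UNIV. A $ j $ k * x (Inl k)) +
    ((\<Sum>k\<in>UNIV. cnj (B $ j $ k) * x (Inr k)) + (\<Sum>k\<in>UNIV. x (Inr k) * cnj (B $ k $ j)))"
    unfolding quad_poly_def[abs_def]
    by (simp add: pd_add polyfun_add p pd_bilinear_form sum.distrib si)
  also have "(\<Sum>k\<in>UNIV. x (Inr k) * cnj (B $ k $ j)) = (\<Sum>k\<in>UNIV. cnj (B $ j $ k) * x (Inr k))"
    by (simp add: Bs mult.commute)
  finally show ?thesis
    by (simp add: sum_UNIV_Plus dbar_coeff_def mult.assoc flip: sum_distrib_left)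
qed

text \<open>The 2 x 2 minors through a nonzero pivot entry make every row a multiple of the pivot
  row, with factors c j. In contrapositive form it supplies the two independent entries of q
  required for extension.\<close>

lemma rank_one_iff_dbar_coeff:
  assumes B: "transpose B = B" and nz: "dbar_coeff A B j1 u1 \<noteq> 0"
    and eq: "\<And>j u. dbar_coeff A B j1 u1 * dbar_coeff A B j u = dbar_coeff A B j u1 * dbar_coeff A B j1 u"
  shows "\<exists>r s t. rank_one_form r s t A B"
proof -
  let ?W = "dbar_coeff A B"
  define c where "c j = ?W j u1 / ?W j1 u1" for j
  have W: "?W j u = c j * ?W j1 u" for j u
    using eq[of j u] nz by (simp add: c_def field_simps)
  have "A $ j $ k = cnj (cnj (c j)) * ?W j1 (Inl k)" for j k
    using W[of j "Inl k"] by (simp add: dbar_coeff_def)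
  moreover have "B $ k $ j = cnj (?W j1 (Inr k) / 2) * cnj (c j)" for j k
  proof -
    have "2 * cnj (B $ j $ k) = c j * ?W j1 (Inr k)" using W[of j "Inr k"] by (simp add: dbar_coeff_def)
    then have "cnj (2 * cnj (B $ j $ k)) = cnj (c j * ?W j1 (Inr k))" by simp
    moreover have "B $ j $ k = B $ k $ j" using B by (metis transpose_def vec_lambda_beta)
    ultimately show ?thesis by (simp add: mult.commute)
  qed
  ultimately have "rank_one_form (\<lambda>j. cnj (c j)) (\<lambda>k. ?W j1 (Inl k)) (\<lambda>k. cnj (?W j1 (Inr k) / 2)) A B"
    unfolding rank_one_form_def by blast
  then show ?thesis by blast
qed

section \<open>Linear functions, uniqueness and extension for the given quadric\<close>

lemma linear_zzbar_poly:
  fixes a b :: "complex ^ 'n::finite"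
  defines "h \<equiv> \<lambda>x. (\<Sum>j\<in>UNIV. a $ j * x (Inl j)) + (\<Sum>j\<in>UNIV. b $ j * x (Inr j))"
  shows "linear_zzbar a b = (\<lambda>z. h (zz z))" "polyfun h" "pd (Inr j) h x = b $ j"
    "\<exists>f. mpol_eval f = h \<and> weighted_homogeneous unit_weight 1 f"
proof -
  show "linear_zzbar a b = (\<lambda>z. h (zz z))" by (simp add: linear_zzbar_def h_def fun_eq_iff)
  show "polyfun h" unfolding h_def by (intro polyfun_intros) auto
  have p: "polyfun (\<lambda>x::'n + 'n \<Rightarrow> complex. c $ j * x (f j))" "polyfun (\<lambda>x::'n + 'n \<Rightarrow> complex. \<Sum>j\<in>UNIV. c $ j * x (f j))"
    for c :: "complex ^ 'n" and f :: "'n \<Rightarrow> 'n + 'n" and j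
    by (intro polyfun_intros; auto)+
  show "pd (Inr j) h x = b $ j"
    unfolding h_def by (simp add: pd_add p pd_sum pd_cmult polyfun_var if_distrib[of "\<lambda>x. _ * x"] cong: if_cong)
  let ?m = "\<lambda>c v. Poly_Mapping.single (Poly_Mapping.single v (1::nat)) c :: ('n + 'n) mpol"
  let ?f = "(\<Sum>j\<in>UNIV. ?m (a $ j) (Inl j)) + (\<Sum>j\<in>UNIV. ?m (b $ j) (Inr j))"
  have prod: "(\<Prod>w\<in>UNIV. x w ^ Poly_Mapping.lookup (Poly_Mapping.single v (1::nat)) w) = x v" for x :: "'n + 'n \<Rightarrow> complex" and v
  proof -
    have "(\<Prod>w\<in>UNIV. x w ^ Poly_Mapping.lookup (Poly_Mapping.single v (1::nat)) w)
      = (\<Prod>w\<in>UNIV. if w = v then x v else 1)"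
      by (intro prod.cong) (auto simp: lookup_single when_def)
    then show ?thesis by simp
  qed
  have "mpol_eval ?f x = h x" for x
    unfolding mpol_eval_add mpol_eval_sum[OF finite] mpol_eval_single prod h_def ..
  then have e: "mpol_eval ?f = h" by blast
  have "exp_weight unit_weight (Poly_Mapping.single v (1::nat)) = 1" for v :: "'n + 'n"
    by (simp add: exp_weight_def unit_weight_def lookup_single when_def)
  moreover have "Poly_Mapping.keys ?f \<subseteq> range (\<lambda>v. Poly_Mapping.single v (1::nat))"
  proof -
    have "Poly_Mapping.keys (\<Sum>j\<in>UNIV. ?m (c j) (g j)) \<subseteq> range (\<lambda>v. Poly_Mapping.single v (1::nat))" for c and g :: "'n \<Rightarrow> 'n + 'n"
    proof (rule order_trans[OF keys_sum])
      show "(\<Union>j\<in>UNIV. Poly_Mapping.keys (?m (c j) (g j))) \<subseteq> range (\<lambda>v. Poly_Mapping.single v (1::nat))"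
        by auto
    qed
    then show ?thesis by (intro order_trans[OF keys_add] Un_least)
  qed
  ultimately have "weighted_homogeneous unit_weight 1 ?f"
    unfolding weighted_homogeneous_def by blast
  with e show "\<exists>f. mpol_eval f = h \<and> weighted_homogeneous unit_weight 1 f" by blast
qed

text \<open>As w has weight two, it cannot occur in a polynomial of weight one.\<close>

lemma eval_zw_weight_1:
  fixes F :: "'n::finite option mpol"
  assumes "weighted_homogeneous zw_weight 1 F"
  shows "eval_zw F z w = eval_zw F z 0"
  unfolding eval_zw_def mpol_eval_def
proof (rule sum.cong[OF refl])
  fix m assume m: "m \<in> Poly_Mapping.keys F"
  have "zw_weight (None :: 'n option) * Poly_Mapping.lookup m None \<le> exp_weight zw_weight m"
    unfolding exp_weight_def
    using member_le_sum[of "None :: 'n option" UNIV "\<lambda>v. zw_weight v * Poly_Mapping.lookup m v"] by simp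
  then have "Poly_Mapping.lookup m None = 0"
    using assms m by (simp add: weighted_homogeneous_def zw_weight_def)
  then have "(case v of None \<Rightarrow> w | Some j \<Rightarrow> z $ j) ^ Poly_Mapping.lookup m v =
    (case v of None \<Rightarrow> 0 | Some j \<Rightarrow> z $ j) ^ Poly_Mapping.lookup m v" for v
    by (cases v) auto
  then show "Poly_Mapping.lookup F m * (\<Prod>v\<in>UNIV. (case v of None \<Rightarrow> w | Some j \<Rightarrow> z $ j) ^ Poly_Mapping.lookup m v) =
    Poly_Mapping.lookup F m * (\<Prod>v\<in>UNIV. (case v of None \<Rightarrow> 0 | Some j \<Rightarrow> z $ j) ^ Poly_Mapping.lookup m v)"
    by simp
qed

lemma eval_zw_diff: "eval_zw (F - G) z w = eval_zw F z w - eval_zw G z w"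
  by (simp add: eval_zw_def mpol_eval_diff)

lemma holomorphic_polynomial_zero_on_graph:
  fixes Q :: "complex ^ 'n::finite \<Rightarrow> complex"
  assumes B: "transpose B = B" and Q: "Q = quadric_fun A B C" and W: "dbar_coeff A B j u \<noteq> 0"
    and z: "\<And>z. eval_zw G z (Q z) = 0"
  shows "G = 0"
proof -
  let ?q = "quad_poly A B C"
  have "mpol_eval G (case_option (?q x) (\<lambda>j. x (Inl j))) = 0" for x
    by (rule polyfun_zero_on_zz[OF polyfun_weighted[OF polyfun_mpol_eval polyfun_quad_poly]])
      (use z in \<open>simp add: eval_zw_def Q quadric_fun_eq_quad_poly\<close>)
  moreover obtain d where "polyfun_deg d (mpol_eval G)"
    using polyfun_mpol_eval[of G] unfolding polyfun_def by blast
  ultimately have "mpol_eval G = (\<lambda>y. 0)"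
    by (intro polyfun_zero_on_graph[OF polyfun_quad_poly pd_quad_poly[OF B] W])
  then show "G = 0" by (intro mpol_eq_0_if_eval_0) metis
qed

lemma CR_polynomial_extends:
  fixes Q :: "complex ^ 'n::finite \<Rightarrow> complex"
  assumes B: "transpose B = B" and Q: "Q = quadric_fun A B C" and W1: "dbar_coeff A B j1 u1 \<noteq> 0"
    and W2: "dbar_coeff A B j1 u1 * dbar_coeff A B j2 u2 \<noteq> dbar_coeff A B j2 u1 * dbar_coeff A B j1 u2"
    and nz: "pd (Inr j0) (quad_poly A B C) \<noteq> (\<lambda>x. 0)"
    and CR: "CR_function (fun_graph Q) (\<lambda>p. eval_zzbar f (fst p))"
  shows "\<exists>F. \<forall>z. eval_zzbar f z = eval_zw F z (Q z)"
proof -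
  let ?q = "quad_poly A B C"
  have pq: "polyfun ?q" and pf: "polyfun (mpol_eval f)"
    by (rule polyfun_quad_poly, rule polyfun_mpol_eval)
  have "CR_function (fun_graph (\<lambda>z. ?q (zz z))) (\<lambda>p. mpol_eval f (zz (fst p)))"
    using CR by (simp add: Q quadric_fun_eq_quad_poly eval_zzbar_eq)
  then have e: "pd (Inr k) ?q (zz z) * pd (Inr j) (mpol_eval f) (zz z) = pd (Inr j) ?q (zz z) * pd (Inr k) (mpol_eval f) (zz z)" for z j k
    unfolding CR_function_fun_graph_iff[OF pq nz pf] by blast
  \<comment> \<open>The CR relations hold at the points (z, conj z) and spread to independent
    variables by the identity theorem.\<close>
  have e': "pd (Inr k) ?q x * pd (Inr j) (mpol_eval f) x = pd (Inr j) ?q x * pd (Inr k) (mpol_eval f) x" for x j k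
  proof -
    have "(\<lambda>x. pd (Inr k) ?q x * pd (Inr j) (mpol_eval f) x - pd (Inr j) ?q x * pd (Inr k) (mpol_eval f) x) x = 0"
      by (rule polyfun_zero_on_zz, intro polyfun_diff polyfun_mult polyfun_pd pq pf) (simp add: e[of k])
    then show ?thesis by simp
  qed
  obtain d where d: "polyfun_deg d (mpol_eval f)" using pf unfolding polyfun_def by blast
  obtain F where F: "polyfun F" "\<forall>x. mpol_eval f x = F (case_option (?q x) (\<lambda>j. x (Inl j)))"
    using CR_polyfun_extends[OF pq pd_quad_poly[OF B] W1 W2 d e'] by blast
  obtain P where P: "F = mpol_eval P" using polyfun_imp_mpol_eval[OF F(1)] by blast
  have "eval_zzbar f z = eval_zw P z (Q z)" for z
    using F(2) by (simp add: eval_zzbar_eq eval_zw_def Q quadric_fun_eq_quad_poly P)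
  then show ?thesis by blast
qed

theorem theorem1p2:
  fixes A B C :: "complex ^ 'n ^ 'n::finite"
    and Q :: "complex ^ 'n \<Rightarrow> complex"
    and M :: "((complex ^ 'n) \<times> complex) set"
    and i1 i2 :: 'n
  assumes n_ge_2: "CARD('n) \<ge> 2"
    and indices: "i1 \<noteq> i2"
    and B_sym: "transpose B = B"
    and C_sym: "transpose C = C"
    and Q_def: "Q = quadric_fun A B C"
    and M_def: "M = fun_graph Q"
    and dbar_nonzero: "\<exists>z j. dbar Q z j \<noteq> 0"
  defines "cond_a \<equiv> rank (stack (adjoint_mat A) B) \<ge> 2"
    and "cond_b \<equiv>
      (\<forall>f :: ('n + 'n) mpol. CR_function M (\<lambda>p. eval_zzbar f (fst p)) \<longrightarrow>
         (\<exists>!F :: 'n option mpol. \<forall>z. eval_zzbar f z = eval_zw F z (Q z)) \<and>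
         (\<forall>F :: 'n option mpol. (\<forall>z. eval_zzbar f z = eval_zw F z (Q z)) \<longrightarrow>
            weighted_degree zw_weight F = weighted_degree unit_weight f \<and>
            (\<forall>d. weighted_homogeneous unit_weight d f \<longrightarrow> weighted_homogeneous zw_weight d F)))"
    and "cond_c \<equiv>
      (\<forall>a b :: complex ^ 'n. CR_function M (\<lambda>p. linear_zzbar a b (fst p)) \<longrightarrow> (\<forall>j. b $ j = 0))"
    and "cond_d \<equiv>
      (\<forall>E \<in> set (exceptional i1 i2). \<forall>N \<in> E. \<not> biholomorphically_equivalent M N)"
  shows "(cond_a \<longleftrightarrow> cond_b) \<and> (cond_a \<longleftrightarrow> cond_c) \<and> (cond_a \<longleftrightarrow> cond_d) \<and>
    (\<forall>k < 4. \<forall>l < 4. k \<noteq> l \<longrightarrow>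
       (\<forall>N \<in> exceptional i1 i2 ! k. \<forall>N' \<in> exceptional i1 i2 ! l.
          \<not> biholomorphically_equivalent N N'))"
proof -
  let ?q = "quad_poly A B C" and ?W = "dbar_coeff A B"
  note pq = polyfun_quad_poly[of A B C] and pdq = pd_quad_poly[OF B_sym, of _ A C]
  have Qq: "Q = (\<lambda>z. ?q (zz z))" unfolding Q_def by (rule quadric_fun_eq_quad_poly)
  obtain z0 j0 where zj: "pd (Inr j0) ?q (zz z0) \<noteq> 0"
    using dbar_nonzero unfolding Qq dbar_eq_pd[OF pq] by blast
  then have nz: "pd (Inr j0) ?q \<noteq> (\<lambda>x. 0)" by metis
  obtain u0 where W0: "?W j0 u0 \<noteq> 0"
    using zj unfolding pdq by (metis (no_types, lifting) mult_zero_left sum.neutral)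
  have a_iff: "cond_a \<longleftrightarrow> \<not> (\<exists>r s t. rank_one_form r s t A B)"
    unfolding cond_a_def by (rule rank_stack_iff)
  note unique = holomorphic_polynomial_zero_on_graph[OF B_sym Q_def W0]
  have hom: "Q (complex_of_real t *s z) = (complex_of_real t)\<^sup>2 * Q z" for t z
    using quadratic_quadric_fun[of A B C] unfolding quadratic_def Q_def scaleR_vec_eq by blast
  have ab: cond_b if a: cond_a
    unfolding cond_b_def
  proof (intro allI impI)
    obtain j2 u2 where W2: "?W j0 u0 * ?W j2 u2 \<noteq> ?W j2 u0 * ?W j0 u2"
      using rank_one_iff_dbar_coeff[OF B_sym W0] a unfolding a_iff by blast
    fix f :: "('n + 'n) mpol" assume CR: "CR_function M (\<lambda>p. eval_zzbar f (fst p))"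
    obtain F where F: "\<forall>z. eval_zzbar f z = eval_zw F z (Q z)"
      using CR_polynomial_extends[OF B_sym Q_def W0 W2 nz CR[unfolded M_def]] by blast
    have "\<exists>!F. \<forall>z. eval_zzbar f z = eval_zw F z (Q z)"
    proof (rule ex1I[of _ F])
      show "\<forall>z. eval_zzbar f z = eval_zw F z (Q z)" by (rule F)
      fix G assume G: "\<forall>z. eval_zzbar f z = eval_zw G z (Q z)"
      have "eval_zw (G - F) z (Q z) = 0" for z using F G by (simp add: eval_zw_diff)
      from unique[OF this] show "G = F" by simp
    qed
    moreover have "weighted_degree zw_weight F = weighted_degree unit_weight f \<and>
        (\<forall>d. weighted_homogeneous unit_weight d f \<longrightarrow> weighted_homogeneous zw_weight d F)"
      if "\<forall>z. eval_zzbar f z = eval_zw F z (Q z)" for F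
      using degree_of_extension[OF hom that[rule_format] unique] by blast
    ultimately show "(\<exists>!F. \<forall>z. eval_zzbar f z = eval_zw F z (Q z)) \<and>
      (\<forall>F. (\<forall>z. eval_zzbar f z = eval_zw F z (Q z)) \<longrightarrow>
        weighted_degree zw_weight F = weighted_degree unit_weight f \<and>
        (\<forall>d. weighted_homogeneous unit_weight d f \<longrightarrow> weighted_homogeneous zw_weight d F))"
      by blast
  qed
  have bc: cond_c if b: cond_b
    unfolding cond_c_def
  proof (intro allI impI)
    fix a b :: "complex ^ 'n" and j
    assume CR: "CR_function M (\<lambda>p. linear_zzbar a b (fst p))"
    let ?h = "\<lambda>x::'n + 'n \<Rightarrow> complex. (\<Sum>j\<in>UNIV. a $ j * x (Inl j)) + (\<Sum>j\<in>UNIV. b $ j * x (Inr j))"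
    obtain f where f: "mpol_eval f = ?h" "weighted_homogeneous unit_weight 1 f"
      using linear_zzbar_poly(4)[of a b] by blast
    have ef: "eval_zzbar f z = linear_zzbar a b z" for z
      by (simp add: eval_zzbar_eq f(1) linear_zzbar_poly(1))
    then have "CR_function M (\<lambda>p. eval_zzbar f (fst p))" using CR by simp
    then obtain F where F: "\<And>z. eval_zzbar f z = eval_zw F z (Q z)" "weighted_homogeneous zw_weight 1 F"
      using b f(2) unfolding cond_b_def by blast
    \<comment> \<open>F has weight one and is free of w, so w = 0 may be inserted; this makes the
      second term a function of z alone.\<close>
    let ?g = "\<lambda>x. ?h x - mpol_eval F (case_option 0 (\<lambda>j. x (Inl j)))"
    have "polyfun ?g"
      by (intro polyfun_diff linear_zzbar_poly(2) polyfun_weighted[OF polyfun_mpol_eval polyfun_const])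
    moreover have "?g (zz z) = 0" for z
    proof -
      have "?h (zz z) = eval_zw F z 0"
        using F(1)[of z] eval_zw_weight_1[OF F(2)] by (simp add: eval_zzbar_eq f(1))
      then show ?thesis by (simp add: eval_zw_def)
    qed
    ultimately have g: "?g x = 0" for x by (rule polyfun_zero_on_zz)
    have "(\<Sum>l\<in>UNIV. b $ l * (if l = j then 1 else 0)) = b $ j"
      by (simp add: if_distrib[of "\<lambda>x. _ * x"] cong: if_cong)
    \<comment> \<open>Both test points have z = 0 and differ only in conj z_j, so their difference
      is b_j.\<close>
    then show "b $ j = 0"
      using g[of "case_sum (\<lambda>l. 0) (\<lambda>l. if l = j then 1 else 0)"] g[of "\<lambda>_. 0"] by simp
  qed
  have ca: cond_a if c: cond_c
    unfolding a_iff
  proof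
    assume "\<exists>r s t. rank_one_form r s t A B"
    then obtain r s t where ro: "rank_one_form r s t A B" by blast
    \<comment> \<open>In the rank-one case q_j = conj(r_j) times one linear form, with coefficients
      w. Hence the sum of conj(r_j) conj z_j has dbar proportional to q and is CR without being
      holomorphic.\<close>
    define w where "w = case_sum s (\<lambda>k. 2 * cnj (t k))"
    have "B $ j $ k = B $ k $ j" for j k using B_sym by (metis transpose_def vec_lambda_beta)
    then have W: "?W j u = cnj (r j) * w u" for j u
      using ro by (cases u) (simp_all add: rank_one_form_def dbar_coeff_def w_def)
    define b where "b = (\<chi> j. cnj (r j))"
    let ?h = "\<lambda>x::'n + 'n \<Rightarrow> complex. (\<Sum>j\<in>UNIV. 0 $ j * x (Inl j)) + (\<Sum>j\<in>UNIV. b $ j * x (Inr j))"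
    have pdq': "pd (Inr j) ?q x = cnj (r j) * (\<Sum>u\<in>UNIV. w u * x u)" for j x
      unfolding pdq W sum_distrib_left by (simp only: mult.assoc)
    have "CR_function M (\<lambda>p. linear_zzbar 0 b (fst p))"
      unfolding M_def Qq linear_zzbar_poly(1)
      unfolding CR_function_fun_graph_iff[OF pq nz linear_zzbar_poly(2)]
        linear_zzbar_poly(3) pdq' b_def by simp
    then have "b $ j0 = 0" using c unfolding cond_c_def by blast
    then show False using W0 W by (simp add: b_def)
  qed
  have da: "cond_a \<longleftrightarrow> cond_d"
  proof
    assume a: cond_a
    show cond_d
      unfolding cond_d_def
    proof (intro ballI notI)
      fix E N assume EN: "E \<in> set (exceptional i1 i2)" "N \<in> E" and eq: "biholomorphically_equivalent M N"
      obtain k where k: "k < 4" "E = exceptional i1 i2 ! k"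
      proof -
        have "length (exceptional i1 i2) = 4" by (simp add: exceptional_def)
        then show ?thesis using EN(1) that unfolding in_set_conv_nth by metis
      qed
      obtain \<alpha> \<rho> b where "N = fun_graph (exc_fun i1 i2 \<alpha> \<rho> b)"
        using exceptional_cases[OF EN(2)[unfolded k(2)] k(1)] by blast
      then show False
        using equivalent_exc_imp_rank_one[OF B_sym] eq a unfolding a_iff M_def Q_def by blast
    qed
  next
    assume d: cond_d
    have AB: "A \<noteq> 0 \<or> B \<noteq> 0"
    proof (rule ccontr)
      assume "\<not> ?thesis"
      then show False using W0 by (cases u0) (simp_all add: dbar_coeff_def)
    qed
    show cond_a
      unfolding a_iff
    proof
      assume "\<exists>r s t. rank_one_form r s t A B"
      then obtain r s t where ro: "rank_one_form r s t A B" by blast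
      show False
        using rank_one_equivalent_exceptional[OF indices ro B_sym AB, of C] d
        unfolding cond_d_def M_def Q_def by blast
    qed
  qed
  have "\<forall>k < 4. \<forall>l < 4. k \<noteq> l \<longrightarrow>
       (\<forall>N \<in> exceptional i1 i2 ! k. \<forall>N' \<in> exceptional i1 i2 ! l. \<not> biholomorphically_equivalent N N')"
    by (intro allI impI ballI) (rule exceptional_inequivalent[OF indices])
  then show ?thesis using ab bc ca da by blast
qed

end
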